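(* Let $1\le r\le n-1$ and $k\ge1$. Let $\mathcal P\in Newt$ be the Newton polygon attached to $H$. The group $H$ has a canonical subgroup of rank $r$ and level $k$ if and only if $\mathcal P$ belongs to the half-apartment of $Newt$ attached to the open half-apartment $\{x\in Q:\alpha_{r,r+1}(x)>k-1\}$ of the quarter $Q$, i.e. if and only if $$\lambda_r^{(k)}>\lambda_{r+1}.$$
   Context: $F/\mathbb{Q}_p$ is a finite extension, $\mathcal O=\mathcal O_F$, $\pi$ a uniformizer, $q$ the residue cardinality. $K|F$ is a field complete for a valuation $v:K\to\mathbb R\cup\{+\infty\}$ extending that of $F$ ($v(\pi)=1$), extended to an algebraic closure $\overline K$. $H$ is a formal $\mathcal O$-module ($\pi$-divisible, $\mathcal O$ acting on the Lie algebra through $\mathcal O\to\mathcal O_K$) of dimension $1$ and height $n$ over $\mathcal O_K$. For a torsion point $y$ of $H$ over $\mathcal O_{\overline K}$, $v(y)$ is the valuation of its coordinate under an isomorphism of pointed formal schemes $\widehat H\simeq\mathrm{Spf}(\mathcal O_K[[T]])$ (independent of choices; $v(0)=+\infty$). A canonical subgroup of rank $r$ and level $k$ is a sub-$\mathcal O_F/\pi^k\mathcal O_F$-module $M\subset H[\pi^k](\mathcal O_{\overline K})$, free of rank $r$, such that $v(x)>v(y)$ for all $x\in M$ and all $y\in H[\pi^k](\mathcal O_{\overline K})\setminus M$. $\mathcal P$ is given by its slopes $\lambda_1\ge\dots\ge\lambda_n>0$: the valuations of the non-zero points of $H[\pi](\mathcal O_{\overline K})$, $\lambda_i$ being counted for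 $q^i-q^{i-1}$ points. With $\eta(s)=s+\sum_{i=1}^n(q^i-q^{i-1})\min(s,\lambda_i)$ (increasing bijection of $[0,+\infty[$), $\lambda_i^{(1)}=\lambda_i$ and $\lambda_i^{(k+1)}=\eta^{-1}(\lambda_i^{(k)})$. $Q$ is the quarter $\{a_1\le\dots\le a_n\}$ of the standard apartment $\mathbb R^n/\mathbb R$ of the building of $\mathrm{PGL}_n(F)$, $\alpha_{ij}(a)=a_j-a_i$; the half-apartment $\{\alpha_{ij}>b\}$ of $Q$ ($b\in\mathbb N$, $i<j$) corresponds to $\{\lambda_i^{(b+1)}>\lambda_j\}$ in the set $Newt$ of Newton polygons. *)

theory Defs
  imports
    "HOL-Algebra.Algebraic_Closure_Type"
    "HOL-Algebra.Module"
    "HOL-Library.Extended_Real"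
    "HOL-Library.Multiset"
begin

section \<open>Valued fields\<close>

definition valuation :: "('a::field \<Rightarrow> ereal) \<Rightarrow> bool" where
  "valuation v \<longleftrightarrow>
     (\<forall>x. v x \<noteq> -\<infinity>) \<and>
     (\<forall>x. v x = \<infinity> \<longleftrightarrow> x = 0) \<and>
     (\<forall>x y. v (x * y) = v x + v y) \<and>
     (\<forall>x y. min (v x) (v y) \<le> v (x + y))"

definition vlim :: "('a::field \<Rightarrow> ereal) \<Rightarrow> (nat \<Rightarrow> 'a) \<Rightarrow> 'a \<Rightarrow> bool" where
  "vlim v s l \<longleftrightarrow> (\<lambda>n. v (s n - l)) \<longlonglongrightarrow> \<infinity>"

definition vCauchy :: "('a::field \<Rightarrow> ereal) \<Rightarrow> (nat \<Rightarrow> 'a) \<Rightarrow> bool" where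
  "vCauchy v s \<longleftrightarrow> (\<forall>c::real. \<exists>N. \<forall>m\<ge>N. \<forall>n\<ge>N. ereal c < v (s m - s n))"

definition vcomplete :: "('a::field \<Rightarrow> ereal) \<Rightarrow> 'a set \<Rightarrow> bool" where
  "vcomplete v S \<longleftrightarrow> (\<forall>s. range s \<subseteq> S \<and> vCauchy v s \<longrightarrow> (\<exists>l\<in>S. vlim v s l))"

definition valuation_ring :: "('a::field \<Rightarrow> ereal) \<Rightarrow> 'a ring" where
  "valuation_ring v = ring_of_type_algebra\<lparr>carrier := {x. 0 \<le> v x}\<rparr>"

definition maximal_ideal :: "('a::field \<Rightarrow> ereal) \<Rightarrow> 'a set" where
  "maximal_ideal v = {x. 0 < v x}"

definition residue_card :: "('a::field \<Rightarrow> ereal) \<Rightarrow> nat" where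
  "residue_card v = Coset.order (valuation_ring v Quot maximal_ideal v)"

definition uniformizer :: "('a::field \<Rightarrow> ereal) \<Rightarrow> 'a \<Rightarrow> bool" where
  "uniformizer v \<pi> \<longleftrightarrow>
     \<pi> \<in> carrier (valuation_ring v) \<and> \<pi> \<noteq> 0 \<and>
     PIdl\<^bsub>valuation_ring v\<^esub> \<pi> = maximal_ideal v"

text \<open>\<open>\<rat>\<^sub>p\<close> as the completion of \<open>\<rat>\<close> for its \<open>p\<close>-adic valuation: a subfield which is complete, in
  which \<open>\<rat>\<close> is dense, and whose valuation restricts to the \<open>p\<close>-adic one on \<open>\<int>\<close>. The factor \<open>e\<close> (the
  ramification index of an extension) allows for valuations that are not normalised at \<open>p\<close>.\<close>

definition padic_rationals :: "nat \<Rightarrow> ('a::field_char_0 \<Rightarrow> ereal) \<Rightarrow> 'a set \<Rightarrow> bool" where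
  "padic_rationals p v L \<longleftrightarrow>
     subfield L ring_of_type_algebra \<and>
     vcomplete v L \<and>
     (\<forall>x\<in>L. \<forall>c::real. \<exists>r::rat. ereal c < v (x - of_rat r)) \<and>
     (\<exists>e::real. 0 < e \<and>
        (\<forall>m::int. m \<noteq> 0 \<longrightarrow> v (of_int m) = ereal (e * real (multiplicity (int p) m))))"

definition padic_field :: "nat \<Rightarrow> ('a::field_char_0 \<Rightarrow> ereal) \<Rightarrow> bool" where
  "padic_field p v \<longleftrightarrow>
     valuation v \<and>
     (\<exists>L. padic_rationals p v L \<and> ring.finite_dimension ring_of_type_algebra L UNIV)"

definition field_embedding :: "('a::field \<Rightarrow> 'b::field) \<Rightarrow> bool" where
  "field_embedding \<iota> \<longleftrightarrow>
     \<iota> 1 = 1 \<and> (\<forall>x y. \<iota> (x + y) = \<iota> x + \<iota> y) \<and> (\<forall>x y. \<iota> (x * y) = \<iota> x * \<iota> y)"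


section \<open>One-dimensional formal \<open>\<O>\<close>-modules\<close>

text \<open>A power series \<open>\<Sum> c\<^sub>i\<^sub>j X\<^sup>i Y\<^sup>j\<close> in two variables is an iterated power series \<open>F\<close> with
  \<open>c\<^sub>i\<^sub>j = F $ i $ j\<close>; likewise for three variables. All identities between power series are
  expressed in the ring of power series in \<open>X, Y, Z\<close>.\<close>

definition varX :: "'k::comm_ring_1 fps fps fps" where "varX = fps_X"
definition varY :: "'k::comm_ring_1 fps fps fps" where "varY = fps_const fps_X"
definition varZ :: "'k::comm_ring_1 fps fps fps" where "varZ = fps_const (fps_const fps_X)"

text \<open>Substitution of series \<open>A, B\<close> without constant term. Since \<open>A\<^sup>i B\<^sup>j\<close> only has terms of total
  degree at least \<open>i + j\<close>, only the indices \<open>i, j \<le> a + b + c\<close> contribute to the coefficient of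
  \<open>X\<^sup>a Y\<^sup>b Z\<^sup>c\<close>.\<close>

definition subst1 :: "'k::comm_ring_1 fps \<Rightarrow> 'k fps fps fps \<Rightarrow> 'k fps fps fps" where
  "subst1 f A = Abs_fps (\<lambda>a. Abs_fps (\<lambda>b. Abs_fps (\<lambda>c.
     \<Sum>i\<le>a + b + c. f $ i * (A ^ i) $ a $ b $ c)))"

definition subst2 ::
    "'k::comm_ring_1 fps fps \<Rightarrow> 'k fps fps fps \<Rightarrow> 'k fps fps fps \<Rightarrow> 'k fps fps fps" where
  "subst2 F A B = Abs_fps (\<lambda>a. Abs_fps (\<lambda>b. Abs_fps (\<lambda>c.
     \<Sum>i\<le>a + b + c. \<Sum>j\<le>a + b + c. F $ i $ j * (A ^ i * B ^ j) $ a $ b $ c)))"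

definition formal_group_law :: "('k::field \<Rightarrow> ereal) \<Rightarrow> 'k fps fps \<Rightarrow> bool" where
  "formal_group_law v F \<longleftrightarrow>
     (\<forall>i j. 0 \<le> v (F $ i $ j)) \<and>
     subst2 F varX 0 = varX \<and>
     subst2 F 0 varY = varY \<and>
     subst2 F varX varY = subst2 F varY varX \<and>
     subst2 F (subst2 F varX varY) varZ = subst2 F varX (subst2 F varY varZ)"

text \<open>\<open>act a\<close> is the series \<open>[a](T)\<close>; only its values at \<open>a \<in> \<O>\<close> matter. The condition on
  \<open>act a $ 1\<close> says that \<open>\<O>\<close> acts on the Lie algebra through \<open>\<O> \<rightarrow> \<O>\<^sub>K\<close>.\<close>

definition formal_O_module ::
    "('f::field \<Rightarrow> ereal) \<Rightarrow> ('k::field \<Rightarrow> ereal) \<Rightarrow> ('f \<Rightarrow> 'k) \<Rightarrow> 'k fps fps \<Rightarrow> ('f \<Rightarrow> 'k fps) \<Rightarrow> bool" where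
  "formal_O_module vF v \<iota> F act \<longleftrightarrow>
     formal_group_law v F \<and>
     (\<forall>a\<in>carrier (valuation_ring vF).
        (\<forall>i. 0 \<le> v (act a $ i)) \<and> act a $ 0 = 0 \<and> act a $ 1 = \<iota> a \<and>
        subst1 (act a) (subst2 F varX varY) =
          subst2 F (subst1 (act a) varX) (subst1 (act a) varY)) \<and>
     act 1 = fps_X \<and>
     (\<forall>a\<in>carrier (valuation_ring vF). \<forall>b\<in>carrier (valuation_ring vF).
        subst1 (act (a + b)) varX = subst2 F (subst1 (act a) varX) (subst1 (act b) varX) \<and>
        act (a * b) = fps_compose (act a) (act b))"

text \<open>\<open>\<pi>\<close>-divisible of height \<open>n\<close>: the reduction of \<open>[\<pi>](T)\<close> modulo the maximal ideal is non-zero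
  of order \<open>q\<^sup>n\<close>, i.e. \<open>H[\<pi>]\<close> is finite of order \<open>q\<^sup>n\<close>.\<close>

definition has_height :: "('k::field \<Rightarrow> ereal) \<Rightarrow> nat \<Rightarrow> 'k fps \<Rightarrow> nat \<Rightarrow> bool" where
  "has_height v q f n \<longleftrightarrow> v (f $ (q ^ n)) = 0 \<and> (\<forall>i < q ^ n. 0 < v (f $ i))"


section \<open>Torsion points and canonical subgroups\<close>

text \<open>Sums of power series with integral coefficients at points of positive valuation of the
  algebraic closure (whose valuation is \<open>w\<close>). The closure need not be complete, but the sum lies in
  the finite extension of the complete field \<open>K\<close> generated by the points.\<close>

definition eval1 :: "('k::field alg_closure \<Rightarrow> ereal) \<Rightarrow> 'k fps \<Rightarrow> 'k alg_closure \<Rightarrow> 'k alg_closure" where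
  "eval1 w f x = (THE z. vlim w (\<lambda>N. \<Sum>i<N. to_ac (f $ i) * x ^ i) z)"

definition eval2 ::
    "('k::field alg_closure \<Rightarrow> ereal) \<Rightarrow> 'k fps fps \<Rightarrow> 'k alg_closure \<Rightarrow> 'k alg_closure \<Rightarrow> 'k alg_closure" where
  "eval2 w F x y = (THE z. vlim w (\<lambda>N. \<Sum>i<N. \<Sum>j<N. to_ac (F $ i $ j) * x ^ i * y ^ j) z)"

definition torsion_points ::
    "('k::field alg_closure \<Rightarrow> ereal) \<Rightarrow> ('f::field \<Rightarrow> 'k fps) \<Rightarrow> 'f \<Rightarrow> 'k alg_closure set" where
  "torsion_points w act a = {x. 0 < w x \<and> eval1 w (act a) x = 0}"

definition O_mod :: "('f::field \<Rightarrow> ereal) \<Rightarrow> 'f \<Rightarrow> nat \<Rightarrow> 'f set ring" where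
  "O_mod vF \<pi> k = valuation_ring vF Quot (PIdl\<^bsub>valuation_ring vF\<^esub> (\<pi> ^ k))"

text \<open>\<open>H[\<pi>\<^sup>k]\<close> as an \<open>\<O>/\<pi>\<^sup>k\<O>\<close>-module: a residue class acts through any of its representatives.
  The fields \<open>mult\<close> and \<open>one\<close> play no role for modules.\<close>

definition torsion_module ::
    "('k::field alg_closure \<Rightarrow> ereal) \<Rightarrow> 'k fps fps \<Rightarrow> ('f::field \<Rightarrow> 'k fps) \<Rightarrow> 'f \<Rightarrow> nat
     \<Rightarrow> ('f set, 'k alg_closure) module" where
  "torsion_module w F act \<pi> k =
     \<lparr>carrier = torsion_points w act (\<pi> ^ k), monoid.mult = undefined, one = undefined,
      ring.zero = 0, add = eval2 w F,
      module.smult = (\<lambda>C x. eval1 w (act (SOME a. a \<in> C)) x)\<rparr>"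

definition free_of_rank ::
    "('a, 'c) ring_scheme \<Rightarrow> ('a, 'b, 'd) module_scheme \<Rightarrow> 'b set \<Rightarrow> nat \<Rightarrow> bool" where
  "free_of_rank R N M r \<longleftrightarrow>
     (\<exists>e. (\<forall>i<r. e i \<in> M) \<and>
        bij_betw (\<lambda>a. \<Oplus>\<^bsub>N\<^esub>i\<in>{..<r}. a i \<odot>\<^bsub>N\<^esub> e i) ({..<r} \<rightarrow>\<^sub>E carrier R) M)"

definition canonical_subgroup ::
    "('f::field \<Rightarrow> ereal) \<Rightarrow> 'f \<Rightarrow> ('k::field alg_closure \<Rightarrow> ereal) \<Rightarrow> 'k fps fps \<Rightarrow> ('f \<Rightarrow> 'k fps)
     \<Rightarrow> nat \<Rightarrow> nat \<Rightarrow> 'k alg_closure set \<Rightarrow> bool" where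
  "canonical_subgroup vF \<pi> w F act r k M \<longleftrightarrow>
     submodule M (O_mod vF \<pi> k) (torsion_module w F act \<pi> k) \<and>
     free_of_rank (O_mod vF \<pi> k) (torsion_module w F act \<pi> k) M r \<and>
     (\<forall>x\<in>M. \<forall>y\<in>torsion_points w act (\<pi> ^ k) - M. w y < w x)"


section \<open>Newton polygons\<close>

text \<open>A Newton polygon is given by its slopes \<open>lam 1 \<ge> \<dots> \<ge> lam n > 0\<close>, the slope \<open>lam i\<close> (up to sign)
  being that of the segment over \<open>[q\<^sup>i\<^sup>-\<^sup>1, q\<^sup>i]\<close>; values of \<open>lam\<close> outside \<open>{1..n}\<close> are irrelevant.
  The polygon goes from \<open>(1, v(\<pi>)) = (1, 1)\<close> to \<open>(q\<^sup>n, 0)\<close>, hence the last condition.\<close>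

definition Newt :: "nat \<Rightarrow> nat \<Rightarrow> (nat \<Rightarrow> real) set" where
  "Newt q n = {lam. antimono_on {1..n} lam \<and> (\<forall>i\<in>{1..n}. 0 < lam i) \<and>
                  (\<Sum>i=1..n. (real q ^ i - real q ^ (i - 1)) * lam i) = 1}"

definition newton_slopes ::
    "('k::field alg_closure \<Rightarrow> ereal) \<Rightarrow> ('f::field \<Rightarrow> 'k fps) \<Rightarrow> 'f \<Rightarrow> nat \<Rightarrow> nat \<Rightarrow> (nat \<Rightarrow> real) \<Rightarrow> bool" where
  "newton_slopes w act \<pi> q n lam \<longleftrightarrow>
     antimono_on {1..n} lam \<and> (\<forall>i\<in>{1..n}. 0 < lam i) \<and>
     image_mset w (mset_set (torsion_points w act \<pi> - {0})) =
       (\<Sum>i=1..n. replicate_mset (q ^ i - q ^ (i - 1)) (ereal (lam i)))"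

definition eta :: "nat \<Rightarrow> nat \<Rightarrow> (nat \<Rightarrow> real) \<Rightarrow> real \<Rightarrow> real" where
  "eta q n lam s = s + (\<Sum>i=1..n. (real q ^ i - real q ^ (i - 1)) * min s (lam i))"

text \<open>\<open>slope_iter q n lam k i\<close> is \<open>\<lambda>\<^sub>i\<^sup>(\<^sup>k\<^sup>)\<close>, for \<open>k \<ge> 1\<close>.\<close>

definition slope_iter :: "nat \<Rightarrow> nat \<Rightarrow> (nat \<Rightarrow> real) \<Rightarrow> nat \<Rightarrow> nat \<Rightarrow> real" where
  "slope_iter q n lam k i = (the_inv_into {0..} (eta q n lam) ^^ (k - 1)) (lam i)"


section \<open>The quarter and its half-apartments\<close>

definition coord_vectors :: "nat \<Rightarrow> (nat \<Rightarrow> real) set" where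
  "coord_vectors n = {1..n} \<rightarrow>\<^sub>E UNIV"

definition diagonal_rel :: "nat \<Rightarrow> ((nat \<Rightarrow> real) \<times> (nat \<Rightarrow> real)) set" where
  "diagonal_rel n = {(a, b). a \<in> coord_vectors n \<and> b \<in> coord_vectors n \<and>
                             (\<exists>c. \<forall>i\<in>{1..n}. b i = a i + c)}"

definition apartment :: "nat \<Rightarrow> (nat \<Rightarrow> real) set set" where
  "apartment n = coord_vectors n // diagonal_rel n"

definition quarter :: "nat \<Rightarrow> (nat \<Rightarrow> real) set set" where
  "quarter n = {x \<in> apartment n. \<forall>a\<in>x. mono_on {1..n} a}"

definition half_apartment :: "nat \<Rightarrow> nat \<Rightarrow> nat \<Rightarrow> nat \<Rightarrow> (nat \<Rightarrow> real) set set" where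
  "half_apartment n i j b = {x \<in> quarter n. \<forall>a\<in>x. real b < a j - a i}"

text \<open>The half-apartment of \<open>Newt\<close> attached to a half-apartment \<open>A\<close> of the quarter. For
  \<open>1 \<le> i < j \<le> n\<close>, the set \<open>half_apartment n i j b\<close> determines \<open>(i, j, b)\<close>.\<close>

definition Newt_half_apartment ::
    "nat \<Rightarrow> nat \<Rightarrow> (nat \<Rightarrow> real) set set \<Rightarrow> (nat \<Rightarrow> real) set" where
  "Newt_half_apartment q n A =
     {lam \<in> Newt q n. \<exists>i j b. 1 \<le> i \<and> i < j \<and> j \<le> n \<and> A = half_apartment n i j b \<and>
                             lam j < slope_iter q n lam (b + 1) i}"

end

(* The points of H in the maximal ideal of the valuation ring of the algebraic closure form an
   ultrametric O-module, because a power series with coefficients in the complete field K converges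
   at such points, in a finite extension of K. Comparing [pi](T) with its truncations, which are
   polynomials with exactly q^n roots of positive valuation, shows that multiplication by pi is
   surjective and that v(pi y) is the sum of the v(y - h) over h in H[pi].

   Hence v(pi y) >= eta(v(y)), and every x has a preimage y under pi with v(x) = eta(v(y)): one of
   maximal valuation. If lambda_r^(k) > lambda_{r+1}, let M be the set of x in H[pi^k] with
   v(x) >= lambda_r^(k). Then M[pi] has q^r elements, each of them is pi^(k-1) times an element of M,
   and so a basis of M[pi] over O/pi lifts to a basis of M over O/pi^k. Conversely, if M is canonical,
   then M[pi] = pi^(k-1) M contains a non-zero x with v(x) <= lambda_r, so that x = pi^(k-1) y with
   v(y) <= lambda_r^(k), whereas a point of H[pi] outside M has valuation at least lambda_{r+1}. *)

theory Submission
  imports Defs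
begin

section \<open>Valuations\<close>

text \<open>Completeness is available only in finite-dimensional K-subalgebras of the closure, so a
  solution of [\<pi>](y) = x is not obtained as a limit of roots of longer and longer truncations. A
  single truncation is used: its roots exist because the closure is algebraically closed, one of
  them solves the equation up to an error of valuation above 2, and that error is corrected inside
  one finite extension, where [\<pi>] is its linear term plus a contraction. For the product
  formula, the number of points of H[\<pi>] is known from the slopes and agrees with the number of
  roots of positive valuation of the truncation, so close points and roots match bijectively and the
  series itself is never factored. The function \<eta> is what this formula becomes when v(y - h) is
  replaced by min(v(y), v(h)): a lower bound in general, an equality for the best preimage.
  Iterating, \<lambda>_r^(k) is the largest valuation of a point y with \<pi>^(k-1) y = x when v(x)
  = \<lambda>_r, and this makes it the threshold at level k.\<close>

locale valued_field =
  fixes w :: "'a::field \<Rightarrow> ereal"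
  assumes valuation: "valuation w"
begin

lemma w_neq_minf [simp]: "w x \<noteq> -\<infinity>"
  using valuation by (auto simp: valuation_def)

lemma w_eq_inf_iff [simp]: "w x = \<infinity> \<longleftrightarrow> x = 0"
  using valuation by (auto simp: valuation_def)

lemma w_0 [simp]: "w 0 = \<infinity>"
  by simp

lemma w_mult: "w (x * y) = w x + w y"
  using valuation by (auto simp: valuation_def)

lemma w_add_ge: "c \<le> w x \<Longrightarrow> c \<le> w y \<Longrightarrow> c \<le> w (x + y)"
  using valuation by (auto simp: valuation_def intro: order_trans[of _ "min (w x) (w y)"])

lemma w_real: assumes "x \<noteq> 0" obtains r where "w x = ereal r"
  using assms by (cases "w x") auto

lemma w_1 [simp]: "w 1 = 0"
proof -
  obtain r where r: "w 1 = ereal r" using w_real[of 1] by auto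
  then show ?thesis using w_mult[of 1 1] by (simp add: zero_ereal_def)
qed

lemma w_uminus [simp]: "w (- x) = w x"
proof -
  obtain r where r: "w (- 1) = ereal r" using w_real[of "-1"] by auto
  then have "w (- 1) = 0" using w_mult[of "-1" "-1"] by (simp add: zero_ereal_def)
  then show ?thesis using w_mult[of "-1" x] by simp
qed

lemma w_diff_ge: "c \<le> w x \<Longrightarrow> c \<le> w y \<Longrightarrow> c \<le> w (x - y)"
  using w_add_ge[of c x "-y"] by simp

lemma w_diff_commute: "w (x - y) = w (y - x)"
  by (metis minus_diff_eq w_uminus)

lemma w_trans: "c \<le> w (x - y) \<Longrightarrow> c \<le> w (y - z) \<Longrightarrow> c \<le> w (x - z)"
  using w_add_ge[of c "x - y" "y - z"] by simp

lemma w_sum_ge: "(\<And>i. i \<in> A \<Longrightarrow> c \<le> w (f i)) \<Longrightarrow> c \<le> w (sum f A)"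
  by (induction A rule: infinite_finite_induct) (auto intro: w_add_ge)

lemma w_add_eq: assumes "w x < w y" shows "w (x + y) = w x"
proof (rule antisym)
  show "w x \<le> w (x + y)" using assms by (intro w_add_ge) auto
  show "w (x + y) \<le> w x"
  proof (rule ccontr)
    assume "\<not> w (x + y) \<le> w x"
    then have "w x < min (w (x + y)) (w y)" using assms by auto
    also have "\<dots> \<le> w (x + y - y)" by (intro w_diff_ge) auto
    finally show False by simp
  qed
qed

lemma w_eq_of_close: "w x < w (x - y) \<Longrightarrow> w y = w x"
  using w_add_eq[of x "y - x"] by (simp add: w_diff_commute)

lemma w_power: "w (x ^ n) = ereal (real n) * w x"
proof (induction n)
  case 0 then show ?case by (simp add: zero_ereal_def[symmetric])
next
  case (Suc n)
  show ?case
    by (cases "w x") (simp_all add: w_mult Suc algebra_simps add_nonneg_pos)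
qed

lemma w_power_ge: assumes "ereal c \<le> w x" shows "ereal (real n * c) \<le> w (x ^ n)"
proof (cases "w x")
  case (real r)
  with assms show ?thesis by (simp add: w_power mult_left_mono)
qed (use assms in \<open>auto simp: w_power zero_ereal_def[symmetric]\<close>)

lemma w_mult_ge: "ereal a \<le> w x \<Longrightarrow> ereal b \<le> w y \<Longrightarrow> ereal (a + b) \<le> w (x * y)"
  unfolding w_mult plus_ereal.simps(1)[symmetric] by (rule add_mono)

lemma w_mult_nonneg: "0 \<le> w x \<Longrightarrow> 0 \<le> w y \<Longrightarrow> 0 \<le> w (x * y)"
  unfolding w_mult by simp

lemma w_mult_ge_right: "0 \<le> w x \<Longrightarrow> c \<le> w y \<Longrightarrow> c \<le> w (x * y)"
  unfolding w_mult using add_mono[of 0 "w x" c "w y"] by simp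

lemma w_power_nonneg: "0 \<le> w x \<Longrightarrow> 0 \<le> w (x ^ n)"
  by (induction n) (auto intro: w_mult_nonneg)

lemma pos_lower_bound:
  assumes "0 < w x" obtains \<mu> where "0 < \<mu>" "ereal \<mu> \<le> w x"
proof (cases "w x")
  case (real r) then show ?thesis using assms that[of r] by auto
next
  case PInf then show ?thesis using that[of 1] by auto
qed (use assms in auto)

lemma eq_if_arbitrarily_close:
  assumes "\<And>c. ereal c \<le> w (a - b)" shows "a = b"
proof -
  have "w (a - b) = \<infinity>" by (metis assms ereal_top)
  then show ?thesis by simp
qed

section \<open>Limits and Cauchy sequences for a valuation\<close>

lemma vlim_iff: "vlim w s l \<longleftrightarrow> (\<forall>c. \<forall>\<^sub>F n in sequentially. ereal c < w (s n - l))"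
  unfolding vlim_def tendsto_PInfty ..

lemma vlim_unique: assumes "vlim w s a" "vlim w s b" shows "a = b"
proof (rule eq_if_arbitrarily_close)
  fix c
  have "\<forall>\<^sub>F n in sequentially. ereal c < w (s n - a) \<and> ereal c < w (s n - b)"
    using assms by (auto simp: vlim_iff intro: eventually_conj)
  then obtain n where "ereal c < w (s n - a)" "ereal c < w (s n - b)"
    using eventually_happens'[OF sequentially_bot] by blast
  then show "ereal c \<le> w (a - b)"
    using w_trans[of "ereal c" a "s n" b] by (auto simp: w_diff_commute[of a])
qed

text \<open>This rate is the one produced by power series: at a point of valuation at least \<mu>,
  the terms of degree at least N of an integral series have valuation at least N \<mu>.\<close>

lemma vlim_I_linear:
  assumes "0 < \<mu>" "\<And>N::nat. ereal (real N * \<mu>) \<le> w (s N - l)" shows "vlim w s l"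
  unfolding vlim_iff
proof
  fix c
  obtain N :: nat where N: "c < real N * \<mu>"
    using assms(1) reals_Archimedean3[of \<mu>] by meson
  show "\<forall>\<^sub>F n in sequentially. ereal c < w (s n - l)"
  proof (rule eventually_sequentiallyI[of N])
    fix n assume "N \<le> n"
    then have "c < real n * \<mu>" using N assms(1) by (meson less_le_trans mult_right_mono less_imp_le of_nat_le_iff)
    then show "ereal c < w (s n - l)" using assms(2)[of n] by (meson ereal_less(2) less_ereal.simps(1) less_le_trans)
  qed
qed

text \<open>Closed balls are closed, because \<open>w (s n - a)\<close> equals
  \<open>w (l - a)\<close> as soon as \<open>s n\<close> is closer to \<open>l\<close> than
  \<open>a\<close> is.\<close>

lemma vlim_le:
  assumes "vlim w s l" "\<forall>\<^sub>F n in sequentially. c \<le> w (s n - a)" shows "c \<le> w (l - a)"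
proof (cases "l = a")
  case False
  then obtain r where r: "w (l - a) = ereal r" using w_real[of "l - a"] by auto
  have "\<forall>\<^sub>F n in sequentially. ereal r < w (s n - l) \<and> c \<le> w (s n - a)"
    using assms by (auto simp: vlim_iff intro: eventually_conj)
  then obtain n where n: "ereal r < w (s n - l)" "c \<le> w (s n - a)"
    using eventually_happens'[OF sequentially_bot] by blast
  have "w (s n - a) = w (l - a)"
    using w_add_eq[of "l - a" "s n - l"] n r by simp
  then show ?thesis using n by simp
qed simp

lemma vlim_imp_vCauchy: assumes "vlim w s l" shows "vCauchy w s"
  unfolding vCauchy_def
proof
  fix c
  obtain N where N: "\<And>n. n \<ge> N \<Longrightarrow> ereal (c + 1) < w (s n - l)"
    using assms by (auto simp: vlim_iff eventually_sequentially)
  have "ereal c < w (s m - s n)" if "m \<ge> N" "n \<ge> N" for m n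
  proof -
    have "ereal (c + 1) \<le> w (s m - s n)"
      using N[OF that(1)] N[OF that(2)] w_trans[of _ "s m" l "s n"] by (auto simp: w_diff_commute[of l])
    then show ?thesis by (rule less_le_trans[rotated]) simp
  qed
  then show "\<exists>N. \<forall>m\<ge>N. \<forall>n\<ge>N. ereal c < w (s m - s n)" by blast
qed

text \<open>By the ultrametric inequality a bound on consecutive differences bounds all later
  differences, with no sum of errors.\<close>

lemma vCauchy_I_linear:
  assumes "0 < \<mu>" "\<And>N::nat. ereal (real N * \<mu>) \<le> w (s (Suc N) - s N)" shows "vCauchy w s"
  unfolding vCauchy_def
proof
  fix c
  obtain N :: nat where N: "c < real N * \<mu>"
    using assms(1) reals_Archimedean3[of \<mu>] by meson
  have *: "ereal (real N * \<mu>) \<le> w (s m - s N)" if "m \<ge> N" for m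
    using that
  proof (induction m rule: dec_induct)
    case (step m)
    have "real N * \<mu> \<le> real m * \<mu>" using step assms(1) by (simp add: mult_right_mono)
    then have "ereal (real N * \<mu>) \<le> w (s (Suc m) - s m)"
      using assms(2)[of m] by (meson ereal_less_eq(3) order_trans)
    then show ?case using step w_trans by blast
  qed simp
  have "ereal c < w (s m - s n)" if "m \<ge> N" "n \<ge> N" for m n
  proof -
    have "ereal (real N * \<mu>) \<le> w (s m - s n)"
      using *[OF that(1)] *[OF that(2)] w_trans[of _ "s m" "s N" "s n"] by (auto simp: w_diff_commute[of "s N"])
    then show ?thesis using N by (meson less_ereal.simps(1) less_le_trans)
  qed
  then show "\<exists>N. \<forall>m\<ge>N. \<forall>n\<ge>N. ereal c < w (s m - s n)" by blast
qed

end


section \<open>Complete subrings of the algebraic closure\<close>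

text \<open>The ring \<open>E\<close> is an auxiliary place of convergence. The value of a series
  does not depend on it, since limits are unique in the whole closure.\<close>

locale complete_subring = valued_field +
  fixes E
  assumes E_1: "1 \<in> E"
    and E_diff: "x \<in> E \<Longrightarrow> y \<in> E \<Longrightarrow> x - y \<in> E"
    and E_mult: "x \<in> E \<Longrightarrow> y \<in> E \<Longrightarrow> x * y \<in> E"
    and E_complete: "vcomplete w E"
begin

lemma E_0: "0 \<in> E" using E_diff[OF E_1 E_1] by simp
lemma E_uminus: "x \<in> E \<Longrightarrow> - x \<in> E" using E_diff[OF E_0] by simp
lemma E_add: "x \<in> E \<Longrightarrow> y \<in> E \<Longrightarrow> x + y \<in> E" using E_diff[of x "-y"] E_uminus by simp
lemma E_power: "x \<in> E \<Longrightarrow> x ^ n \<in> E" by (induction n) (auto intro: E_1 E_mult)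
lemma E_sum: "(\<And>i. i \<in> A \<Longrightarrow> f i \<in> E) \<Longrightarrow> sum f A \<in> E"
  by (induction A rule: infinite_finite_induct) (auto intro: E_0 E_add)

end

locale complete_valued_field =
  base: valued_field v + valued_field w
  for v :: "'k::field \<Rightarrow> ereal" and w :: "'k alg_closure \<Rightarrow> ereal" +
  assumes complete: "vcomplete v UNIV"
    and w_to_ac: "w (to_ac x) = v x"
begin

sublocale ac: vector_space "\<lambda>c x. to_ac c * x :: 'k alg_closure"
  by unfold_locales (auto simp: algebra_simps)

text \<open>A complete \<open>V\<close> is closed, so \<open>w (e - u)\<close> is bounded by some
  \<open>C\<close> for \<open>u\<close> in \<open>V\<close>. Dividing by \<open>c\<close> gives
  \<open>w (c e + u) \<le> v c + C\<close>; hence the K-coordinates of a Cauchy sequence are Cauchy,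
  and so are the components in \<open>V\<close>.\<close>

lemma vcomplete_insert:
  assumes V: "ac.subspace V" and cV: "vcomplete w V" and e: "e \<notin> V"
  shows "vcomplete w {to_ac c * e + u |c u. u \<in> V}"
  unfolding vcomplete_def
proof (intro allI impI, elim conjE)
  obtain C where C: "\<And>u. u \<in> V \<Longrightarrow> w (e - u) \<le> ereal C"
  proof (rule ccontr)
    assume "\<not> thesis"
    then have "\<forall>n. \<exists>u\<in>V. ereal (real n) < w (e - u)"
      using that by (meson not_le)
    then obtain u where u: "\<And>n. u n \<in> V" "\<And>n. ereal (real n) < w (e - u n)" by metis
    have lim: "vlim w u e"
      using u(2) by (intro vlim_I_linear[of 1]) (auto simp: w_diff_commute[of _ e] intro: less_imp_le)
    then obtain l where "l \<in> V" "vlim w u l"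
      using cV u(1) vlim_imp_vCauchy unfolding vcomplete_def by blast
    with lim e show False using vlim_unique by blast
  qed
  have bound: "w (to_ac c * e + u) \<le> v c + ereal C" if "u \<in> V" for c u
  proof (cases "c = 0")
    case False
    have "to_ac c * inverse (to_ac c) = 1" using False by simp
    then have "to_ac c * e + u = to_ac c * (e - to_ac (- inverse c) * u)"
      by (simp add: distrib_left mult.assoc[symmetric])
    moreover have "w (e - to_ac (- inverse c) * u) \<le> ereal C"
      using V that by (intro C) (rule ac.subspace_scale)
    ultimately show ?thesis by (simp add: w_mult w_to_ac add_left_mono del: to_ac_minus to_ac_inverse)
  qed simp
  fix s assume s: "range s \<subseteq> {to_ac c * e + u |c u. u \<in> V}" and Cau: "vCauchy w s"
  have "\<forall>n. \<exists>c u. s n = to_ac c * e + u \<and> u \<in> V" using s by blast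
  then obtain c u where cu: "\<And>n. s n = to_ac (c n) * e + u n" "\<And>n. u n \<in> V" by metis
  have "vCauchy v c"
    unfolding vCauchy_def
  proof
    fix d
    obtain N where N: "\<And>m n. m \<ge> N \<Longrightarrow> n \<ge> N \<Longrightarrow> ereal (d + C) < w (s m - s n)"
      using Cau unfolding vCauchy_def by blast
    have "ereal d < v (c m - c n)" if "m \<ge> N" "n \<ge> N" for m n
    proof -
      have "s m - s n = to_ac (c m - c n) * e + (u m - u n)"
        by (simp add: cu algebra_simps)
      then have "w (s m - s n) \<le> v (c m - c n) + ereal C"
        using bound[of "u m - u n" "c m - c n"] V cu(2) ac.subspace_diff by metis
      then have "ereal (d + C) < v (c m - c n) + ereal C" using N[OF that] by simp
      then show ?thesis by (cases "v (c m - c n)") auto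
    qed
    then show "\<exists>N. \<forall>m\<ge>N. \<forall>n\<ge>N. ereal d < v (c m - c n)" by blast
  qed
  then obtain c' where c': "vlim v c c'"
    using complete unfolding vcomplete_def by blast
  have lim_ce: "vlim w (\<lambda>n. to_ac (c n) * e) (to_ac c' * e)"
  proof (cases "e = 0")
    case False
    then obtain r where r: "w e = ereal r" using w_real by blast
    show ?thesis unfolding vlim_iff
    proof
      fix d
      have "\<forall>\<^sub>F n in sequentially. ereal (d - r) < v (c n - c')"
        using c' by (auto simp: base.vlim_iff)
      then show "\<forall>\<^sub>F n in sequentially. ereal d < w (to_ac (c n) * e - to_ac c' * e)"
      proof (rule eventually_mono)
        fix n assume "ereal (d - r) < v (c n - c')"
        then have "ereal d < v (c n - c') + ereal r" by (cases "v (c n - c')") auto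
        then show "ereal d < w (to_ac (c n) * e - to_ac c' * e)"
          by (simp add: w_mult w_to_ac r flip: left_diff_distrib to_ac_diff)
      qed
    qed
  qed (simp add: vlim_iff)
  have "vCauchy w u" unfolding vCauchy_def
  proof
    fix d
    obtain N1 where N1: "\<And>m n. m \<ge> N1 \<Longrightarrow> n \<ge> N1 \<Longrightarrow> ereal (d + 1) < w (s m - s n)"
      using Cau unfolding vCauchy_def by blast
    obtain N2 where N2: "\<And>m n. m \<ge> N2 \<Longrightarrow> n \<ge> N2 \<Longrightarrow> ereal (d + 1) < w (to_ac (c m) * e - to_ac (c n) * e)"
      using vlim_imp_vCauchy[OF lim_ce] unfolding vCauchy_def by blast
    have "ereal d < w (u m - u n)" if "m \<ge> max N1 N2" "n \<ge> max N1 N2" for m n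
    proof -
      have "ereal (d + 1) \<le> w ((s m - s n) - (to_ac (c m) * e - to_ac (c n) * e))"
        using N1[of m n] N2[of m n] that by (intro w_diff_ge[of _ "s m - s n"]) (auto intro: less_imp_le)
      moreover have "(s m - s n) - (to_ac (c m) * e - to_ac (c n) * e) = u m - u n"
        by (simp add: cu)
      ultimately show ?thesis by (auto intro: less_le_trans[rotated])
    qed
    then show "\<exists>N. \<forall>m\<ge>N. \<forall>n\<ge>N. ereal d < w (u m - u n)" by blast
  qed
  then obtain u' where u': "u' \<in> V" "vlim w u u'"
    using cV cu(2) unfolding vcomplete_def by blast
  have "vlim w s (to_ac c' * e + u')" unfolding vlim_iff
  proof
    fix d
    have "\<forall>\<^sub>F n in sequentially. ereal (d + 1) < w (to_ac (c n) * e - to_ac c' * e) \<and> ereal (d + 1) < w (u n - u')"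
      using lim_ce u' by (auto simp: vlim_iff intro: eventually_conj)
    then show "\<forall>\<^sub>F n in sequentially. ereal d < w (s n - (to_ac c' * e + u'))"
    proof (rule eventually_mono, elim conjE)
      fix n assume "ereal (d + 1) < w (to_ac (c n) * e - to_ac c' * e)" "ereal (d + 1) < w (u n - u')"
      then have "ereal (d + 1) \<le> w ((to_ac (c n) * e - to_ac c' * e) + (u n - u'))"
        by (intro w_add_ge) auto
      moreover have "(to_ac (c n) * e - to_ac c' * e) + (u n - u') = s n - (to_ac c' * e + u')"
        by (simp add: cu)
      ultimately show "ereal d < w (s n - (to_ac c' * e + u'))" by (auto intro: less_le_trans[rotated])
    qed
  qed
  with u' show "\<exists>l\<in>{to_ac c * e + u |c u. u \<in> V}. vlim w s l" by blast
qed

lemma vcomplete_span: "finite S \<Longrightarrow> vcomplete w (ac.span S)"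
proof (induction S rule: finite_induct)
  case empty
  have "vlim w (\<lambda>_. 0) 0" by (simp add: vlim_iff)
  then show ?case
    by (auto simp: vcomplete_def image_subset_iff vlim_def)
next
  case (insert e S)
  show ?case
  proof (cases "e \<in> ac.span S")
    case True
    then show ?thesis using insert by (simp add: ac.span_redundant)
  next
    case False
    have "ac.span (insert e S) = {to_ac c * e + u |c u. u \<in> ac.span S}"
      (is "_ = ?R")
    proof (intro equalityI subsetI)
      fix x assume "x \<in> ac.span (insert e S)"
      then obtain k where "x - to_ac k * e \<in> ac.span S" unfolding ac.span_insert by blast
      then show "x \<in> ?R" by (intro CollectI exI[of _ k] exI[of _ "x - to_ac k * e"]) simp
    next
      fix x assume "x \<in> ?R"
      then obtain c u where "x = to_ac c * e + u" "u \<in> ac.span S" by blast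
      then show "x \<in> ac.span (insert e S)" unfolding ac.span_insert by (intro CollectI exI[of _ c]) simp
    qed
    then show ?thesis
      using vcomplete_insert[OF ac.subspace_span insert.IH False] by simp
  qed
qed

lemma span_mult:
  assumes "\<And>a b. a \<in> A \<Longrightarrow> b \<in> B \<Longrightarrow> a * b \<in> ac.span C"
    and x: "x \<in> ac.span A" and y: "y \<in> ac.span B"
  shows "x * y \<in> ac.span C"
proof -
  have *: "a * y \<in> ac.span C" if "a \<in> A" for a
    using y
  proof (induction rule: ac.span_induct_alt)
    case (step c z u)
    have "a * (to_ac c * z + u) = to_ac c * (a * z) + a * u" by (simp add: algebra_simps)
    then show ?case using step assms(1) that by (auto intro: ac.span_add ac.span_scale)
  qed (simp add: ac.span_zero)
  show ?thesis using x
  proof (induction rule: ac.span_induct_alt)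
    case (step c z u)
    have "(to_ac c * z + u) * y = to_ac c * (z * y) + u * y" by (simp add: algebra_simps)
    then show ?case using step * by (auto intro: ac.span_add ac.span_scale)
  qed (simp add: ac.span_zero)
qed

lemma powers_in_span:
  obtains d where "0 < d" "\<And>n. x ^ n \<in> ac.span {x ^ i |i. i < d}"
proof -
  obtain p :: "'k poly" where p: "p \<noteq> 0" "poly (map_poly to_ac p) x = 0"
    by (rule alg_closure_algebraic)
  define d where "d = degree p"
  define c where "c = Polynomial.coeff p d"
  have c: "c \<noteq> 0" using p by (simp add: c_def d_def)
  have deg: "degree (map_poly to_ac p) = d" by (simp add: d_def degree_map_poly)
  have eq: "(\<Sum>i<d. to_ac (Polynomial.coeff p i) * x ^ i) + to_ac c * x ^ d = 0"
    using p(2) unfolding poly_altdef deg by (simp add: coeff_map_poly c_def lessThan_Suc_atMost[symmetric])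
  have "d \<noteq> 0"
  proof
    assume "d = 0" then show False using eq c by simp
  qed
  let ?V = "ac.span {x ^ i |i. i < d}"
  have xd: "x ^ d \<in> ?V"
  proof -
    have "to_ac c * x ^ d = - (\<Sum>i<d. to_ac (Polynomial.coeff p i) * x ^ i)"
      using eq by (simp add: add_eq_0_iff)
    then have "inverse (to_ac c) * (to_ac c * x ^ d) =
        to_ac (- inverse c) * (\<Sum>i<d. to_ac (Polynomial.coeff p i) * x ^ i)"
      by simp
    moreover have "inverse (to_ac c) * (to_ac c * x ^ d) = x ^ d"
      using c by (simp add: mult.assoc[symmetric])
    ultimately have "x ^ d = to_ac (- inverse c) * (\<Sum>i<d. to_ac (Polynomial.coeff p i) * x ^ i)"
      by metis
    also have "\<dots> \<in> ?V"
      by (intro ac.span_scale ac.span_sum ac.span_base) auto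
    finally show ?thesis .
  qed
  have "x ^ n \<in> ?V" for n
  proof (induction n)
    case 0 show ?case using \<open>d \<noteq> 0\<close> by (intro ac.span_base) (auto intro!: exI[of _ 0])
  next
    case (Suc n)
    have "x * x ^ n \<in> ?V"
    proof (rule span_mult[OF _ _ Suc])
      show "x \<in> ac.span {x}" by (simp add: ac.span_base)
      fix a b assume "a \<in> {x}" "b \<in> {x ^ i |i. i < d}"
      then obtain i where i: "i < d" "a * b = x ^ Suc i" by auto
      show "a * b \<in> ?V"
      proof (cases "Suc i = d")
        case False
        then have "a * b \<in> {x ^ i |i. i < d}" using i by (auto intro!: exI[of _ "Suc i"] simp del: power_Suc)
        then show ?thesis by (rule ac.span_base)
      qed (use xd i in simp)
    qed
    then show ?case by simp
  qed
  then show ?thesis using that \<open>d \<noteq> 0\<close> by blast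
qed

text \<open>A finite set whose pairwise products stay in its span spans a subring. Such a set
  survives the adjunction of an algebraic x: multiply it by the powers of x below the degree of a
  polynomial relation.\<close>

lemma complete_subring_containing:
  assumes "finite Z"
  obtains E where "complete_subring w E" "range to_ac \<subseteq> E" "Z \<subseteq> E"
proof -
  have "\<exists>S. finite S \<and> 1 \<in> ac.span S \<and> Z \<subseteq> ac.span S \<and> (\<forall>a\<in>S. \<forall>b\<in>S. a * b \<in> ac.span S)"
    using assms
  proof (induction Z rule: finite_induct)
    case empty
    show ?case by (intro exI[of _ "{1}"]) (auto intro: ac.span_base)
  next
    case (insert x Z)
    then obtain S where S: "finite S" "1 \<in> ac.span S" "Z \<subseteq> ac.span S"
      "\<And>a b. a \<in> S \<Longrightarrow> b \<in> S \<Longrightarrow> a * b \<in> ac.span S" by blast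
    obtain d where d: "0 < d" "\<And>n. x ^ n \<in> ac.span {x ^ i |i. i < d}"
      using powers_in_span by blast
    define T where "T = {a * b |a b. a \<in> S \<and> b \<in> {x ^ i |i. i < d}}"
    have T: "s * t \<in> ac.span T" if "s \<in> ac.span S" "t \<in> ac.span {x ^ i |i. i < d}" for s t
      by (rule span_mult[OF _ that]) (auto simp: T_def intro!: ac.span_base)
    have "finite T" unfolding T_def using S(1) by (intro finite_image_set2) auto
    moreover have "1 \<in> ac.span T" using T[OF S(2) d(2)[of 0]] by simp
    moreover have "x \<in> ac.span T" using T[OF S(2) d(2)[of 1]] by simp
    moreover have "Z \<subseteq> ac.span T" using T[OF _ d(2)[of 0]] S(3) by auto
    moreover have "a * b \<in> ac.span T" if ab: "a \<in> T" "b \<in> T" for a b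
    proof -
      obtain s i s' i' where "s \<in> S" "s' \<in> S" "a = s * x ^ i" "b = s' * x ^ i'"
        using ab unfolding T_def by blast
      then have "a * b = (s * s') * x ^ (i + i')" by (simp add: power_add algebra_simps)
      then show ?thesis using T[OF S(4)[OF \<open>s \<in> S\<close> \<open>s' \<in> S\<close>] d(2)] by simp
    qed
    ultimately show ?case by (intro exI[of _ T]) auto
  qed
  then obtain S where S: "finite S" "1 \<in> ac.span S" "Z \<subseteq> ac.span S"
      "\<And>a b. a \<in> S \<Longrightarrow> b \<in> S \<Longrightarrow> a * b \<in> ac.span S" by blast
  have "complete_subring w (ac.span S)"
  proof
    show "1 \<in> ac.span S" by fact
    show "x - y \<in> ac.span S" if "x \<in> ac.span S" "y \<in> ac.span S" for x y
      using that by (rule ac.span_diff)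
    show "x * y \<in> ac.span S" if "x \<in> ac.span S" "y \<in> ac.span S" for x y
      using that by (rule span_mult[rotated]) (rule S(4))
    show "vcomplete w (ac.span S)" using S(1) by (rule vcomplete_span)
  qed
  moreover have "range to_ac \<subseteq> ac.span S"
  proof clarify
    fix c show "to_ac c \<in> ac.span S" using ac.span_scale[OF S(2), of c] by simp
  qed
  ultimately show ?thesis using S(3) by (rule that)
qed

end


section \<open>Evaluation of power series\<close>

text \<open>Subrings are sets, and homomorphisms satisfy their laws only on such a set, because
  evaluation at a point of positive valuation behaves well on series with integral coefficients, a
  proper part of the type.\<close>

definition subr :: "'a::comm_ring_1 set \<Rightarrow> bool" where
  "subr S \<longleftrightarrow> 1 \<in> S \<and> (\<forall>x\<in>S. \<forall>y\<in>S. x - y \<in> S \<and> x * y \<in> S)"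

definition hom_on :: "'a::comm_ring_1 set \<Rightarrow> ('a \<Rightarrow> 'b::comm_ring_1) \<Rightarrow> bool" where
  "hom_on S \<phi> \<longleftrightarrow> \<phi> 1 = 1 \<and> (\<forall>x\<in>S. \<forall>y\<in>S. \<phi> (x + y) = \<phi> x + \<phi> y \<and> \<phi> (x * y) = \<phi> x * \<phi> y)"

definition fps_over :: "'a set \<Rightarrow> 'a fps set" where
  "fps_over S = {A. \<forall>i. A $ i \<in> S}"

definition coefmap :: "('a \<Rightarrow> 'b) \<Rightarrow> 'a fps \<Rightarrow> 'b fps" where
  "coefmap \<phi> A = Abs_fps (\<lambda>i. \<phi> (A $ i))"

lemma coefmap_nth [simp]: "coefmap \<phi> A $ i = \<phi> (A $ i)"
  by (simp add: coefmap_def)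

lemma fps_overD: "A \<in> fps_over S \<Longrightarrow> A $ i \<in> S"
  by (simp add: fps_over_def)

context
  fixes S :: "'a::comm_ring_1 set"
  assumes S: "subr S"
begin

lemma subr_1: "1 \<in> S" and subr_diff: "x \<in> S \<Longrightarrow> y \<in> S \<Longrightarrow> x - y \<in> S"
  and subr_mult: "x \<in> S \<Longrightarrow> y \<in> S \<Longrightarrow> x * y \<in> S"
  using S by (auto simp: subr_def)

lemma subr_0: "0 \<in> S"
  using subr_diff[OF subr_1 subr_1] by simp

lemma subr_add: "x \<in> S \<Longrightarrow> y \<in> S \<Longrightarrow> x + y \<in> S"
  using subr_diff[of x "0 - y"] subr_diff[OF subr_0, of y] by simp

lemma subr_power: "x \<in> S \<Longrightarrow> x ^ n \<in> S"
  by (induction n) (auto intro: subr_1 subr_mult)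

lemma subr_sum: "(\<And>i. i \<in> I \<Longrightarrow> f i \<in> S) \<Longrightarrow> sum f I \<in> S"
  by (induction I rule: infinite_finite_induct) (auto intro: subr_0 subr_add)

lemma subr_fps_over: "subr (fps_over S)"
  using subr_0 subr_1
  unfolding subr_def[of "fps_over S"]
  by (auto simp: fps_over_def fps_mult_nth fps_one_nth intro!: subr_sum subr_mult subr_diff)

lemma fps_const_in_fps_over: "c \<in> S \<Longrightarrow> fps_const c \<in> fps_over S"
  using subr_0 by (auto simp: fps_over_def)

lemma fps_X_in_fps_over: "fps_X \<in> fps_over S"
  using subr_0 subr_1 by (auto simp: fps_over_def fps_X_def)

context
  fixes \<phi> :: "'a \<Rightarrow> 'b::comm_ring_1"
  assumes \<phi>: "hom_on S \<phi>"
begin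

lemma hom_on_1: "\<phi> 1 = 1"
  and hom_on_add: "x \<in> S \<Longrightarrow> y \<in> S \<Longrightarrow> \<phi> (x + y) = \<phi> x + \<phi> y"
  and hom_on_mult: "x \<in> S \<Longrightarrow> y \<in> S \<Longrightarrow> \<phi> (x * y) = \<phi> x * \<phi> y"
  using \<phi> by (auto simp: hom_on_def)

lemma hom_on_0: "\<phi> 0 = 0"
  using hom_on_add[OF subr_0 subr_0] by simp

lemma hom_on_diff: assumes "x \<in> S" "y \<in> S" shows "\<phi> (x - y) = \<phi> x - \<phi> y"
  using hom_on_add[OF subr_diff[OF assms] assms(2)] by (simp add: algebra_simps)

lemma hom_on_sum: "(\<And>i. i \<in> I \<Longrightarrow> f i \<in> S) \<Longrightarrow> \<phi> (sum f I) = (\<Sum>i\<in>I. \<phi> (f i))"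
  by (induction I rule: infinite_finite_induct) (auto simp: hom_on_0 hom_on_add subr_sum)

lemma hom_on_power: "x \<in> S \<Longrightarrow> \<phi> (x ^ n) = \<phi> x ^ n"
  by (induction n) (auto simp: hom_on_1 hom_on_mult subr_power)

lemma hom_on_coefmap: "hom_on (fps_over S) (coefmap \<phi>)"
  unfolding hom_on_def
proof (intro conjI ballI)
  show "coefmap \<phi> 1 = 1"
    by (rule fps_ext) (simp add: hom_on_0 hom_on_1)
  fix A B assume AB: "A \<in> fps_over S" "B \<in> fps_over S"
  show "coefmap \<phi> (A + B) = coefmap \<phi> A + coefmap \<phi> B"
    by (rule fps_ext) (simp add: hom_on_add fps_overD AB)
  show "coefmap \<phi> (A * B) = coefmap \<phi> A * coefmap \<phi> B"
    by (rule fps_ext) (simp add: fps_mult_nth hom_on_sum hom_on_mult fps_overD AB subr_mult)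
qed

lemma coefmap_in_fps_over: "\<phi> ` S \<subseteq> T \<Longrightarrow> A \<in> fps_over S \<Longrightarrow> coefmap \<phi> A \<in> fps_over T"
  by (auto simp: fps_over_def)

lemma coefmap_fps_X: "coefmap \<phi> fps_X = fps_X"
  by (rule fps_ext) (simp add: fps_X_def hom_on_0 hom_on_1)

lemma coefmap_fps_const: "coefmap \<phi> (fps_const c) = fps_const (\<phi> c)"
  by (rule fps_ext) (simp add: hom_on_0)

end
end

lemma hom_on_comp:
  assumes "hom_on S \<phi>" "hom_on T \<psi>" "\<phi> ` S \<subseteq> T" shows "hom_on S (\<lambda>x. \<psi> (\<phi> x))"
  using assms by (auto simp: hom_on_def image_subset_iff)


definition (in valued_field) ev :: "'a fps \<Rightarrow> 'a \<Rightarrow> 'a" where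
  "ev A x = (THE z. vlim w (\<lambda>N. \<Sum>i<N. A $ i * x ^ i) z)"

lemma (in valued_field) ev_unique:
  assumes "0 < \<mu>" "\<And>N. ereal (real N * \<mu>) \<le> w ((\<Sum>i<N. A $ i * x ^ i) - z)"
  shows "ev A x = z"
proof -
  have "vlim w (\<lambda>N. \<Sum>i<N. A $ i * x ^ i) z" by (rule vlim_I_linear[OF assms])
  then show ?thesis unfolding ev_def using vlim_unique by blast
qed

section \<open>Evaluation in one variable as a ring homomorphism\<close>

context complete_subring begin

definition integers :: "'a set" where "integers = {c \<in> E. 0 \<le> w c}"

lemma subr_integers: "subr integers"
  by (auto simp: subr_def integers_def intro: E_1 E_diff E_mult w_diff_ge w_mult_nonneg)

context
  fixes x \<mu>
  assumes x: "x \<in> E" "ereal \<mu> \<le> w x" and \<mu>: "0 < \<mu>"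
begin

lemma term_ge:
  assumes "A \<in> fps_over integers" shows "ereal (real i * \<mu>) \<le> w (A $ i * x ^ i)"
  using fps_overD[OF assms, of i] w_power_ge[OF x(2)] by (auto simp: integers_def intro: w_mult_ge_right)

lemma partial_sum_diff_ge:
  assumes "A \<in> fps_over integers" "N \<le> n"
  shows "ereal (real N * \<mu>) \<le> w ((\<Sum>i<n. A $ i * x ^ i) - (\<Sum>i<N. A $ i * x ^ i))"
proof -
  have "(\<Sum>i<n. A $ i * x ^ i) - (\<Sum>i<N. A $ i * x ^ i) = (\<Sum>i=N..<n. A $ i * x ^ i)"
    using assms(2) by (metis atLeast0LessThan sum_diff_nat_ivl zero_le)
  also have "ereal (real N * \<mu>) \<le> w \<dots>"
  proof (rule w_sum_ge)
    fix i assume "i \<in> {N..<n}"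
    then have "ereal (real N * \<mu>) \<le> ereal (real i * \<mu>)" using \<mu> by simp
    then show "ereal (real N * \<mu>) \<le> w (A $ i * x ^ i)" using term_ge[OF assms(1)] order_trans by blast
  qed
  finally show ?thesis .
qed

lemma ev_props:
  assumes A: "A \<in> fps_over integers"
  shows ev_in_E: "ev A x \<in> E" (is ?A)
    and ev_approx: "\<And>N. ereal (real N * \<mu>) \<le> w ((\<Sum>i<N. A $ i * x ^ i) - ev A x)" (is "\<And>N. ?B N")
    and vlim_ev: "vlim w (\<lambda>N. \<Sum>i<N. A $ i * x ^ i) (ev A x)" (is ?C)
proof -
  let ?s = "\<lambda>N. \<Sum>i<N. A $ i * x ^ i"
  have "vCauchy w ?s"
    by (rule vCauchy_I_linear[OF \<mu>]) (rule partial_sum_diff_ge[OF A], simp)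
  moreover have "range ?s \<subseteq> E"
    using fps_overD[OF A] x(1) by (auto simp: integers_def intro!: E_sum E_mult E_power)
  ultimately obtain l where l: "l \<in> E" "vlim w ?s l"
    using E_complete unfolding vcomplete_def by blast
  then have "ev A x = l" unfolding ev_def using vlim_unique by blast
  then show ?A and C: ?C using l by simp_all
  show "?B N" for N
  proof -
    have "ereal (real N * \<mu>) \<le> w (ev A x - ?s N)"
      by (rule vlim_le[OF C]) (rule eventually_sequentiallyI[of N], rule partial_sum_diff_ge[OF A])
    then show ?thesis by (simp add: w_diff_commute)
  qed
qed

text \<open>The weighted hypothesis allows several variables to be treated one at a time: in
  \<open>ev3_ge\<close> the exponents of X, Y and Z are subtracted successively from the total order
  N.\<close>

lemma ev_ge:
  assumes A: "A \<in> fps_over integers" and d: "\<And>i. ereal (d - real i * \<mu>) \<le> w (A $ i)"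
  shows "ereal d \<le> w (ev A x)"
proof -
  have "ereal d \<le> w (\<Sum>i<N. A $ i * x ^ i)" for N
  proof (rule w_sum_ge)
    fix i show "ereal d \<le> w (A $ i * x ^ i)"
      using w_mult_ge[OF d w_power_ge[OF x(2)], of i i] by simp
  qed
  then have "ereal d \<le> w (ev A x - 0)"
    by (intro vlim_le[OF vlim_ev[OF A]] always_eventually) auto
  then show ?thesis by simp
qed

lemma ev_in_integers: assumes A: "A \<in> fps_over integers" shows "ev A x \<in> integers"
proof -
  have "ereal (0 - real i * \<mu>) \<le> w (A $ i)" for i
  proof -
    have "ereal (0 - real i * \<mu>) \<le> 0" using \<mu> by simp
    also have "0 \<le> w (A $ i)" using fps_overD[OF A, of i] by (simp add: integers_def)
    finally show ?thesis .
  qed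
  then show ?thesis
    using ev_in_E[OF A] ev_ge[OF A, of 0] by (simp add: integers_def zero_ereal_def)
qed

text \<open>The product of two partial sums runs over a square of index pairs, the partial sum of
  the product over a triangle. The pairs outside the triangle have i + j \<ge> N, so their terms
  have valuation at least N \<mu>.\<close>

lemma ev_mult:
  assumes A: "A \<in> fps_over integers" and B: "B \<in> fps_over integers"
  shows "ev (A * B) x = ev A x * ev B x"
proof (rule ev_unique[OF \<mu>])
  fix N
  let ?a = "\<Sum>i<N. A $ i * x ^ i" and ?b = "\<Sum>i<N. B $ i * x ^ i"
  let ?g = "\<lambda>(i, j). (A $ i * x ^ i) * (B $ j * x ^ j)"
  let ?Q = "{..<N} \<times> {..<N}" and ?T = "{(i, j). i + j < N}"
  have "?a * ?b = sum ?g ?Q"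
    by (simp add: sum_product sum.cartesian_product)
  moreover have "(\<Sum>i<N. (A * B) $ i * x ^ i) = sum ?g ?T"
    unfolding sum.triangle_reindex fps_mult_nth sum_distrib_right
    by (intro sum.cong) (auto simp: atLeast0AtMost algebra_simps simp flip: power_add)
  moreover have "sum ?g ?T = sum ?g ?Q - sum ?g (?Q - ?T)"
    by (subst sum_diff) auto
  ultimately have "(\<Sum>i<N. (A * B) $ i * x ^ i) - ev A x * ev B x =
      - sum ?g (?Q - ?T) + ((?a - ev A x) * ?b + ev A x * (?b - ev B x))"
    by (simp add: algebra_simps)
  also have "ereal (real N * \<mu>) \<le> w \<dots>"
  proof (intro w_add_ge)
    show "ereal (real N * \<mu>) \<le> w (- sum ?g (?Q - ?T))"
      unfolding w_uminus
    proof (rule w_sum_ge)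
      fix ij assume "ij \<in> ?Q - ?T"
      then obtain i j where ij: "ij = (i, j)" "\<not> i + j < N" by auto
      then have "real N \<le> real i + real j" by linarith
      then have "real N * \<mu> \<le> (real i + real j) * \<mu>" using \<mu> by (intro mult_right_mono) auto
      then have "ereal (real N * \<mu>) \<le> ereal (real i * \<mu> + real j * \<mu>)" by (simp add: algebra_simps)
      also have "\<dots> \<le> w (A $ i * x ^ i * (B $ j * x ^ j))"
        by (intro w_mult_ge term_ge A B)
      finally show "ereal (real N * \<mu>) \<le> w (?g ij)" using ij by simp
    qed
    have "0 \<le> w ?b"
    proof (rule w_sum_ge)
      fix i
      have "0 \<le> ereal (real i * \<mu>)" using \<mu> by simp
      also note term_ge[OF B]
      finally show "0 \<le> w (B $ i * x ^ i)" .
    qed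
    then show "ereal (real N * \<mu>) \<le> w ((?a - ev A x) * ?b)"
      using w_mult_ge_right[OF _ ev_approx[OF A]] by (simp add: mult.commute)
    show "ereal (real N * \<mu>) \<le> w (ev A x * (?b - ev B x))"
      using ev_in_integers[OF A] by (intro w_mult_ge_right ev_approx[OF B]) (simp add: integers_def)
  qed
  finally show "ereal (real N * \<mu>) \<le> w ((\<Sum>i<N. (A * B) $ i * x ^ i) - ev A x * ev B x)" .
qed

lemma ev_add:
  assumes A: "A \<in> fps_over integers" and B: "B \<in> fps_over integers"
  shows "ev (A + B) x = ev A x + ev B x"
proof (rule ev_unique[OF \<mu>])
  fix N
  have "(\<Sum>i<N. (A + B) $ i * x ^ i) - (ev A x + ev B x) =
      ((\<Sum>i<N. A $ i * x ^ i) - ev A x) + ((\<Sum>i<N. B $ i * x ^ i) - ev B x)"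
    by (simp add: algebra_simps sum.distrib)
  then show "ereal (real N * \<mu>) \<le> w ((\<Sum>i<N. (A + B) $ i * x ^ i) - (ev A x + ev B x))"
    using w_add_ge[OF ev_approx[OF A] ev_approx[OF B]] by (simp only:)
qed

lemma ev_fps_const: assumes "0 \<le> w c" shows "ev (fps_const c) x = c"
proof (rule ev_unique[OF \<mu>])
  fix N
  have "(\<Sum>i<N. fps_const c $ i * x ^ i) = (\<Sum>i<N. if i = 0 then c else 0)"
    by (intro sum.cong) auto
  also have "\<dots> = (if N = 0 then 0 else c)" by simp
  finally show "ereal (real N * \<mu>) \<le> w ((\<Sum>i<N. fps_const c $ i * x ^ i) - c)"
    using assms by (simp add: zero_ereal_def[symmetric])
qed

lemma ev_fps_X: "ev fps_X x = x"
proof (rule ev_unique[OF \<mu>])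
  fix N
  have "(\<Sum>i<N. fps_X $ i * x ^ i) = (\<Sum>i<N. if i = 1 then x else 0)"
    by (intro sum.cong) auto
  also have "\<dots> = (if 1 < N then x else 0)" by simp
  finally have "w ((\<Sum>i<N. fps_X $ i * x ^ i) - x) = (if 1 < N then \<infinity> else w x)" by simp
  moreover have "real N * \<mu> \<le> \<mu>" if "\<not> 1 < N"
    using that \<mu> by (cases N) auto
  ultimately show "ereal (real N * \<mu>) \<le> w ((\<Sum>i<N. fps_X $ i * x ^ i) - x)"
    using order_trans[OF _ x(2), of "ereal (real N * \<mu>)"] by simp
qed

lemma hom_on_ev: "hom_on (fps_over integers) (\<lambda>A. ev A x)"
  unfolding hom_on_def using ev_fps_const[of 1] by (auto simp: ev_add ev_mult)

text \<open>The conclusion has the form of the hypotheses one level of series higher, so the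
  construction can be repeated for iterated power series.\<close>

lemma hom_on_ev_coefmap:
  assumes "subr S" "hom_on S \<phi>" "\<phi> ` S \<subseteq> integers"
  shows "hom_on (fps_over S) (\<lambda>A. ev (coefmap \<phi> A) x)"
    and "(\<lambda>A. ev (coefmap \<phi> A) x) ` fps_over S \<subseteq> integers"
  using assms
  by (auto intro!: hom_on_comp[OF hom_on_coefmap hom_on_ev] ev_in_integers coefmap_in_fps_over)

end

text \<open>Only the derivative \<open>f'(0)\<close> matters near \<open>0\<close>: the quadratic remainder of an integral series
  is a contraction there.\<close>

lemma ev_diff_ge:
  assumes A: "A \<in> fps_over integers" "A $ 0 = 0" "A $ 1 = 0" and \<mu>: "0 < \<mu>"
    and x: "x \<in> E" "ereal \<mu> \<le> w x" and y: "y \<in> E" "ereal \<mu> \<le> w y" and d: "ereal d \<le> w (x - y)"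
  shows "ereal (d + \<mu>) \<le> w (ev A x - ev A y)"
proof -
  have pow: "ereal (d + \<mu>) \<le> w (x ^ i - y ^ i)" if i: "2 \<le> i" for i
  proof -
    have "x ^ i - y ^ i = (x - y) * (\<Sum>j<i. y ^ (i - Suc j) * x ^ j)"
      by (rule power_diff_sumr2)
    moreover have "ereal \<mu> \<le> w (\<Sum>j<i. y ^ (i - Suc j) * x ^ j)"
    proof (rule w_sum_ge)
      fix j assume "j \<in> {..<i}"
      then have "(real (i - Suc j) * \<mu>) + (real j * \<mu>) = real (i - 1) * \<mu>"
        by (auto simp: algebra_simps of_nat_diff)
      moreover have "1 * \<mu> \<le> real (i - 1) * \<mu>" using i \<mu> by (intro mult_right_mono) auto
      ultimately have "ereal \<mu> \<le> ereal ((real (i - Suc j) * \<mu>) + (real j * \<mu>))" by simp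
      also have "\<dots> \<le> w (y ^ (i - Suc j) * x ^ j)"
        by (intro w_mult_ge w_power_ge x y)
      finally show "ereal \<mu> \<le> w (y ^ (i - Suc j) * x ^ j)" .
    qed
    ultimately show ?thesis using w_mult_ge[OF d] by simp
  qed
  have part: "ereal (d + \<mu>) \<le> w ((\<Sum>i<N. A $ i * x ^ i) - (\<Sum>i<N. A $ i * y ^ i))" for N
    unfolding sum_subtractf[symmetric] right_diff_distrib[symmetric]
  proof (rule w_sum_ge)
    fix i :: nat
    consider "i = 0" | "i = 1" | "2 \<le> i" by linarith
    then show "ereal (d + \<mu>) \<le> w (A $ i * (x ^ i - y ^ i))"
    proof cases
      case 3
      then show ?thesis using fps_overD[OF A(1), of i] pow
        by (intro w_mult_ge_right) (auto simp: integers_def)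
    qed (use A(2,3) in auto)
  qed
  have "vlim w (\<lambda>N. (\<Sum>i<N. A $ i * x ^ i) - (\<Sum>i<N. A $ i * y ^ i)) (ev A x - ev A y)"
  proof (rule vlim_I_linear[OF \<mu>])
    fix N
    have "ereal (real N * \<mu>) \<le> w (((\<Sum>i<N. A $ i * x ^ i) - ev A x) - ((\<Sum>i<N. A $ i * y ^ i) - ev A y))"
      by (rule w_diff_ge[OF ev_approx[OF x \<mu> A(1)] ev_approx[OF y \<mu> A(1)]])
    then show "ereal (real N * \<mu>) \<le>
        w ((\<Sum>i<N. A $ i * x ^ i) - (\<Sum>i<N. A $ i * y ^ i) - (ev A x - ev A y))"
      by (simp add: algebra_simps)
  qed
  then have "ereal (d + \<mu>) \<le> w (ev A x - ev A y - 0)"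
    using part by (intro vlim_le[where a = 0] always_eventually) auto
  then show ?thesis by simp
qed

end


section \<open>Formal substitution and evaluation\<close>

definition vanishes_to_order :: "nat \<Rightarrow> 'a::comm_ring_1 fps fps fps \<Rightarrow> bool" where
  "vanishes_to_order d A \<longleftrightarrow> (\<forall>a b c. a + b + c < d \<longrightarrow> A $ a $ b $ c = 0)"

lemma vanishes_to_order_mult:
  assumes A: "vanishes_to_order d A" and B: "vanishes_to_order e B"
  shows "vanishes_to_order (d + e) (A * B)"
  unfolding vanishes_to_order_def
proof (intro allI impI)
  fix a b c assume abc: "a + b + c < d + e"
  have "(A * B) $ a $ b $ c =
      (\<Sum>i=0..a. \<Sum>j=0..b. \<Sum>k=0..c. A $ i $ j $ k * B $ (a - i) $ (b - j) $ (c - k))"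
    by (simp add: fps_mult_nth fps_sum_nth)
  also have "\<dots> = 0"
  proof (intro sum.neutral ballI)
    fix i j k assume "i \<in> {0..a}" "j \<in> {0..b}" "k \<in> {0..c}"
    then have "i + j + k < d \<or> (a - i) + (b - j) + (c - k) < e" using abc by auto
    then show "A $ i $ j $ k * B $ (a - i) $ (b - j) $ (c - k) = 0"
      using A B unfolding vanishes_to_order_def by auto
  qed
  finally show "(A * B) $ a $ b $ c = 0" .
qed

lemma vanishes_to_order_power:
  "vanishes_to_order 1 A \<Longrightarrow> vanishes_to_order n (A ^ n)"
proof (induction n)
  case (Suc n)
  then show ?case using vanishes_to_order_mult[of 1 A n "A ^ n"] by simp
qed (simp add: vanishes_to_order_def)

abbreviation const3 :: "'a::comm_ring_1 \<Rightarrow> 'a fps fps fps" where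
  "const3 c \<equiv> fps_const (fps_const (fps_const c))"

text \<open>Without constant terms, \<open>A ^ i * B ^ j\<close> has order at least i + j, so the
  cut-off in the definition may be any larger N. Up to order N the substitution is thus a finite sum
  of products, to which a homomorphism can be applied.\<close>

lemma subst2_eq_partial_sum:
  assumes A: "vanishes_to_order 1 A" and B: "vanishes_to_order 1 B" and N: "a + b + c < N"
  shows "subst2 F A B $ a $ b $ c = (\<Sum>i<N. \<Sum>j<N. const3 (F $ i $ j) * (A ^ i * B ^ j)) $ a $ b $ c"
proof -
  let ?g = "\<lambda>i j. F $ i $ j * (A ^ i * B ^ j) $ a $ b $ c"
  have zero: "?g i j = 0" if "a + b + c < i + j" for i j
    using vanishes_to_order_mult[OF vanishes_to_order_power[OF A] vanishes_to_order_power[OF B], of i j] that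
    unfolding vanishes_to_order_def by simp
  have "subst2 F A B $ a $ b $ c = (\<Sum>i\<le>a + b + c. \<Sum>j\<le>a + b + c. ?g i j)"
    by (simp add: subst2_def)
  also have "\<dots> = (\<Sum>i\<le>a + b + c. \<Sum>j<N. ?g i j)"
    using N by (intro sum.cong refl sum.mono_neutral_left) (auto intro!: zero)
  also have "\<dots> = (\<Sum>i<N. \<Sum>j<N. ?g i j)"
    using N by (intro sum.mono_neutral_left) (auto intro!: zero sum.neutral)
  also have "\<dots> = (\<Sum>i<N. \<Sum>j<N. const3 (F $ i $ j) * (A ^ i * B ^ j)) $ a $ b $ c"
    by (simp add: fps_sum_nth)
  finally show ?thesis .
qed

lemma subst1_eq_partial_sum:
  assumes A: "vanishes_to_order 1 A" and N: "a + b + c < N"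
  shows "subst1 f A $ a $ b $ c = (\<Sum>i<N. const3 (f $ i) * A ^ i) $ a $ b $ c"
proof -
  let ?g = "\<lambda>i. f $ i * (A ^ i) $ a $ b $ c"
  have "subst1 f A $ a $ b $ c = (\<Sum>i\<le>a + b + c. ?g i)"
    by (simp add: subst1_def)
  also have "\<dots> = (\<Sum>i<N. ?g i)"
    using N vanishes_to_order_power[OF A]
    by (intro sum.mono_neutral_left) (auto simp: vanishes_to_order_def)
  also have "\<dots> = (\<Sum>i<N. const3 (f $ i) * A ^ i) $ a $ b $ c"
    by (simp add: fps_sum_nth)
  finally show ?thesis .
qed

lemma vanishes_to_order_1_iff: "vanishes_to_order 1 A \<longleftrightarrow> A $ 0 $ 0 $ 0 = 0"
  by (simp add: vanishes_to_order_def)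

lemma vanishes_vars [simp]:
  "vanishes_to_order (Suc 0) varX" "vanishes_to_order (Suc 0) varY" "vanishes_to_order (Suc 0) varZ"
  "vanishes_to_order (Suc 0) 0"
  by (simp_all add: vanishes_to_order_def varX_def varY_def varZ_def)

lemma vanishes_subst2: "F $ 0 $ 0 = 0 \<Longrightarrow> vanishes_to_order (Suc 0) (subst2 F A B)"
  using vanishes_to_order_1_iff[of "subst2 F A B"] by (simp add: subst2_def)

lemma vanishes_subst1: "f $ 0 = 0 \<Longrightarrow> vanishes_to_order (Suc 0) (subst1 f A)"
  using vanishes_to_order_1_iff[of "subst1 f A"] by (simp add: subst1_def)

lemma eval2_unique:
  fixes w' :: "'b::field alg_closure \<Rightarrow> ereal"
  assumes "valued_field w'" "0 < \<mu>"
    "\<And>N. ereal (real N * \<mu>) \<le> w' ((\<Sum>i<N. \<Sum>j<N. to_ac (F $ i $ j) * x ^ i * y ^ j) - z)"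
  shows "eval2 w' F x y = z"
proof -
  interpret w': valued_field w' by fact
  have "vlim w' (\<lambda>N. \<Sum>i<N. \<Sum>j<N. to_ac (F $ i $ j) * x ^ i * y ^ j) z"
    by (rule w'.vlim_I_linear[OF assms(2,3)])
  then show ?thesis unfolding eval2_def using w'.vlim_unique by blast
qed

section \<open>Evaluation of integral series at triples of points, and substitution\<close>

context complete_valued_field begin

definition O_K :: "'k set" where "O_K = {c. 0 \<le> v c}"

lemma subr_O_K: "subr O_K"
  by (auto simp: subr_def O_K_def intro: base.w_diff_ge base.w_mult_nonneg)

lemma subr_O_K1: "subr (fps_over O_K)" and subr_O_K2: "subr (fps_over (fps_over O_K))"
  and subr_O_K3: "subr (fps_over (fps_over (fps_over O_K)))"
  by (intro subr_fps_over subr_O_K)+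

lemma vars_integral:
  "varX \<in> fps_over (fps_over (fps_over O_K))" "varY \<in> fps_over (fps_over (fps_over O_K))"
  "varZ \<in> fps_over (fps_over (fps_over O_K))" "0 \<in> fps_over (fps_over (fps_over O_K))"
  unfolding varX_def varY_def varZ_def
  by (intro fps_X_in_fps_over fps_const_in_fps_over subr_fps_over subr_O_K subr_0)+

lemma const3_integral: "c \<in> O_K \<Longrightarrow> const3 c \<in> fps_over (fps_over (fps_over O_K))"
  by (intro fps_const_in_fps_over subr_fps_over subr_O_K)

lemma integral3_nth: "A \<in> fps_over (fps_over (fps_over O_K)) \<Longrightarrow> A $ a $ b $ c \<in> O_K"
  by (intro fps_overD)

lemma subst2_integral:
  assumes "F \<in> fps_over (fps_over O_K)"
    and "A \<in> fps_over (fps_over (fps_over O_K))" "B \<in> fps_over (fps_over (fps_over O_K))"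
  shows "subst2 F A B \<in> fps_over (fps_over (fps_over O_K))"
proof -
  have "F $ i $ j * (A ^ i * B ^ j) $ a $ b $ c \<in> O_K" for i j a b c
    using assms
    by (intro subr_mult[OF subr_O_K] integral3_nth subr_mult[OF subr_O_K3] subr_power[OF subr_O_K3])
       (auto dest: fps_overD)
  then show ?thesis
    unfolding fps_over_def by (auto simp: subst2_def intro!: subr_sum[OF subr_O_K])
qed

lemma subst1_integral:
  assumes "f \<in> fps_over O_K" and "A \<in> fps_over (fps_over (fps_over O_K))"
  shows "subst1 f A \<in> fps_over (fps_over (fps_over O_K))"
proof -
  have "f $ i * (A ^ i) $ a $ b $ c \<in> O_K" for i a b c
    using assms
    by (intro subr_mult[OF subr_O_K] integral3_nth subr_power[OF subr_O_K3])
       (auto dest: fps_overD)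
  then show ?thesis
    unfolding fps_over_def by (auto simp: subst1_def intro!: subr_sum[OF subr_O_K])
qed

lemma eval1_eq_ev: "eval1 w f x = ev (coefmap to_ac f) x"
  by (simp add: eval1_def ev_def)

end

locale evaluation = complete_valued_field v w + complete_subring w E
  for v :: "'k::field \<Rightarrow> ereal" and w :: "'k alg_closure \<Rightarrow> ereal" and E +
  assumes to_ac_E: "range to_ac \<subseteq> E"
begin

lemma hom_on_to_ac: "hom_on O_K to_ac" and to_ac_integers: "to_ac ` O_K \<subseteq> integers"
  using to_ac_E by (auto simp: hom_on_def O_K_def integers_def w_to_ac)

lemma coefmap_to_ac_integral: "f \<in> fps_over O_K \<Longrightarrow> coefmap to_ac f \<in> fps_over integers"
  by (rule coefmap_in_fps_over[OF subr_O_K hom_on_to_ac to_ac_integers])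

text \<open>The order follows the nesting of the type: the innermost series are in Z, the outermost
  in X. The axioms of a formal module are identities in this ring, and this single homomorphism
  carries them over to points.\<close>

definition ev3 where
  "ev3 x y z A = ev (coefmap (\<lambda>G. ev (coefmap (\<lambda>f. eval1 w f z) G) y) A) x"

context
  fixes x y z \<mu>
  assumes xyz: "x \<in> E" "y \<in> E" "z \<in> E" "ereal \<mu> \<le> w x" "ereal \<mu> \<le> w y" "ereal \<mu> \<le> w z"
    and \<mu>: "0 < \<mu>"
begin

lemma hom_eval1:
  "hom_on (fps_over O_K) (\<lambda>A. eval1 w A z)" "(\<lambda>A. eval1 w A z) ` fps_over O_K \<subseteq> integers"
  using hom_on_ev_coefmap[OF xyz(3,6) \<mu> subr_O_K hom_on_to_ac to_ac_integers]
  unfolding eval1_eq_ev by auto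

lemma hom_ev2:
  "hom_on (fps_over (fps_over O_K)) (\<lambda>G. ev (coefmap (\<lambda>f. eval1 w f z) G) y)"
  "(\<lambda>G. ev (coefmap (\<lambda>f. eval1 w f z) G) y) ` fps_over (fps_over O_K) \<subseteq> integers"
  using hom_on_ev_coefmap[OF xyz(2,5) \<mu> subr_O_K1 hom_eval1] .

lemma hom_ev3:
  "hom_on (fps_over (fps_over (fps_over O_K))) (ev3 x y z)"
  "ev3 x y z ` fps_over (fps_over (fps_over O_K)) \<subseteq> integers"
  using hom_on_ev_coefmap[OF xyz(1,4) \<mu> subr_O_K2 hom_ev2] unfolding ev3_def by auto

lemma eval1_vars: "eval1 w fps_X z = z" "c \<in> O_K \<Longrightarrow> eval1 w (fps_const c) z = to_ac c"
  by (auto simp: eval1_eq_ev coefmap_fps_X[OF subr_O_K hom_on_to_ac] ev_fps_X[OF xyz(3,6) \<mu>]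
      coefmap_fps_const[OF subr_O_K hom_on_to_ac] O_K_def w_to_ac intro!: ev_fps_const[OF xyz(3,6) \<mu>])

lemma ev3_vars: "ev3 x y z varX = x" "ev3 x y z varY = y" "ev3 x y z varZ = z"
  and ev3_const3: "c \<in> O_K \<Longrightarrow> ev3 x y z (const3 c) = to_ac c"
proof -
  have pos: "0 \<le> w a" if "ereal \<mu> \<le> w a" for a
    using order_trans[OF _ that, of 0] \<mu> by simp
  show "ev3 x y z varX = x"
    unfolding ev3_def varX_def coefmap_fps_X[OF subr_O_K2 hom_ev2(1)] by (rule ev_fps_X[OF xyz(1,4) \<mu>])
  have y: "ev fps_X y = y" by (rule ev_fps_X[OF xyz(2,5) \<mu>])
  show "ev3 x y z varY = y"
    unfolding ev3_def varY_def coefmap_fps_const[OF subr_O_K2 hom_ev2(1)] coefmap_fps_X[OF subr_O_K1 hom_eval1(1)] y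
    by (rule ev_fps_const[OF xyz(1,4) \<mu>]) (rule pos[OF xyz(5)])
  have z: "ev (fps_const z) y = z" by (rule ev_fps_const[OF xyz(2,5) \<mu>]) (rule pos[OF xyz(6)])
  show "ev3 x y z varZ = z"
    unfolding ev3_def varZ_def coefmap_fps_const[OF subr_O_K2 hom_ev2(1)]
      coefmap_fps_const[OF subr_O_K1 hom_eval1(1)] eval1_vars z
    by (rule ev_fps_const[OF xyz(1,4) \<mu>]) (rule pos[OF xyz(6)])
  assume c: "c \<in> O_K"
  then have wc: "0 \<le> w (to_ac c)" by (simp add: O_K_def w_to_ac)
  have y: "ev (fps_const (to_ac c)) y = to_ac c" by (rule ev_fps_const[OF xyz(2,5) \<mu> wc])
  show "ev3 x y z (const3 c) = to_ac c"
    unfolding ev3_def coefmap_fps_const[OF subr_O_K2 hom_ev2(1)]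
      coefmap_fps_const[OF subr_O_K1 hom_eval1(1)] eval1_vars(2)[OF c] y
    by (rule ev_fps_const[OF xyz(1,4) \<mu> wc])
qed

lemma eval1_ge:
  assumes f: "f \<in> fps_over O_K" and d: "\<And>i. ereal (d - real i * \<mu>) \<le> v (f $ i)"
  shows "ereal d \<le> w (eval1 w f z)"
  unfolding eval1_eq_ev
  by (rule ev_ge[OF xyz(3,6) \<mu>]) (use d in \<open>auto simp: w_to_ac coefmap_to_ac_integral[OF f]\<close>)

lemma ev3_ge:
  assumes A: "A \<in> fps_over (fps_over (fps_over O_K))" and N: "vanishes_to_order N A"
  shows "ereal (real N * \<mu>) \<le> w (ev3 x y z A)"
  unfolding ev3_def
proof (rule ev_ge[OF xyz(1,4) \<mu> coefmap_in_fps_over[OF subr_O_K2 hom_ev2 A]], unfold coefmap_nth)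
  fix i
  have Ai: "A $ i \<in> fps_over (fps_over O_K)" using A by (rule fps_overD)
  show "ereal (real N * \<mu> - real i * \<mu>) \<le> w (ev (coefmap (\<lambda>f. eval1 w f z) (A $ i)) y)"
  proof (rule ev_ge[OF xyz(2,5) \<mu> coefmap_in_fps_over[OF subr_O_K1 hom_eval1 Ai]], unfold coefmap_nth)
    fix j
    have Aij: "A $ i $ j \<in> fps_over O_K" using Ai by (rule fps_overD)
    show "ereal (real N * \<mu> - real i * \<mu> - real j * \<mu>) \<le> w (eval1 w (A $ i $ j) z)"
    proof (rule eval1_ge[OF Aij])
      fix k
      show "ereal (real N * \<mu> - real i * \<mu> - real j * \<mu> - real k * \<mu>) \<le> v (A $ i $ j $ k)"
      proof (cases "i + j + k < N")
        case True
        then show ?thesis using N by (simp add: vanishes_to_order_def)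
      next
        case False
        then have "real N * \<mu> \<le> real (i + j + k) * \<mu>" using \<mu> by (intro mult_right_mono) auto
        then have "ereal (real N * \<mu> - real i * \<mu> - real j * \<mu> - real k * \<mu>) \<le> 0"
          by (simp add: algebra_simps)
        also have "0 \<le> v (A $ i $ j $ k)" using fps_overD[OF Aij] by (simp add: O_K_def)
        finally show ?thesis .
      qed
    qed
  qed
qed

text \<open>The homomorphism \<open>ev3\<close> sends the finite partial sums of the formal
  substitution exactly to the partial sums that define \<open>eval2\<close>. Since the former agree
  with \<open>subst2 F A B\<close> to order N, the latter are within N \<mu> of its value.\<close>

lemma ev3_subst2:
  assumes F: "F \<in> fps_over (fps_over O_K)"
    and A: "A \<in> fps_over (fps_over (fps_over O_K))" "vanishes_to_order (Suc 0) A"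
    and B: "B \<in> fps_over (fps_over (fps_over O_K))" "vanishes_to_order (Suc 0) B"
  shows "eval2 w F (ev3 x y z A) (ev3 x y z B) = ev3 x y z (subst2 F A B)"
    and "vlim w (\<lambda>N. \<Sum>i<N. \<Sum>j<N. to_ac (F $ i $ j) * ev3 x y z A ^ i * ev3 x y z B ^ j)
      (eval2 w F (ev3 x y z A) (ev3 x y z B))"
proof -
  let ?V = "fps_over (fps_over (fps_over O_K))"
  let ?h = "ev3 x y z"
  note h = subr_O_K3 hom_ev3(1)
  let ?P = "\<lambda>N. \<Sum>i<N. \<Sum>j<N. const3 (F $ i $ j) * (A ^ i * B ^ j)"
  have Fij: "F $ i $ j \<in> O_K" for i j using F by (intro fps_overD)
  have AB: "A ^ i * B ^ j \<in> ?V" for i j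
    by (intro subr_mult[OF subr_O_K3] subr_power[OF subr_O_K3] A B)
  have summand: "const3 (F $ i $ j) * (A ^ i * B ^ j) \<in> ?V" for i j
    by (intro subr_mult[OF subr_O_K3] AB const3_integral Fij)
  have P: "?P N \<in> ?V" for N by (intro subr_sum[OF subr_O_K3] summand)
  have hP: "?h (?P N) = (\<Sum>i<N. \<Sum>j<N. to_ac (F $ i $ j) * ?h A ^ i * ?h B ^ j)" for N
  proof -
    have "?h (const3 (F $ i $ j) * (A ^ i * B ^ j)) = to_ac (F $ i $ j) * ?h A ^ i * ?h B ^ j" for i j
      by (simp add: hom_on_mult[OF h] hom_on_power[OF h] AB A B const3_integral Fij subr_power[OF subr_O_K3]
          ev3_const3 mult.assoc)
    then show ?thesis by (simp add: hom_on_sum[OF h] summand subr_sum[OF subr_O_K3])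
  qed
  have S: "subst2 F A B \<in> ?V" by (rule subst2_integral[OF F A(1) B(1)])
  have "ereal (real N * \<mu>) \<le> w (?h (?P N) - ?h (subst2 F A B))" for N
  proof -
    have "vanishes_to_order N (?P N - subst2 F A B)"
      using subst2_eq_partial_sum[of A B _ _ _ N F] A(2) B(2) by (simp add: vanishes_to_order_def)
    then show ?thesis
      unfolding hom_on_diff[OF h P S, symmetric] by (rule ev3_ge[OF subr_diff[OF subr_O_K3 P S]])
  qed
  then have close: "ereal (real N * \<mu>) \<le>
      w ((\<Sum>i<N. \<Sum>j<N. to_ac (F $ i $ j) * ?h A ^ i * ?h B ^ j) - ?h (subst2 F A B))" for N
    unfolding hP .
  show eq: "eval2 w F (?h A) (?h B) = ?h (subst2 F A B)"
    by (rule eval2_unique[OF valued_field_axioms \<mu> close])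
  show "vlim w (\<lambda>N. \<Sum>i<N. \<Sum>j<N. to_ac (F $ i $ j) * ?h A ^ i * ?h B ^ j) (eval2 w F (?h A) (?h B))"
    unfolding eq by (rule vlim_I_linear[OF \<mu> close])
qed

lemma ev3_subst1:
  assumes f: "f \<in> fps_over O_K"
    and A: "A \<in> fps_over (fps_over (fps_over O_K))" "vanishes_to_order (Suc 0) A"
  shows "eval1 w f (ev3 x y z A) = ev3 x y z (subst1 f A)"
proof -
  let ?V = "fps_over (fps_over (fps_over O_K))"
  let ?h = "ev3 x y z"
  note h = subr_O_K3 hom_ev3(1)
  let ?P = "\<lambda>N. \<Sum>i<N. const3 (f $ i) * A ^ i"
  have fi: "f $ i \<in> O_K" for i using f by (rule fps_overD)
  have Ai: "A ^ i \<in> ?V" for i by (intro subr_power[OF subr_O_K3] A)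
  have summand: "const3 (f $ i) * A ^ i \<in> ?V" for i
    by (intro subr_mult[OF subr_O_K3] Ai const3_integral fi)
  have P: "?P N \<in> ?V" for N by (intro subr_sum[OF subr_O_K3] summand)
  have hP: "?h (?P N) = (\<Sum>i<N. coefmap to_ac f $ i * ?h A ^ i)" for N
    by (simp add: hom_on_sum[OF h] summand hom_on_mult[OF h] hom_on_power[OF h] Ai A const3_integral fi ev3_const3)
  have S: "subst1 f A \<in> ?V" by (rule subst1_integral[OF f A(1)])
  have "ereal (real N * \<mu>) \<le> w (?h (?P N) - ?h (subst1 f A))" for N
  proof -
    have "vanishes_to_order N (?P N - subst1 f A)"
      using subst1_eq_partial_sum[of A _ _ _ N f] A(2) by (simp add: vanishes_to_order_def)
    then show ?thesis
      unfolding hom_on_diff[OF h P S, symmetric] by (rule ev3_ge[OF subr_diff[OF subr_O_K3 P S]])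
  qed
  then show ?thesis
    unfolding eval1_eq_ev hP by (intro ev_unique[OF \<mu>])
qed

text \<open>Multiplicativity of the action is an identity for \<open>fps_compose\<close> in one
  variable, so it is transported here and not through \<open>ev3\<close>. The powers
  \<open>g ^ i\<close> vanish below degree i, which makes the partial sums agree with the composite
  to order N.\<close>

lemma eval1_compose:
  assumes f: "f \<in> fps_over O_K" and g: "g \<in> fps_over O_K" "g $ 0 = 0"
  shows "eval1 w (fps_compose f g) z = eval1 w f (eval1 w g z)"
proof -
  let ?h = "\<lambda>A. eval1 w A z"
  note h = subr_O_K1 hom_eval1(1)
  let ?P = "\<lambda>N. \<Sum>i<N. fps_const (f $ i) * g ^ i"
  have fi: "f $ i \<in> O_K" for i using f by (rule fps_overD)
  have gi: "g ^ i \<in> fps_over O_K" for i by (intro subr_power[OF subr_O_K1] g)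
  have c: "fps_const (f $ i) \<in> fps_over O_K" for i by (intro fps_const_in_fps_over[OF subr_O_K] fi)
  have summand: "fps_const (f $ i) * g ^ i \<in> fps_over O_K" for i
    by (intro subr_mult[OF subr_O_K1] gi c)
  have P: "?P N \<in> fps_over O_K" for N by (intro subr_sum[OF subr_O_K1] summand)
  have hP: "?h (?P N) = (\<Sum>i<N. coefmap to_ac f $ i * ?h g ^ i)" for N
    by (simp add: hom_on_sum[OF h] summand hom_on_mult[OF h] hom_on_power[OF h] gi g c eval1_vars fi)
  have S: "fps_compose f g \<in> fps_over O_K"
    unfolding fps_over_def mem_Collect_eq fps_compose_nth
    by (intro allI subr_sum[OF subr_O_K] subr_mult[OF subr_O_K] fi fps_overD[OF gi])
  have "ereal (real N * \<mu>) \<le> w (?h (?P N) - ?h (fps_compose f g))" for N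
  proof -
    have *: "(?P N - fps_compose f g) $ k = 0" if "k < N" for k
    proof -
      have "?P N $ k = (\<Sum>i<N. f $ i * (g ^ i) $ k)" by (simp add: fps_sum_nth)
      also have "\<dots> = (\<Sum>i=0..k. f $ i * (g ^ i) $ k)"
        using that startsby_zero_power_prefix[OF g(2)]
        by (intro sum.mono_neutral_right) auto
      finally show ?thesis by (simp add: fps_compose_nth)
    qed
    have "ereal (real N * \<mu>) \<le> w (?h (?P N - fps_compose f g))"
    proof (rule eval1_ge)
      show D: "?P N - fps_compose f g \<in> fps_over O_K" by (intro subr_diff[OF subr_O_K1] P S)
      fix k
      show "ereal (real N * \<mu> - real k * \<mu>) \<le> v ((?P N - fps_compose f g) $ k)"
      proof (cases "k < N")
        case False
        then have "ereal (real N * \<mu> - real k * \<mu>) \<le> 0" using \<mu> by simp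
        also have "0 \<le> v ((?P N - fps_compose f g) $ k)" using fps_overD[OF D] by (simp add: O_K_def)
        finally show ?thesis .
      qed (simp only: *, simp)
    qed
    then show ?thesis using hom_on_diff[OF h P S] by simp
  qed
  then show ?thesis
    unfolding hP eval1_eq_ev[of f] by (rule ev_unique[OF \<mu>, symmetric])
qed

lemma eval1_approx:
  assumes f: "f \<in> fps_over O_K"
  shows "ereal (real N * \<mu>) \<le> w ((\<Sum>i<N. to_ac (f $ i) * z ^ i) - eval1 w f z)"
  using ev_approx[OF xyz(3,6) \<mu> coefmap_to_ac_integral[OF f], of N] by (simp add: eval1_eq_ev)

end

end


context evaluation begin

text \<open>Near \<open>0\<close> the series is \<open>c s\<close> plus a contraction, so the equation is solved by the iteration
  \<open>s \<mapsto> (t - (f(s) - c s)) / c\<close>.\<close>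

lemma solve_near_0:
  assumes f: "f \<in> fps_over O_K" "f $ 0 = 0" "v (f $ 1) = 1" and t: "t \<in> E" "2 < w t"
  obtains s where "0 < w s" "eval1 w f s = t"
proof (cases "t = 0")
  case True
  have "eval1 w f 0 = 0"
    unfolding eval1_eq_ev
    using ev_unique[of 1 "coefmap to_ac f" 0 0] f(2)
    by (simp add: power_0_left if_distrib cong: if_cong)
  then show ?thesis using that[of 0] True by simp
next
  case False
  then obtain \<tau> where \<tau>: "w t = ereal \<tau>" using w_real by blast
  have \<tau>2: "2 < \<tau>" using t(2) \<tau> by simp
  \<comment> \<open>Dividing by c lowers valuations by 1, so a solution has valuation about \<tau> -
    1. The bound \<tau> > 2 is used twice: the iteration gains \<mu> - 1 > 0 at each step, and 2
    \<mu> \<ge> \<tau> keeps the iterates in the ball of points of valuation at least \<mu>.\<close>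
  define \<mu> where "\<mu> = \<tau> - 1"
  have \<mu>: "1 < \<mu>" "0 < \<mu>" using \<tau>2 by (auto simp: \<mu>_def)
  define c where "c = to_ac (f $ 1)"
  have c0: "c \<noteq> 0" using f(3) by (auto simp: c_def)
  have wc: "w c = 1" using f(3) by (simp add: c_def w_to_ac)
  define i where "i = inverse c"
  have ci: "c * i = 1" using c0 by (simp add: i_def)
  have wi: "w i = ereal (-1)"
    using w_mult[of c i] wc ci by (cases "w i") (auto simp: one_ereal_def zero_ereal_def)
  have iE: "i \<in> E" using to_ac_E by (auto simp: i_def c_def simp flip: to_ac_inverse)
  define A where "A = coefmap to_ac f - fps_const c * fps_X"
  have F: "coefmap to_ac f \<in> fps_over integers" by (rule coefmap_to_ac_integral[OF f(1)])
  have ci': "c \<in> integers" using to_ac_E wc by (auto simp: integers_def c_def)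
  have cX: "fps_const c \<in> fps_over integers" "fps_X \<in> fps_over integers"
    by (intro fps_const_in_fps_over fps_X_in_fps_over subr_integers ci')+
  have "A \<in> fps_over integers"
    unfolding A_def by (intro subr_diff[OF subr_fps_over] subr_mult[OF subr_fps_over] subr_integers F cX)
  moreover have "A $ 0 = 0" "A $ 1 = 0" using f(2) by (simp_all add: A_def c_def)
  ultimately have A: "A \<in> fps_over integers" "A $ 0 = 0" "A $ 1 = 0" by blast+
  have evf: "eval1 w f x = ev A x + c * x" if "x \<in> E" "ereal \<mu> \<le> w x" for x
  proof -
    note h = subr_fps_over[OF subr_integers] hom_on_ev[OF that \<mu>(2)]
    have "ev (fps_const c * fps_X) x = c * x"
      using hom_on_mult[OF h cX] ev_fps_const[OF that \<mu>(2), of c] ev_fps_X[OF that \<mu>(2)] wc by simp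
    then have "ev A x = ev (coefmap to_ac f) x - c * x"
      unfolding A_def using hom_on_diff[OF h F subr_mult[OF subr_fps_over[OF subr_integers] cX]] by simp
    then show ?thesis by (simp add: eval1_eq_ev)
  qed
  define g where "g s = (t - ev A s) * i" for s
  have contr: "ereal (d + (\<mu> - 1)) \<le> w (g x - g y)"
    if "x \<in> E" "ereal \<mu> \<le> w x" "y \<in> E" "ereal \<mu> \<le> w y" "ereal d \<le> w (x - y)" for x y d
  proof -
    have "ereal (d + \<mu>) \<le> w (ev A x - ev A y)" by (rule ev_diff_ge[OF A \<mu>(2) that])
    then have "ereal ((d + \<mu>) + (-1)) \<le> w ((ev A y - ev A x) * i)"
      by (intro w_mult_ge) (auto simp: w_diff_commute wi)
    moreover have "g x - g y = (ev A y - ev A x) * i" by (simp add: g_def algebra_simps)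
    moreover have "d + \<mu> + (-1) = d + (\<mu> - 1)" by simp
    ultimately show ?thesis by (simp only:)
  qed
  have evA0: "ev A 0 = 0"
    using ev_unique[of 1 A 0 0] A(2) by (simp add: power_0_left if_distrib cong: if_cong)
  have gE: "g x \<in> E \<and> ereal \<mu> \<le> w (g x)" if x: "x \<in> E" "ereal \<mu> \<le> w x" for x
  proof
    show "g x \<in> E"
      unfolding g_def by (intro E_mult E_diff t iE ev_in_E[OF x \<mu>(2) A(1)])
    have "ereal (\<mu> + \<mu>) \<le> w (ev A x - ev A 0)"
      using x by (intro ev_diff_ge[OF A \<mu>(2)]) (auto simp: E_0)
    then have "ereal (\<mu> + \<mu>) \<le> w (ev A x)" by (simp add: evA0)
    moreover have "ereal \<tau> \<le> ereal (\<mu> + \<mu>)" using \<tau>2 by (simp add: \<mu>_def)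
    ultimately have "ereal \<tau> \<le> w (ev A x)" by (rule order_trans[rotated])
    then have "ereal \<tau> \<le> w (t - ev A x)" using \<tau> by (intro w_diff_ge) auto
    then have "ereal (\<tau> + (-1)) \<le> w (g x)" unfolding g_def by (intro w_mult_ge) (auto simp: wi)
    then show "ereal \<mu> \<le> w (g x)" by (simp add: \<mu>_def)
  qed
  define s where "s n = (g ^^ n) 0" for n
  have s: "s n \<in> E \<and> ereal \<mu> \<le> w (s n)" for n
    by (induction n) (auto simp: s_def E_0 gE)
  have step: "ereal (real n * (\<mu> - 1)) \<le> w (s (Suc n) - s n)" for n
  proof (induction n)
    case 0
    have "0 \<le> ereal \<mu>" using \<mu> by simp
    also have "\<dots> \<le> w (s 1)" using s by blast
    finally show ?case by (simp add: s_def[of 0] zero_ereal_def)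
  next
    case (Suc n)
    have "s (Suc k) = g (s k)" for k by (simp add: s_def)
    moreover have "real (Suc n) * (\<mu> - 1) = real n * (\<mu> - 1) + (\<mu> - 1)" by (simp add: algebra_simps)
    ultimately show ?case using contr[OF _ _ _ _ Suc] s[of n] s[of "Suc n"] by (simp only:)
  qed
  have "vCauchy w s" using \<mu> step by (intro vCauchy_I_linear[of "\<mu> - 1"]) auto
  then obtain l where l: "l \<in> E" "vlim w s l"
    using E_complete s unfolding vcomplete_def by blast
  have wl: "ereal \<mu> \<le> w l"
    using vlim_le[OF l(2), of "ereal \<mu>" 0] s by auto
  have "l = g l"
  proof (rule eq_if_arbitrarily_close)
    fix d
    obtain N where N: "\<And>n. N \<le> n \<Longrightarrow> ereal d < w (s n - l)"
      using l(2) unfolding vlim_iff eventually_sequentially by blast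
    have "ereal d \<le> w (s N - l)" "ereal d \<le> w (s (Suc N) - l)" using N[of N] N[of "Suc N"] by auto
    note * = this
    have "ereal (d + (\<mu> - 1)) \<le> w (g (s N) - g l)"
      using contr[OF _ _ l(1) wl *(1)] s by blast
    moreover have "ereal d \<le> ereal (d + (\<mu> - 1))" using \<mu> by simp
    ultimately have "ereal d \<le> w (g (s N) - g l)" by (rule order_trans[rotated])
    then have "ereal d \<le> w (s (Suc N) - g l)" by (simp add: s_def)
    then show "ereal d \<le> w (l - g l)"
      using *(2) w_trans[of "ereal d" l "s (Suc N)" "g l"] by (simp add: w_diff_commute)
  qed
  then have "c * l = (t - ev A l) * (c * i)" by (simp add: g_def mult.left_commute[of c])
  then have "eval1 w f l = t" using evf[OF l(1) wl] ci by (simp add: algebra_simps)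
  moreover have "0 < w l" using wl \<mu>(2) by (meson ereal_less(2) less_le_trans)
  ultimately show ?thesis using that by blast
qed

end


section \<open>The module of points\<close>

lemma carrier_valuation_ring [simp]: "x \<in> carrier (valuation_ring vF) \<longleftrightarrow> 0 \<le> vF x"
  by (simp add: valuation_ring_def)

locale formal_module = complete_valued_field v w + F: valued_field vF
  for v :: "'k::field \<Rightarrow> ereal" and w :: "'k alg_closure \<Rightarrow> ereal" and vF :: "'f::field \<Rightarrow> ereal" +
  fixes \<iota> :: "'f \<Rightarrow> 'k" and F :: "'k fps fps" and act :: "'f \<Rightarrow> 'k fps"
  assumes O_module: "formal_O_module vF v \<iota> F act"
begin

lemma act_integral: "0 \<le> vF a \<Longrightarrow> act a \<in> fps_over O_K"
  and act_0: "0 \<le> vF a \<Longrightarrow> act a $ 0 = 0" and act_1: "0 \<le> vF a \<Longrightarrow> act a $ 1 = \<iota> a"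
  and act_subst: "0 \<le> vF a \<Longrightarrow> subst1 (act a) (subst2 F varX varY) =
    subst2 F (subst1 (act a) varX) (subst1 (act a) varY)"
  and act_one: "act 1 = fps_X"
  and act_add: "0 \<le> vF a \<Longrightarrow> 0 \<le> vF b \<Longrightarrow>
    subst1 (act (a + b)) varX = subst2 F (subst1 (act a) varX) (subst1 (act b) varX)"
  and act_mult: "0 \<le> vF a \<Longrightarrow> 0 \<le> vF b \<Longrightarrow> act (a * b) = fps_compose (act a) (act b)"
  and F_integral: "F \<in> fps_over (fps_over O_K)"
  and F_X_0: "subst2 F varX 0 = varX" and F_0_Y: "subst2 F 0 varY = varY"
  and F_comm: "subst2 F varX varY = subst2 F varY varX"
  and F_assoc: "subst2 F (subst2 F varX varY) varZ = subst2 F varX (subst2 F varY varZ)"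
  using O_module
  by (auto simp: formal_O_module_def formal_group_law_def fps_over_def O_K_def)

lemma F_nth_0: "F $ a $ 0 = (if a = 1 then 1 else 0)"
proof -
  have "F $ i $ j * (varX ^ i * 0 ^ j) $ a $ 0 $ 0 = (if j = 0 then if i = a then F $ i $ 0 else 0 else 0)" for i j
    by (auto simp: varX_def power_0_left)
  then have "subst2 F varX 0 $ a $ 0 $ 0 = F $ a $ 0"
    by (simp add: subst2_def)
  then show ?thesis unfolding F_X_0 by (auto simp: varX_def fps_X_def)
qed

lemma F_0_nth: "F $ 0 $ b = (if b = 1 then 1 else 0)"
proof -
  have "F $ i $ j * (0 ^ i * varY ^ j) $ 0 $ b $ 0 = (if j = b then if i = 0 then F $ 0 $ j else 0 else 0)" for i j
    by (auto simp: varY_def power_0_left fps_const_power)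
  then have "subst2 F 0 varY $ 0 $ b $ 0 = F $ 0 $ b"
    by (simp add: subst2_def)
  then show ?thesis unfolding F_0_Y by (auto simp: varY_def fps_X_def)
qed

section \<open>Group law and action of O on the points of positive valuation\<close>

abbreviation padd where "padd \<equiv> eval2 w F"
abbreviation smul where "smul a \<equiv> eval1 w (act a)"

text \<open>Three points in one ring and one common \<mu> cover all module laws; associativity is
  the law that involves all three.\<close>

lemma evaluation_containing:
  assumes "0 < w x" "0 < w y" "0 < w z"
  obtains E \<mu> where "evaluation v w E" "x \<in> E" "y \<in> E" "z \<in> E"
    "ereal \<mu> \<le> w x" "ereal \<mu> \<le> w y" "ereal \<mu> \<le> w z" "0 < \<mu>"
proof -
  obtain E where E: "complete_subring w E" "range to_ac \<subseteq> E" "{x, y, z} \<subseteq> E"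
    using complete_subring_containing[of "{x, y, z}"] by auto
  have ev: "evaluation v w E"
    using complete_valued_field_axioms E(1,2) by (simp add: evaluation_def evaluation_axioms_def)
  obtain \<mu>1 \<mu>2 \<mu>3 where "0 < \<mu>1" "ereal \<mu>1 \<le> w x" "0 < \<mu>2" "ereal \<mu>2 \<le> w y" "0 < \<mu>3" "ereal \<mu>3 \<le> w z"
    using assms pos_lower_bound by metis
  note \<mu> = this
  define m where "m = min \<mu>1 (min \<mu>2 \<mu>3)"
  have m: "m \<le> \<mu>1" "m \<le> \<mu>2" "m \<le> \<mu>3" "0 < m" using \<mu> by (auto simp: m_def)
  have "ereal m \<le> w x" by (rule order_trans[OF _ \<mu>(2)]) (simp add: m)
  moreover have "ereal m \<le> w y" by (rule order_trans[OF _ \<mu>(4)]) (simp add: m)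
  moreover have "ereal m \<le> w z" by (rule order_trans[OF _ \<mu>(6)]) (simp add: m)
  ultimately show ?thesis using that[OF ev] E(3) m(4) by simp
qed

context
  fixes E x y z \<mu>
  assumes ev: "evaluation v w E" and E: "x \<in> E" "y \<in> E" "z \<in> E"
    and \<mu>: "ereal \<mu> \<le> w x" "ereal \<mu> \<le> w y" "ereal \<mu> \<le> w z" "0 < \<mu>"
begin

interpretation evaluation v w E by (rule ev)

lemmas ev_setup = E \<mu>

lemma ev3_padd:
  assumes "A \<in> fps_over (fps_over (fps_over O_K))" "vanishes_to_order (Suc 0) A"
    and "B \<in> fps_over (fps_over (fps_over O_K))" "vanishes_to_order (Suc 0) B"
  shows "padd (ev3 x y z A) (ev3 x y z B) = ev3 x y z (subst2 F A B)"
  by (rule ev3_subst2(1)[OF ev_setup F_integral assms])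

lemma vanishes_F: "vanishes_to_order (Suc 0) (subst2 F A B)"
  by (rule vanishes_subst2) (simp add: F_nth_0)

lemmas vars = vars_integral vanishes_vars ev3_vars[OF ev_setup] vanishes_F
  subst2_integral[OF F_integral]

lemma padd_comm_aux: "padd x y = padd y x"
  using ev3_padd[of varX varY] ev3_padd[of varY varX] F_comm by (simp add: vars)

lemma padd_assoc_aux: "padd (padd x y) z = padd x (padd y z)"
proof -
  have "padd (padd x y) z = ev3 x y z (subst2 F (subst2 F varX varY) varZ)"
    using ev3_padd[of "subst2 F varX varY" varZ] ev3_padd[of varX varY] by (simp add: vars)
  also have "\<dots> = padd x (padd y z)"
    unfolding F_assoc
    using ev3_padd[of varX "subst2 F varY varZ"] ev3_padd[of varY varZ] by (simp add: vars)
  finally show ?thesis .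
qed

lemma padd_0_aux: "padd x 0 = x"
  using ev3_padd[of varX 0] hom_on_0[OF subr_O_K3 hom_ev3(1)[OF ev_setup]]
  by (simp add: vars F_X_0)

lemma padd_ge_aux: "ereal \<mu> \<le> w (padd x y)"
  using ev3_ge[OF ev_setup subst2_integral[OF F_integral vars_integral(1,2)] vanishes_F]
    ev3_padd[of varX varY] by (simp add: vars)

lemma padd_lim_aux:
  "vlim w (\<lambda>N. \<Sum>i<N. \<Sum>j<N. to_ac (F $ i $ j) * x ^ i * y ^ j) (padd x y)"
  using ev3_subst2(2)[OF ev_setup F_integral vars_integral(1) vanishes_vars(1) vars_integral(2) vanishes_vars(2)]
  by (simp add: vars)

lemma smul_ge_aux: assumes "0 \<le> vF a" shows "ereal \<mu> \<le> w (smul a x)"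
proof (rule eval1_ge[OF E(1,1,1) \<mu>(1,1,1,4) act_integral[OF assms]])
  fix i
  show "ereal (\<mu> - real i * \<mu>) \<le> v (act a $ i)"
  proof (cases "i = 0")
    case False
    then have "1 * \<mu> \<le> real i * \<mu>" using \<mu>(4) by (intro mult_right_mono) auto
    then have "ereal (\<mu> - real i * \<mu>) \<le> 0" by simp
    also have "0 \<le> v (act a $ i)" using fps_overD[OF act_integral[OF assms]] by (simp add: O_K_def)
    finally show ?thesis .
  qed (simp add: act_0 assms)
qed

lemma smul_padd_aux: assumes a: "0 \<le> vF a" shows "smul a (padd x y) = padd (smul a x) (smul a y)"
proof -
  note s = ev3_subst1[OF ev_setup act_integral[OF a]]
  have v: "vanishes_to_order (Suc 0) (subst1 (act a) A)" for A
    using vanishes_subst1 act_0[OF a] by blast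
  have "smul a (padd x y) = ev3 x y z (subst1 (act a) (subst2 F varX varY))"
    using ev3_padd[of varX varY] s[of "subst2 F varX varY"] by (simp add: vars)
  also have "\<dots> = padd (smul a x) (smul a y)"
    unfolding act_subst[OF a]
    using ev3_padd[of "subst1 (act a) varX" "subst1 (act a) varY"] s[of varX] s[of varY]
    by (simp add: vars v subst1_integral[OF act_integral[OF a]])
  finally show ?thesis .
qed

lemma smul_add_aux:
  assumes a: "0 \<le> vF a" and b: "0 \<le> vF b"
  shows "smul (a + b) x = padd (smul a x) (smul b x)"
proof -
  have ab: "0 \<le> vF (a + b)" using a b by (rule F.w_add_ge)
  have v: "c \<in> {a, b} \<Longrightarrow> vanishes_to_order (Suc 0) (subst1 (act c) A)" for A c
    using vanishes_subst1 act_0 a b by blast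
  have "smul (a + b) x = ev3 x y z (subst1 (act (a + b)) varX)"
    using ev3_subst1[OF ev_setup act_integral[OF ab], of varX] by (simp add: vars)
  also have "\<dots> = padd (smul a x) (smul b x)"
    unfolding act_add[OF a b]
    using ev3_padd[of "subst1 (act a) varX" "subst1 (act b) varX"]
      ev3_subst1[OF ev_setup act_integral[OF a], of varX] ev3_subst1[OF ev_setup act_integral[OF b], of varX]
    by (simp add: vars v subst1_integral[OF act_integral] a b)
  finally show ?thesis .
qed

lemma smul_mult_aux:
  assumes a: "0 \<le> vF a" and b: "0 \<le> vF b" shows "smul (a * b) x = smul a (smul b x)"
  using eval1_compose[OF E(1,1,1) \<mu>(1,1,1,4) act_integral[OF a] act_integral[OF b] act_0[OF b]]
  by (simp add: act_mult[OF a b])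

lemma smul_one_aux: "smul 1 x = x"
  using eval1_vars(1)[OF E(1,1,1) \<mu>(1,1,1,4)] by (simp add: act_one)

lemma smul_approx_aux:
  assumes "0 \<le> vF a"
  shows "ereal (real N * \<mu>) \<le> w ((\<Sum>i<N. to_ac (act a $ i) * x ^ i) - smul a x)"
  by (rule eval1_approx[OF E(1,1,1) \<mu>(1,1,1,4) act_integral[OF assms]])

end

lemma padd_comm: assumes "0 < w x" "0 < w y" shows "padd x y = padd y x"
  using evaluation_containing[OF assms assms(1)] padd_comm_aux by metis

lemma padd_assoc:
  assumes "0 < w x" "0 < w y" "0 < w z" shows "padd (padd x y) z = padd x (padd y z)"
  using evaluation_containing[OF assms] padd_assoc_aux by metis

lemma padd_0: assumes "0 < w x" shows "padd x 0 = x"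
  using evaluation_containing[OF assms assms assms] padd_0_aux by metis

lemma padd_ge: assumes "0 < \<mu>" "ereal \<mu> \<le> w x" "ereal \<mu> \<le> w y" shows "ereal \<mu> \<le> w (padd x y)"
proof -
  have "0 < w x" "0 < w y" using assms by (meson ereal_less(2) less_le_trans)+
  from evaluation_containing[OF this this(1)] show ?thesis using padd_ge_aux assms by metis
qed

lemma padd_pos: assumes "0 < w x" "0 < w y" shows "0 < w (padd x y)"
proof -
  obtain E \<mu> where "0 < \<mu>" "ereal \<mu> \<le> w x" "ereal \<mu> \<le> w y"
    using evaluation_containing[OF assms assms(1)] by metis
  then show ?thesis using padd_ge by (meson ereal_less(2) less_le_trans)
qed

text \<open>Estimates come with a finite real \<mu>; this passes from them to valuations, including
  the value \<infinity> at x = 0. In particular \<open>smul_ge\<close> also shows that the action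
  fixes 0.\<close>

lemma le_w_I:
  assumes "0 < w x" "\<And>\<mu>. 0 < \<mu> \<Longrightarrow> ereal \<mu> \<le> w x \<Longrightarrow> ereal \<mu> \<le> w y"
  shows "w x \<le> w y"
proof (cases "w x")
  case PInf
  have "ereal c \<le> w y" for c
  proof -
    have "ereal (max 1 c) \<le> w y" by (rule assms(2)) (use PInf in auto)
    then show ?thesis by (rule order_trans[rotated]) simp
  qed
  then have "w y = \<infinity>" by (metis ereal_top)
  then show ?thesis by simp
qed (use assms in auto)

lemma smul_ge: assumes a: "0 \<le> vF a" and x: "0 < w x" shows "w x \<le> w (smul a x)"
proof (rule le_w_I[OF x])
  fix \<mu> assume \<mu>: "0 < \<mu>" "ereal \<mu> \<le> w x"
  from evaluation_containing[OF x x x]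
  show "ereal \<mu> \<le> w (smul a x)" using smul_ge_aux[OF _ _ _ _ \<mu>(2,2,2,1) a] by metis
qed

lemma smul_padd:
  assumes "0 \<le> vF a" "0 < w x" "0 < w y" shows "smul a (padd x y) = padd (smul a x) (smul a y)"
  using evaluation_containing[OF assms(2,3,3)] smul_padd_aux[OF _ _ _ _ _ _ _ _ assms(1)] by metis

lemma smul_add:
  assumes "0 \<le> vF a" "0 \<le> vF b" "0 < w x" shows "smul (a + b) x = padd (smul a x) (smul b x)"
  using evaluation_containing[OF assms(3,3,3)] smul_add_aux[OF _ _ _ _ _ _ _ _ assms(1,2)] by metis

lemma smul_mult:
  assumes "0 \<le> vF a" "0 \<le> vF b" "0 < w x" shows "smul (a * b) x = smul a (smul b x)"
  using evaluation_containing[OF assms(3,3,3)] smul_mult_aux[OF _ _ _ _ _ _ _ _ assms(1,2)] by metis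

lemma smul_one: assumes "0 < w x" shows "smul 1 x = x"
  using evaluation_containing[OF assms assms assms] smul_one_aux by metis

lemma smul_approx:
  assumes "0 \<le> vF a" "0 < \<mu>" "ereal \<mu> \<le> w x"
  shows "ereal (real N * \<mu>) \<le> w ((\<Sum>i<N. to_ac (act a $ i) * x ^ i) - smul a x)"
proof -
  have x: "0 < w x" using assms by (meson ereal_less(2) less_le_trans)
  obtain E where "evaluation v w E" "x \<in> E" using evaluation_containing[OF x x x] by metis
  then show ?thesis using smul_approx_aux assms by blast
qed

text \<open>\<open>F(X, Y) = X + Y + XY G(X, Y)\<close>\<close>

lemma padd_approx:
  assumes \<mu>: "0 < \<mu>" "ereal \<mu> \<le> w x" "ereal \<mu> \<le> w y" and d: "ereal d \<le> w y"
  shows "ereal (\<mu> + d) \<le> w (padd x y - (x + y))"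
proof -
  have x: "0 < w x" "0 < w y" using \<mu> by (meson ereal_less(2) less_le_trans)+
  obtain E where E: "evaluation v w E" "x \<in> E" "y \<in> E" using evaluation_containing[OF x x(1)] by metis
  have *: "ereal (\<mu> + d) \<le> w ((\<Sum>i<N. \<Sum>j<N. to_ac (F $ i $ j) * x ^ i * y ^ j) - (x + y))"
    if N: "2 \<le> N" for N
  proof -
    \<comment> \<open>\<open>?g\<close> holds the coefficients of X and Y; N \<ge> 2 puts the
      exponent 1 in range. What remains is divisible by X Y.\<close>
    let ?g = "\<lambda>i j. (if j = 0 then if i = 1 then x else 0 else 0) + (if j = 1 then if i = 0 then y else 0 else 0)"
    have "(\<Sum>i<N. \<Sum>j<N. ?g i j) = x + y"
      using N by (simp add: sum.distrib)
    then have "(\<Sum>i<N. \<Sum>j<N. to_ac (F $ i $ j) * x ^ i * y ^ j) - (x + y) =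
        (\<Sum>i<N. \<Sum>j<N. to_ac (F $ i $ j) * x ^ i * y ^ j - ?g i j)"
      by (simp add: sum_subtractf)
    also have "ereal (\<mu> + d) \<le> w \<dots>"
    proof (intro w_sum_ge)
      fix i j :: nat
      consider "j = 0" | "i = 0" "j \<noteq> 0" | "i \<noteq> 0" "j \<noteq> 0" by blast
      then show "ereal (\<mu> + d) \<le> w (to_ac (F $ i $ j) * x ^ i * y ^ j - ?g i j)"
      proof cases
        case 1 then show ?thesis by (simp add: F_nth_0)
      next
        case 2 then show ?thesis by (simp add: F_0_nth)
      next
        case 3
        then have "to_ac (F $ i $ j) * x ^ i * y ^ j - ?g i j =
            (to_ac (F $ i $ j) * (x ^ (i - 1) * y ^ (j - 1))) * (x * y)"
          by (cases i; cases j) (simp_all add: mult_ac)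
        moreover have "0 \<le> w (to_ac (F $ i $ j) * (x ^ (i - 1) * y ^ (j - 1)))"
          using fps_overD[OF fps_overD[OF F_integral]] x
          by (intro w_mult_nonneg w_power_nonneg) (auto simp: w_to_ac O_K_def)
        ultimately show ?thesis using w_mult_ge_right[OF _ w_mult_ge[OF \<mu>(2) d]] by simp
      qed
    qed
    finally show ?thesis .
  qed
  show ?thesis
    by (rule vlim_le[OF padd_lim_aux[OF E(1,2,3,3) \<mu>(2,3,3,1)]])
      (rule eventually_sequentiallyI[of 2], rule *)
qed

text \<open>The value z of [0] at x satisfies z = z + z in the formal group. There addition differs
  from that of the field by a term of valuation at least 2 w(z), so w(z) \<ge> 2 w(z), which is
  impossible for z \<noteq> 0. The inverse [-1](x) is derived from this.\<close>

lemma smul_0: assumes x: "0 < w x" shows "smul 0 x = 0"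
proof (rule ccontr)
  define z where "z = smul 0 x"
  assume "smul 0 x \<noteq> 0"
  then obtain r where r: "w z = ereal r" using w_real unfolding z_def by blast
  have "0 < w z" using x smul_ge[of 0 x] unfolding z_def by (simp add: less_le_trans)
  then have "0 < r" using r by simp
  have "z = padd z z" using smul_add[of 0 0 x] x by (simp add: z_def)
  then have "ereal (r + r) \<le> w (z - (z + z))"
    using padd_approx[of r z z r] r \<open>0 < r\<close> by simp
  then show False using r \<open>0 < r\<close> by simp
qed

lemma padd_smul_minus_one: assumes x: "0 < w x" shows "padd x (smul (- 1) x) = 0"
  using smul_add[of 1 "-1" x] x by (simp add: smul_one smul_0)

lemma w_padd_diff: assumes x: "0 < w x" and y: "0 < w y" shows "w (padd x y - x) = w y"
proof (cases "y = 0")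
  case False
  then obtain r where r: "w y = ereal r" using w_real by blast
  obtain E \<mu> where \<mu>: "0 < \<mu>" "ereal \<mu> \<le> w x" "ereal \<mu> \<le> w y"
    using evaluation_containing[OF x y y] by metis
  have "ereal (\<mu> + r) \<le> w (padd x y - (x + y))"
    by (rule padd_approx[OF \<mu>]) (simp add: r)
  moreover have "w y < ereal (\<mu> + r)" using r \<mu> by simp
  ultimately have "w y < w (y - (padd x y - x))"
    using w_diff_commute[of "padd x y" "x + y"] by (simp add: algebra_simps)
  then show ?thesis by (rule w_eq_of_close)
qed (simp add: padd_0 x)

lemma smul_surj_near_0:
  assumes a: "0 \<le> vF a" "v (\<iota> a) = 1" and t: "2 < w t"
  obtains s where "0 < w s" "smul a s = t"
proof -
  have "0 < w t" using t by (rule less_trans[rotated]) simp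
  then obtain E where "evaluation v w E" "t \<in> E" using evaluation_containing by metis
  then interpret evaluation v w E by blast
  show ?thesis
    using solve_near_0[of "act a" t] act_integral[OF a(1)] act_0[OF a(1)] act_1[OF a(1)] a(2) \<open>t \<in> E\<close> t that
    by metis
qed

definition points :: "('f, 'k alg_closure) module" where
  "points = \<lparr>carrier = {x. 0 < w x}, monoid.mult = undefined, one = undefined,
      ring.zero = 0, add = padd, module.smult = smul\<rparr>"

lemma points_simps [simp]:
  "x \<in> carrier points \<longleftrightarrow> 0 < w x" "\<zero>\<^bsub>points\<^esub> = 0" "x \<oplus>\<^bsub>points\<^esub> y = padd x y" "a \<odot>\<^bsub>points\<^esub> x = smul a x"
  by (simp_all add: points_def)

lemma cring_valuation_ring: "cring (valuation_ring vF)"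
proof (intro cringI abelian_groupI comm_monoidI)
  show "\<exists>y\<in>carrier (valuation_ring vF). y \<oplus>\<^bsub>valuation_ring vF\<^esub> x = \<zero>\<^bsub>valuation_ring vF\<^esub>"
    if "x \<in> carrier (valuation_ring vF)" for x
    using that by (intro bexI[of _ "- x"]) (auto simp: valuation_ring_def ring_of_type_algebra_def)
qed (auto simp: valuation_ring_def ring_of_type_algebra_def algebra_simps
    intro: F.w_add_ge F.w_mult_nonneg)

lemma smul_pos: "0 \<le> vF a \<Longrightarrow> 0 < w x \<Longrightarrow> 0 < w (smul a x)"
  using smul_ge less_le_trans by blast

lemma module_points: "Module.module (valuation_ring vF) points"
proof (intro moduleI cring_valuation_ring abelian_groupI)
  show "\<exists>y\<in>carrier points. y \<oplus>\<^bsub>points\<^esub> x = \<zero>\<^bsub>points\<^esub>" if "x \<in> carrier points" for x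
    using that smul_pos[of "-1" x] padd_comm[of x "smul (-1) x"] padd_smul_minus_one[of x]
    by (intro bexI[of _ "smul (-1) x"]) auto
  show "x \<oplus>\<^bsub>points\<^esub> y = y \<oplus>\<^bsub>points\<^esub> x" if "x \<in> carrier points" "y \<in> carrier points" for x y
    using that padd_comm by simp
qed (auto simp: padd_pos padd_assoc padd_0 smul_pos smul_padd smul_add smul_mult smul_one
  padd_comm[of 0] valuation_ring_def ring_of_type_algebra_def)

text \<open>F(X, Y) - X is Y times a unit at points of positive valuation, so differences in the
  formal group and in the field are equally large. A product over field differences y - h can
  therefore be read inside the module.\<close>

lemma w_minus_points:
  assumes x: "0 < w x" and y: "0 < w y" shows "w (x \<ominus>\<^bsub>points\<^esub> y) = w (x - y)"
proof -
  interpret P: Module.module "valuation_ring vF" points by (rule module_points)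
  let ?d = "x \<ominus>\<^bsub>points\<^esub> y"
  have d: "0 < w ?d" using P.minus_closed[of x y] x y by simp
  have "y \<oplus>\<^bsub>points\<^esub> ?d = x"
    using x y P.a_lcomm[of y x "\<ominus>\<^bsub>points\<^esub> y"] P.r_neg[of y] P.a_inv_closed[of y] P.r_zero[of x]
    unfolding P.minus_eq points_simps(1) by simp
  then show ?thesis using w_padd_diff[OF y d] by simp
qed

end


section \<open>Roots of positive valuation\<close>

context valued_field begin

text \<open>The order of vanishing at 0 of the reduction of an integral polynomial. By
  \<open>weierstrass_roots\<close> it counts the roots of positive valuation with
  multiplicity.\<close>

definition weierstrass_degree :: "'a poly \<Rightarrow> nat \<Rightarrow> bool" where
  "weierstrass_degree g N \<longleftrightarrow> (\<forall>i. 0 \<le> w (Polynomial.coeff g i)) \<and>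
     w (Polynomial.coeff g N) = 0 \<and> (\<forall>i<N. 0 < w (Polynomial.coeff g i))"

lemma w_add_pos: "0 < w x \<Longrightarrow> 0 < w y \<Longrightarrow> 0 < w (x + y)"
  using w_add_ge[of "min (w x) (w y)" x y] by (auto intro: less_le_trans[of 0 "min (w x) (w y)"])

lemma w_sum_pos: "(\<And>i. i \<in> I \<Longrightarrow> 0 < w (f i)) \<Longrightarrow> 0 < w (sum f I)"
  by (induction I rule: infinite_finite_induct) (auto intro: w_add_pos)

lemma w_mult_pos: "0 < w x \<Longrightarrow> 0 \<le> w y \<Longrightarrow> 0 < w (x * y)" "0 \<le> w x \<Longrightarrow> 0 < w y \<Longrightarrow> 0 < w (x * y)"
  unfolding w_mult by (auto intro: add_pos_nonneg add_nonneg_pos)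

lemma weierstrass_degree_mult:
  assumes f: "weierstrass_degree f M" and g: "weierstrass_degree g N"
  shows "weierstrass_degree (f * g) (M + N)"
  unfolding weierstrass_degree_def coeff_mult
proof (intro conjI allI impI)
  note fg = f[unfolded weierstrass_degree_def] g[unfolded weierstrass_degree_def]
  show "0 \<le> w (\<Sum>i\<le>k. Polynomial.coeff f i * Polynomial.coeff g (k - i))" for k
    using fg by (intro w_sum_ge w_mult_nonneg) auto
  have pos: "0 < w (Polynomial.coeff f i * Polynomial.coeff g j)" if "i < M \<or> j < N" for i j
    using that fg by (auto intro: w_mult_pos)
  show "0 < w (\<Sum>i\<le>k. Polynomial.coeff f i * Polynomial.coeff g (k - i))" if "k < M + N" for k
    using that by (intro w_sum_pos pos) auto
  let ?r = "\<Sum>i\<in>{..M + N} - {M}. Polynomial.coeff f i * Polynomial.coeff g (M + N - i)"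
  have "(\<Sum>i\<le>M + N. Polynomial.coeff f i * Polynomial.coeff g (M + N - i)) =
      Polynomial.coeff f M * Polynomial.coeff g N + ?r"
    by (subst sum.remove[of _ M]) auto
  moreover have "0 < w ?r" by (intro w_sum_pos pos) auto
  moreover have "w (Polynomial.coeff f M * Polynomial.coeff g N) = 0"
    using fg by (simp add: w_mult)
  ultimately show "w (\<Sum>i\<le>M + N. Polynomial.coeff f i * Polynomial.coeff g (M + N - i)) = 0"
    using w_add_eq by simp
qed

text \<open>A root \<rho> of non-positive valuation gives T - \<rho> = -\<rho> (1 - T/\<rho>), whose
  second factor is integral of Weierstrass degree 0 and has valuation 0 at every y with w(y) > 0.
  Only the roots of positive valuation contribute; the scalars -\<rho> are collected in c.\<close>

lemma prod_linear_factors: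
  obtains c G where "c \<noteq> 0" "(\<Prod>\<rho>\<in>#A. [:- \<rho>, 1:]) = smult c G"
    "weierstrass_degree G (size {#\<rho> \<in># A. 0 < w \<rho>#})"
    "\<And>y. 0 < w y \<Longrightarrow> w (poly G y) = (\<Sum>\<rho>\<in>#{#\<rho> \<in># A. 0 < w \<rho>#}. w (y - \<rho>))"
proof -
  have "\<exists>c G. c \<noteq> 0 \<and> (\<Prod>\<rho>\<in>#A. [:- \<rho>, 1:]) = smult c G \<and>
    weierstrass_degree G (size {#\<rho> \<in># A. 0 < w \<rho>#}) \<and>
    (\<forall>y. 0 < w y \<longrightarrow> w (poly G y) = (\<Sum>\<rho>\<in>#{#\<rho> \<in># A. 0 < w \<rho>#}. w (y - \<rho>)))"
  proof (induction A)
    case empty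
    show ?case by (intro exI[of _ 1]) (auto simp: weierstrass_degree_def coeff_1)
  next
    case (add \<rho> A)
    then obtain c G where cG: "c \<noteq> 0" "(\<Prod>\<rho>\<in>#A. [:- \<rho>, 1:]) = smult c G"
      "weierstrass_degree G (size {#\<rho> \<in># A. 0 < w \<rho>#})"
      "\<And>y. 0 < w y \<Longrightarrow> w (poly G y) = (\<Sum>\<rho>\<in>#{#\<rho> \<in># A. 0 < w \<rho>#}. w (y - \<rho>))" by blast
    show ?case
    proof (cases "0 < w \<rho>")
      case True
      have "weierstrass_degree [:- \<rho>, 1:] 1"
        using True by (auto simp: weierstrass_degree_def coeff_pCons split: nat.splits)
      note wd = weierstrass_degree_mult[OF this cG(3)]
      have "w (poly ([:- \<rho>, 1:] * G) y) = w (y - \<rho>) + w (poly G y)" for y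
        unfolding poly_mult w_mult by (simp add: algebra_simps)
      then show ?thesis
        using True cG wd
        by (intro exI[of _ c] exI[of _ "[:- \<rho>, 1:] * G"]) (auto simp del: mult_pCons_left poly_mult)
    next
      case False
      then have \<rho>: "\<rho> \<noteq> 0" by auto
      define i where "i = inverse \<rho>"
      have i: "\<rho> * i = 1" using \<rho> by (simp add: i_def)
      obtain a b where ab: "w \<rho> = ereal a" "w i = ereal b" using \<rho> w_real unfolding i_def
        by (metis inverse_zero_imp_zero)
      have wi: "0 \<le> w i"
        using w_mult[of \<rho> i] i False ab by (auto simp: zero_ereal_def)
      have "weierstrass_degree [:1, - i:] 0"
        using wi by (auto simp: weierstrass_degree_def coeff_pCons split: nat.splits)
      note wd = weierstrass_degree_mult[OF this cG(3)]
      have eq: "[:- \<rho>, 1:] = smult (- \<rho>) [:1, - i:]" using i by simp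
      have prod: "(\<Prod>\<rho>\<in>#add_mset \<rho> A. [:- \<rho>, 1:]) = smult (- \<rho> * c) ([:1, - i:] * G)"
        unfolding image_mset_add_mset prod_mset.add_mset cG(2) eq
        by (simp only: mult_smult_left mult_smult_right smult_smult mult.commute[of c])
      have "w (poly ([:1, - i:] * G) y) = w (poly G y)" if "0 < w y" for y
      proof -
        have "0 < w (- (y * i))" using that wi by (simp add: w_mult_pos)
        then have "w (1 + - (y * i)) = 0" using w_add_eq[of 1 "- (y * i)"] by simp
        then show ?thesis unfolding poly_mult w_mult by (simp add: algebra_simps)
      qed
      then show ?thesis
        using False cG wd \<rho> prod
        by (intro exI[of _ "- \<rho> * c"] exI[of _ "[:1, - i:] * G"]) (simp del: mult_pCons_left poly_mult)
    qed
  qed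
  then show ?thesis using that by blast
qed

end

context complete_valued_field begin

lemma weierstrass_roots:
  fixes g :: "'k alg_closure poly"
  assumes g: "weierstrass_degree g N"
  obtains A where "size A = N" "\<And>\<rho>. \<rho> \<in># A \<Longrightarrow> 0 < w \<rho>" "\<And>\<rho>. \<rho> \<in># A \<Longrightarrow> poly g \<rho> = 0"
    "\<And>y. 0 < w y \<Longrightarrow> w (poly g y) = (\<Sum>\<rho>\<in>#A. w (y - \<rho>))"
proof -
  note gd = g[unfolded weierstrass_degree_def]
  have "g \<noteq> 0" using gd by auto
  then obtain B where B: "g = smult (lead_coeff g) (\<Prod>x\<in>#B. [:- x, 1:])"
    using alg_closed_imp_factorization by blast
  obtain c G where cG: "c \<noteq> 0" "(\<Prod>\<rho>\<in>#B. [:- \<rho>, 1:]) = smult c G"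
    "weierstrass_degree G (size {#\<rho> \<in># B. 0 < w \<rho>#})"
    "\<And>y. 0 < w y \<Longrightarrow> w (poly G y) = (\<Sum>\<rho>\<in>#{#\<rho> \<in># B. 0 < w \<rho>#}. w (y - \<rho>))"
    using prod_linear_factors[of B] by blast
  define A where "A = {#\<rho> \<in># B. 0 < w \<rho>#}"
  define d where "d = lead_coeff g * c"
  have gG: "g = smult d G" using B cG(2) by (simp add: d_def)
  note Gd = cG(3)[folded A_def, unfolded weierstrass_degree_def]
  have coeff: "w (Polynomial.coeff g i) = w d + w (Polynomial.coeff G i)" for i
    by (simp add: gG w_mult)
  \<comment> \<open>Both g and G are integral with some coefficient of valuation 0. Comparison at
    the index \<open>size A\<close>, where G has such a coefficient, and at N, where g has one,
    gives the two inequalities.\<close>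
  have "w d = 0"
  proof (rule antisym)
    show "0 \<le> w d" using gd Gd coeff[of "size A"] by (metis add.right_neutral)
    show "w d \<le> 0" using gd Gd coeff[of N] by (metis add_left_mono add.right_neutral)
  qed
  then have coeff': "w (Polynomial.coeff g i) = w (Polynomial.coeff G i)" for i
    by (simp add: coeff)
  have A1: "size A = N"
    using gd Gd coeff' by (metis less_irrefl linorder_neqE_nat)
  have A2: "poly g \<rho> = 0" if "\<rho> \<in># A" for \<rho>
  proof -
    have "\<rho> \<in># B" using that by (simp add: A_def)
    then obtain C where "B = add_mset \<rho> C" by (auto dest: multi_member_split)
    then show ?thesis by (subst B) simp
  qed
  have A3: "w (poly g y) = (\<Sum>\<rho>\<in>#A. w (y - \<rho>))" if "0 < w y" for y
    using cG(4)[OF that] by (simp add: A_def gG w_mult \<open>w d = 0\<close>)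
  have A4: "0 < w \<rho>" if "\<rho> \<in># A" for \<rho> using that by (simp add: A_def)
  show ?thesis by (rule that[OF A1 A4 A2 A3])
qed

end

lemma sum_mset_less:
  fixes f :: "'b \<Rightarrow> ereal"
  assumes "A \<noteq> {#}" "\<And>a. a \<in># A \<Longrightarrow> f a < ereal c"
  shows "(\<Sum>a\<in>#A. f a) < ereal (real (size A) * c)"
  using assms
proof (induction A rule: multiset_induct)
  case (add x A)
  show ?case
  proof (cases "A = {#}")
    case False
    then have "f x + (\<Sum>a\<in>#A. f a) < ereal c + ereal (real (size A) * c)"
      using add by (intro ereal_add_strict_mono2) auto
    then show ?thesis by (simp add: algebra_simps)
  qed (use add in auto)
qed auto

lemma large_multiple:
  assumes "0 < (\<mu>::real)" obtains M :: nat where "a < M" "b < real M * \<mu>" "c < real M * \<mu>"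
proof -
  obtain M1 :: nat where M1: "max b c < real M1 * \<mu>" using assms reals_Archimedean3 by blast
  have "real M1 * \<mu> \<le> real (max M1 (Suc a)) * \<mu>" using assms by (intro mult_right_mono) auto
  then show ?thesis using that[of "max M1 (Suc a)"] M1 by auto
qed

section \<open>Multiplication by \<open>\<pi>\<close> on points: surjectivity and the product
  formula\<close>

locale height_module = formal_module v w vF \<iota> F act
  for v :: "'k::field \<Rightarrow> ereal" and w :: "'k alg_closure \<Rightarrow> ereal" and vF :: "'f::field \<Rightarrow> ereal"
    and \<iota> :: "'f \<Rightarrow> 'k" and F act +
  fixes \<pi> :: 'f and q n :: nat
  assumes v\<pi>: "vF \<pi> = 1" "v (\<iota> \<pi>) = 1" and q: "2 \<le> q" and height: "has_height v q (act \<pi>) n"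
begin

lemma \<pi>_integral: "0 \<le> vF \<pi>" by (simp add: v\<pi>)

definition trunc :: "nat \<Rightarrow> 'k alg_closure poly" where
  "trunc M = (\<Sum>i<M. Polynomial.monom (to_ac (act \<pi> $ i)) i)"

lemma coeff_trunc: "Polynomial.coeff (trunc M) i = (if i < M then to_ac (act \<pi> $ i) else 0)"
  by (simp add: trunc_def coeff_sum)

lemma poly_trunc: "poly (trunc M) y = (\<Sum>i<M. to_ac (act \<pi> $ i) * y ^ i)"
  by (simp add: trunc_def poly_sum poly_monom)

text \<open>Subtracting x touches only the constant coefficient, which keeps positive valuation, and
  M > q^n keeps the unit coefficient of degree q^n. So the height is the Weierstrass degree of every
  such polynomial.\<close>

lemma trunc_roots:
  assumes M: "q ^ n < M" and x: "0 < w x"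
  obtains A where "size A = q ^ n" "\<And>\<rho>. \<rho> \<in># A \<Longrightarrow> 0 < w \<rho>" "\<And>\<rho>. \<rho> \<in># A \<Longrightarrow> poly (trunc M) \<rho> = x"
    "\<And>y. 0 < w y \<Longrightarrow> w (poly (trunc M) y - x) = (\<Sum>\<rho>\<in>#A. w (y - \<rho>))"
proof -
  have int: "0 \<le> v (act \<pi> $ i)" for i using fps_overD[OF act_integral[OF \<pi>_integral]] by (simp add: O_K_def)
  have "weierstrass_degree (trunc M - [:x:]) (q ^ n)"
    unfolding weierstrass_degree_def
  proof (intro conjI allI impI)
    fix i
    show "0 \<le> w (Polynomial.coeff (trunc M - [:x:]) i)"
      using int x by (auto simp: coeff_trunc w_to_ac coeff_pCons intro!: w_diff_ge split: nat.splits)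
    have "Polynomial.coeff [:x:] (q ^ n) = 0"
      using q by (cases "q ^ n") auto
    then show "w (Polynomial.coeff (trunc M - [:x:]) (q ^ n)) = 0"
      using height M by (simp add: has_height_def coeff_trunc w_to_ac)
    assume i: "i < q ^ n"
    then have "0 < w (to_ac (act \<pi> $ i))" using height by (simp add: has_height_def w_to_ac)
    moreover have "0 < w (- Polynomial.coeff [:x:] i)" using x by (cases i) auto
    ultimately show "0 < w (Polynomial.coeff (trunc M - [:x:]) i)"
      using w_add_pos[of "to_ac (act \<pi> $ i)" "- Polynomial.coeff [:x:] i"] i M by (simp add: coeff_trunc)
  qed
  then obtain A where A: "size A = q ^ n" "\<And>\<rho>. \<rho> \<in># A \<Longrightarrow> 0 < w \<rho>"
    "\<And>\<rho>. \<rho> \<in># A \<Longrightarrow> poly (trunc M - [:x:]) \<rho> = 0"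
    "\<And>y. 0 < w y \<Longrightarrow> w (poly (trunc M - [:x:]) y) = (\<Sum>\<rho>\<in>#A. w (y - \<rho>))"
    using weierstrass_roots by blast
  show ?thesis
  proof (rule that[OF A(1,2)])
    show "poly (trunc M) \<rho> = x" if "\<rho> \<in># A" for \<rho> using A(3)[OF that] by simp
    show "w (poly (trunc M) y - x) = (\<Sum>\<rho>\<in>#A. w (y - \<rho>))" if "0 < w y" for y using A(4)[OF that] by simp
  qed
qed

lemma smul_zero: "0 \<le> vF a \<Longrightarrow> smul a 0 = 0"
  using smul_ge[of a 0] by simp

lemma smul_surj:
  assumes x: "0 < w x" obtains y where "0 < w y" "smul \<pi> y = x"
proof (cases "x = 0")
  case True
  then show ?thesis using that[of 0] smul_zero[OF \<pi>_integral] by simp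
next
  case False
  then obtain \<xi> where \<xi>: "w x = ereal \<xi>" "0 < \<xi>" using w_real x by (metis ereal_less(2))
  \<comment> \<open>The q^n roots of positive valuation of \<open>trunc M - x\<close> have
    valuations with sum \<xi>, so one of them reaches the mean \<mu>. The mean does not depend on M,
    so M can be chosen before the roots.\<close>
  define \<mu> where "\<mu> = \<xi> / real (q ^ n)"
  have N: "0 < q ^ n" using q by simp
  have \<mu>: "0 < \<mu>" using \<xi> N by (simp add: \<mu>_def)
  obtain M where M: "q ^ n < M" "2 < real M * \<mu>" using large_multiple[OF \<mu>] by blast
  obtain A where A: "size A = q ^ n" "\<And>\<rho>. \<rho> \<in># A \<Longrightarrow> 0 < w \<rho>" "\<And>\<rho>. \<rho> \<in># A \<Longrightarrow> poly (trunc M) \<rho> = x"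
    "\<And>y. 0 < w y \<Longrightarrow> w (poly (trunc M) y - x) = (\<Sum>\<rho>\<in>#A. w (y - \<rho>))"
    using trunc_roots[OF M(1) x] by blast
  have "poly (trunc M) 0 = to_ac (act \<pi> $ 0)" using M by (simp add: poly_0_coeff_0 coeff_trunc)
  then have sum: "(\<Sum>\<rho>\<in>#A. w \<rho>) = ereal \<xi>" using A(4)[of 0] \<xi> by (simp add: act_0[OF \<pi>_integral])
  have "\<exists>\<rho>. \<rho> \<in># A \<and> ereal \<mu> \<le> w \<rho>"
  proof (rule ccontr)
    assume no: "\<not> ?thesis"
    have "w \<rho> < ereal \<mu>" if "\<rho> \<in># A" for \<rho> using no that not_le by blast
    then have "(\<Sum>\<rho>\<in>#A. w \<rho>) < ereal (real (size A) * \<mu>)"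
      using A(1) N by (intro sum_mset_less) auto
    then show False using sum A(1) q by (simp add: \<mu>_def)
  qed
  then obtain \<rho> where \<rho>: "\<rho> \<in># A" "ereal \<mu> \<le> w \<rho>" by blast
  have w\<rho>: "0 < w \<rho>" by (rule A(2)[OF \<rho>(1)])
  have "ereal (real M * \<mu>) \<le> w (x - smul \<pi> \<rho>)"
    using smul_approx[OF \<pi>_integral \<mu> \<rho>(2), of M] A(3)[OF \<rho>(1)] by (simp add: poly_trunc)
  moreover have "ereal 2 < ereal (real M * \<mu>)" using M by simp
  ultimately have "ereal 2 < w (x - smul \<pi> \<rho>)" by (rule less_le_trans[rotated])
  then have big: "2 < w (x - smul \<pi> \<rho>)" by simp
  interpret P: Module.module "valuation_ring vF" points by (rule module_points)
  have ws: "0 < w (smul \<pi> \<rho>)" using smul_pos \<pi>_integral w\<rho> .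
  define t where "t = x \<ominus>\<^bsub>points\<^esub> smul \<pi> \<rho>"
  have "2 < w t" using w_minus_points[OF x ws] big by (simp add: t_def)
  then obtain s where s: "0 < w s" "smul \<pi> s = t"
    using smul_surj_near_0[OF \<pi>_integral v\<pi>(2)] by blast
  have "smul \<pi> (padd \<rho> s) = smul \<pi> \<rho> \<oplus>\<^bsub>points\<^esub> (x \<ominus>\<^bsub>points\<^esub> smul \<pi> \<rho>)"
    using smul_padd[OF \<pi>_integral w\<rho> s(1)] s(2) by (simp add: t_def)
  also have "\<dots> = x"
    using x ws P.a_lcomm[of "smul \<pi> \<rho>" x "\<ominus>\<^bsub>points\<^esub> smul \<pi> \<rho>"] P.r_neg[of "smul \<pi> \<rho>"]
      P.a_inv_closed[of "smul \<pi> \<rho>"] P.r_zero[of x]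
    unfolding P.minus_eq points_simps(1) by simp
  finally show ?thesis using that padd_pos[OF w\<rho> s(1)] by blast
qed

text \<open>The sum runs over \<open>H[\<pi>]\<close>: each of its \<open>q\<^sup>n\<close> points is close to a root of a truncation of
  \<open>[\<pi>](T)\<close>, and that truncation has exactly \<open>q\<^sup>n\<close> roots of positive valuation.\<close>

lemma w_smul_\<pi>:
  assumes H: "H = {h. 0 < w h \<and> smul \<pi> h = 0}" and card: "card H = q ^ n" and y: "0 < w y"
  shows "w (smul \<pi> y) = (\<Sum>h\<in>H. w (y - h))"
proof (cases "y \<in> H")
  case fin: True
  have "finite H" using card q by (intro card_ge_0_finite) simp
  then have "(\<Sum>h\<in>H. w (y - h)) = \<infinity>" using fin by (auto simp: sum_Pinfty intro!: bexI[of _ y])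
  then show ?thesis using fin H by simp
next
  case False
  have N: "0 < q ^ n" using q by simp
  have fin: "finite H" using card q by (intro card_ge_0_finite) simp
  obtain \<phi> where \<phi>: "w (smul \<pi> y) = ereal \<phi>" using w_real False H y by blast
  have "\<exists>\<mu>>0. \<forall>h\<in>insert y H. ereal \<mu> \<le> w h"
  proof -
    have "\<exists>\<mu>>0. \<forall>h\<in>S. ereal \<mu> \<le> w h" if "finite S" "\<forall>h\<in>S. 0 < w h" for S
      using that
    proof (induction S rule: finite_induct)
      case empty
      show ?case by (intro exI[of _ 1]) auto
    next
      case (insert a S)
      then obtain \<mu> where \<mu>: "0 < \<mu>" "\<And>h. h \<in> S \<Longrightarrow> ereal \<mu> \<le> w h" by auto
      obtain \<nu> where \<nu>: "0 < \<nu>" "ereal \<nu> \<le> w a" using insert pos_lower_bound by (metis insertI1)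
      have "ereal (min \<mu> \<nu>) \<le> w h" if "h \<in> insert a S" for h
      proof (cases "h = a")
        case True
        then show ?thesis using order_trans[OF _ \<nu>(2), of "ereal (min \<mu> \<nu>)"] by simp
      next
        case False
        then show ?thesis using order_trans[OF _ \<mu>(2), of "ereal (min \<mu> \<nu>)" h] that by simp
      qed
      then show ?case using \<mu> \<nu> by (intro exI[of _ "min \<mu> \<nu>"]) auto
    qed
    moreover have "\<forall>h\<in>insert y H. 0 < w h" using y by (simp add: H)
    ultimately show ?thesis using fin by (meson finite_insert)
  qed
  then obtain \<mu> where \<mu>: "0 < \<mu>" "ereal \<mu> \<le> w y" "\<And>h. h \<in> H \<Longrightarrow> ereal \<mu> \<le> w h" by auto
  \<comment> \<open>D separates: a root \<rho> with w(h - \<rho>) > D is that close to no other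
    torsion point, and w(y - h) is unchanged when h is replaced by \<rho>.\<close>
  obtain D where D: "\<And>h h'. h \<in> insert y H \<Longrightarrow> h' \<in> H \<Longrightarrow> h \<noteq> h' \<Longrightarrow> w (h - h') \<le> ereal D"
  proof -
    let ?S = "(\<lambda>(h, h'). real_of_ereal (w (h - h'))) ` (insert y H \<times> H)"
    have "w (h - h') \<le> ereal (Max ?S)" if "h \<in> insert y H" "h' \<in> H" "h \<noteq> h'" for h h'
    proof -
      have "h - h' \<noteq> 0" using that by simp
      then obtain r where r: "w (h - h') = ereal r" by (rule w_real)
      have "r \<in> ?S" using that r by (intro image_eqI[of _ _ "(h, h')"]) auto
      then show ?thesis using r fin by simp
    qed
    then show ?thesis using that by blast
  qed
  \<comment> \<open>The bound by \<phi> makes the truncation and [\<pi>] have the same valuation at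
    y. The bound by q^n D forces, for each h, at least one of the q^n summands w(h - \<rho>) to
    exceed D.\<close>
  obtain M where M: "q ^ n < M" "\<phi> < real M * \<mu>" "real (q ^ n) * D < real M * \<mu>"
    using large_multiple[OF \<mu>(1)] by blast
  obtain A where A: "size A = q ^ n" "\<And>\<rho>. \<rho> \<in># A \<Longrightarrow> 0 < w \<rho>"
    "\<And>y. 0 < w y \<Longrightarrow> w (poly (trunc M) y) = (\<Sum>\<rho>\<in>#A. w (y - \<rho>))"
    by (rule trunc_roots[OF M(1), of 0]) simp_all
  have approx: "ereal (real M * \<mu>) \<le> w (poly (trunc M) h - smul \<pi> h)" if "ereal \<mu> \<le> w h" for h
    using smul_approx[OF \<pi>_integral \<mu>(1) that] by (simp add: poly_trunc)
  have wy: "w (poly (trunc M) y) = w (smul \<pi> y)"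
  proof (rule w_eq_of_close)
    have "ereal \<phi> < ereal (real M * \<mu>)" using M by simp
    then show "w (smul \<pi> y) < w (smul \<pi> y - poly (trunc M) y)"
      unfolding \<phi> w_diff_commute[of "smul \<pi> y"] using approx[OF \<mu>(2)] by (rule less_le_trans)
  qed
  have "\<exists>\<rho>. \<rho> \<in># A \<and> ereal D < w (h - \<rho>)" if h: "h \<in> H" for h
  proof (rule ccontr)
    assume no: "\<not> ?thesis"
    define c where "c = real M * \<mu> / real (q ^ n)"
    have "D < c" using M(3) N by (simp add: c_def field_simps)
    then have "w (h - \<rho>) < ereal c" if "\<rho> \<in># A" for \<rho>
      using no that by (meson less_ereal.simps(1) le_less_trans not_le)
    then have "(\<Sum>\<rho>\<in>#A. w (h - \<rho>)) < ereal (real (size A) * c)"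
      using A(1) N by (intro sum_mset_less) auto
    moreover have "(\<Sum>\<rho>\<in>#A. w (h - \<rho>)) = w (poly (trunc M) h - smul \<pi> h)"
      using A(3)[of h] h H by simp
    ultimately show False using approx[OF \<mu>(3)[OF h]] A(1) q by (simp add: c_def)
  qed
  then obtain \<rho> where \<rho>: "\<And>h. h \<in> H \<Longrightarrow> \<rho> h \<in># A" "\<And>h. h \<in> H \<Longrightarrow> ereal D < w (h - \<rho> h)" by metis
  have inj: "inj_on \<rho> H"
  proof (rule inj_onI, rule ccontr)
    fix h h' assume h: "h \<in> H" "h' \<in> H" "\<rho> h = \<rho> h'" "h \<noteq> h'"
    have "ereal D < min (w (h - \<rho> h)) (w (\<rho> h' - h'))"
      using \<rho>(2)[OF h(1)] \<rho>(2)[OF h(2)] w_diff_commute[of h' "\<rho> h'"] by simp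
    also have "\<dots> \<le> w (h - h')"
      unfolding h(3) by (rule w_trans[OF min.cobounded1 min.cobounded2])
    finally show False using D[of h h'] h by auto
  qed
  \<comment> \<open>A submultiset of full size: every root of positive valuation is attached to
    exactly one torsion point and is simple.\<close>
  have "mset_set (\<rho> ` H) \<subseteq># A"
    using \<rho>(1) by (intro subset_mset.order_trans[OF subset_imp_msubset_mset_set mset_set_set_mset_msubset]) auto
  moreover have "size (mset_set (\<rho> ` H)) = size A"
    using inj card A(1) by (simp add: card_image)
  ultimately have "A = mset_set (\<rho> ` H)"
    using mset_subset_size[of "mset_set (\<rho> ` H)" A] by (auto simp: subset_mset.le_less)
  then have "(\<Sum>\<rho>\<in>#A. w (y - \<rho>)) = (\<Sum>h\<in>H. w (y - \<rho> h))"
    using sum.reindex[OF inj, of "\<lambda>\<rho>. w (y - \<rho>)"] by (simp add: sum_unfold_sum_mset o_def)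
  also have "\<dots> = (\<Sum>h\<in>H. w (y - h))"
  proof (rule sum.cong[OF refl], rule w_eq_of_close)
    fix h assume h: "h \<in> H"
    have "w (y - h) \<le> ereal D" using D[of y h] False h by auto
    then show "w (y - h) < w (y - h - (y - \<rho> h))"
      using \<rho>(2)[OF h] w_diff_commute[of h "\<rho> h"] by (simp add: le_less_trans)
  qed
  finally show ?thesis using A(3)[OF y] wy by simp
qed

text \<open>The sum of the slopes is read off the derivative \<open>\<pi>\<close> of \<open>[\<pi>]\<close> at \<open>0\<close>, by evaluating the
  product formula at a point \<open>y\<close> closer to \<open>0\<close> than the non-zero \<open>\<pi>\<close>-torsion points.\<close>

lemma sum_slopes:
  assumes H: "H = {h. 0 < w h \<and> smul \<pi> h = 0}" and card: "card H = q ^ n"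
  shows "(\<Sum>h\<in>H - {0}. w h) = 1"
proof -
  have fin: "finite H" using card q by (intro card_ge_0_finite) simp
  have "\<exists>r. w h = ereal r" if "h \<in> H - {0}" for h using w_real that by blast
  then obtain r where r: "\<And>h. h \<in> H - {0} \<Longrightarrow> w h = ereal (r h)" by metis
  obtain m :: nat where m: "1 < m" "\<And>h. h \<in> H - {0} \<Longrightarrow> r h < real m"
  proof -
    obtain m :: nat where m: "Max (insert 1 (r ` H)) < real m" using reals_Archimedean2 by blast
    have "r h < real m" if "h \<in> H - {0}" for h
      using that fin by (intro le_less_trans[OF _ m] Max_ge) auto
    moreover have "1 < real m" using fin by (intro le_less_trans[OF _ m] Max_ge) auto
    ultimately show ?thesis using that by auto
  qed
  define y where "y = to_ac (\<iota> \<pi> ^ m)"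
  have wy: "w y = ereal (real m)" by (simp add: y_def w_to_ac base.w_power v\<pi> del: to_ac_power)
  have y: "0 < w y" using m by (simp add: wy)
  \<comment> \<open>With only the linear term kept, the error has valuation at least 2 m. This
    exceeds 1 + m, the valuation of the linear term, because m > 1.\<close>
  have "ereal (real 2 * real m) \<le> w ((\<Sum>i<2. to_ac (act \<pi> $ i) * y ^ i) - smul \<pi> y)"
    using m by (intro smul_approx \<pi>_integral) (auto simp: wy)
  then have "ereal (2 * real m) \<le> w (to_ac (\<iota> \<pi>) * y - smul \<pi> y)"
    using act_0[OF \<pi>_integral] act_1[OF \<pi>_integral] by (simp add: eval_nat_numeral)
  moreover have wcy: "w (to_ac (\<iota> \<pi>) * y) = ereal (1 + real m)"
    by (simp add: w_mult w_to_ac v\<pi> wy one_ereal_def)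
  moreover have "ereal (1 + real m) < ereal (2 * real m)" using m by simp
  ultimately have "w (smul \<pi> y) = ereal (1 + real m)"
    by (metis w_eq_of_close less_le_trans)
  moreover have "w (smul \<pi> y) = (\<Sum>h\<in>H. w (y - h))" by (rule w_smul_\<pi>[OF H card y])
  moreover have "(\<Sum>h\<in>H. w (y - h)) = w y + (\<Sum>h\<in>H - {0}. w (y - h))"
    using fin smul_zero[OF \<pi>_integral] by (subst sum.remove[of _ 0]) (auto simp: H)
  moreover have "(\<Sum>h\<in>H - {0}. w (y - h)) = (\<Sum>h\<in>H - {0}. w h)"
  proof (rule sum.cong[OF refl])
    fix h assume h: "h \<in> H - {0}"
    then have "w (- h) < w y" using r[OF h] m(2)[OF h] by (simp add: wy)
    then show "w (y - h) = w h" using w_add_eq[of "-h" y] by simp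
  qed
  moreover have "(\<Sum>h\<in>H - {0}. w h) = ereal (\<Sum>h\<in>H - {0}. r h)"
    using r by (simp add: sum_ereal[symmetric] del: sum_ereal)
  ultimately show ?thesis by (simp add: wy one_ereal_def)
qed

end


section \<open>The function \<open>\<eta>\<close>\<close>

context
  fixes q n :: nat and lam :: "nat \<Rightarrow> real"
  assumes q: "1 \<le> q" and lam_pos: "\<forall>i\<in>{1..n}. 0 < lam i"
begin

lemma slope_weight_nonneg: "0 \<le> real q ^ i - real q ^ (i - 1)"
  using q by (simp add: power_increasing)

lemma eta_strict_mono: "s < t \<Longrightarrow> eta q n lam s < eta q n lam t"
  unfolding eta_def by (intro add_less_le_mono sum_mono mult_left_mono slope_weight_nonneg) auto

lemma eta_0: "eta q n lam 0 = 0"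
  using lam_pos by (auto simp: eta_def min_absorb1 less_imp_le intro!: sum.neutral)

lemma eta_ge: assumes "0 \<le> s" shows "s \<le> eta q n lam s"
proof -
  have "0 \<le> (\<Sum>i=1..n. (real q ^ i - real q ^ (i - 1)) * min s (lam i))"
    using assms lam_pos by (intro sum_nonneg mult_nonneg_nonneg slope_weight_nonneg) (auto simp: less_imp_le)
  then show ?thesis by (simp add: eta_def)
qed

lemma bij_betw_eta: "bij_betw (eta q n lam) {0..} {0..}"
proof (rule bij_betwI')
  show "eta q n lam s = eta q n lam t \<longleftrightarrow> s = t" for s t
    using eta_strict_mono by (metis less_irrefl linorder_neqE_linordered_idom)
  show "eta q n lam s \<in> {0..}" if "s \<in> {0..}" for s
    using that eta_ge[of s] by simp
  show "\<exists>s\<in>{0..}. t = eta q n lam s" if "t \<in> {0..}" for t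
  proof -
    have "continuous_on {0..t} (eta q n lam)"
      unfolding eta_def by (intro continuous_intros continuous_on_min)
    then have "\<exists>s. 0 \<le> s \<and> s \<le> t \<and> eta q n lam s = t"
      using that eta_ge[of t] eta_0 by (intro IVT') auto
    then show ?thesis by auto
  qed
qed

abbreviation eta_inv where "eta_inv \<equiv> the_inv_into {0..} (eta q n lam)"

lemma eta_eta_inv: "0 \<le> t \<Longrightarrow> eta q n lam (eta_inv t) = t"
  using bij_betw_eta by (simp add: bij_betw_def f_the_inv_into_f)

lemma eta_inv_nonneg: "0 \<le> t \<Longrightarrow> 0 \<le> eta_inv t"
  using bij_betw_apply[OF bij_betw_the_inv_into[OF bij_betw_eta], of t] by simp

lemma eta_le_iff: "eta q n lam s \<le> eta q n lam t \<longleftrightarrow> s \<le> t"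
  using eta_strict_mono by (metis less_le not_le)

lemma eta_inv_le: "0 \<le> t \<Longrightarrow> eta_inv t \<le> t"
  using eta_ge[of "eta_inv t"] eta_eta_inv[of t] eta_inv_nonneg[of t] by simp

text \<open>The bound on k comes from truncated subtraction: indices 0 and 1 both give the initial
  slope, so the recursion starts at 1.\<close>

lemma slope_iter_Suc: "1 \<le> k \<Longrightarrow> slope_iter q n lam (Suc k) i = eta_inv (slope_iter q n lam k i)"
  by (cases k) (simp_all add: slope_iter_def)

lemma slope_iter_nonneg:
  assumes "i \<in> {1..n}" "1 \<le> k" shows "0 \<le> slope_iter q n lam k i"
  using assms(2)
proof (induction k rule: dec_induct)
  case (step k)
  then show ?case using slope_iter_Suc[of k] eta_inv_nonneg by simp
qed (use bspec[OF lam_pos assms(1)] in \<open>simp add: slope_iter_def\<close>)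

lemma slope_iter_antimono:
  assumes "i \<in> {1..n}" "1 \<le> j" "j \<le> k" shows "slope_iter q n lam k i \<le> slope_iter q n lam j i"
  using assms(3)
proof (induction k rule: dec_induct)
  case (step k)
  then show ?case
    using slope_iter_Suc[of k i] eta_inv_le[OF slope_iter_nonneg[OF assms(1)], of k] assms(2) by simp
qed simp

end


section \<open>Modules over a discrete valuation ring\<close>

lemma valuation_ring_simps [simp]:
  "\<zero>\<^bsub>valuation_ring vF\<^esub> = 0" "\<one>\<^bsub>valuation_ring vF\<^esub> = 1"
  "x \<oplus>\<^bsub>valuation_ring vF\<^esub> y = x + y" "x \<otimes>\<^bsub>valuation_ring vF\<^esub> y = x * y"
  by (simp_all add: valuation_ring_def ring_of_type_algebra_def)

text \<open>The residue field enters through a set of representatives, so that spans over O/\<pi>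
  can be counted as functions into \<open>R\<close>, with coefficients still taken in O.\<close>

locale dvr_module = Module.module "valuation_ring vF" N + F: valued_field vF
  for vF :: "'f::field \<Rightarrow> ereal" and N :: "('f, 'b, 'c) module_scheme" (structure) +
  fixes \<pi> :: 'f and q :: nat
  assumes \<pi>_pos: "0 < vF \<pi>" and \<pi>_nonzero: "\<pi> \<noteq> 0"
    and \<pi>_dvd: "0 < vF a \<Longrightarrow> \<exists>b. 0 \<le> vF b \<and> a = \<pi> * b"
    and residues: "\<exists>R. card R = q \<and> (\<forall>\<rho>\<in>R. 0 \<le> vF \<rho>) \<and> (\<forall>a. 0 \<le> vF a \<longrightarrow> (\<exists>!\<rho>. \<rho> \<in> R \<and> 0 < vF (a - \<rho>)))"
    and q_ge_2: "2 \<le> q"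
begin

abbreviation sm (infixr "\<bullet>" 75) where "sm \<equiv> module.smult N"

lemma \<pi>_power_integral: "0 \<le> vF (\<pi> ^ k)"
  using \<pi>_pos by (intro F.w_power_nonneg) simp

lemma sm_closed: "0 \<le> vF a \<Longrightarrow> x \<in> carrier N \<Longrightarrow> a \<bullet> x \<in> carrier N"
  using smult_closed by simp
lemma sm_add: "0 \<le> vF a \<Longrightarrow> 0 \<le> vF b \<Longrightarrow> x \<in> carrier N \<Longrightarrow> (a + b) \<bullet> x = a \<bullet> x \<oplus> b \<bullet> x"
  using smult_l_distr[of a b x] by simp
lemma sm_mult: "0 \<le> vF a \<Longrightarrow> 0 \<le> vF b \<Longrightarrow> x \<in> carrier N \<Longrightarrow> (a * b) \<bullet> x = a \<bullet> b \<bullet> x"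
  using smult_assoc1[of a b x] by simp
lemma sm_distrib: "0 \<le> vF a \<Longrightarrow> x \<in> carrier N \<Longrightarrow> y \<in> carrier N \<Longrightarrow> a \<bullet> (x \<oplus> y) = a \<bullet> x \<oplus> a \<bullet> y"
  using smult_r_distr[of a x y] by simp
lemma sm_zero: "0 \<le> vF a \<Longrightarrow> a \<bullet> \<zero> = \<zero>" "x \<in> carrier N \<Longrightarrow> 0 \<bullet> x = \<zero>"
  using smult_r_null[of a] smult_l_null[of x] by simp_all
lemma sm_minus: "0 \<le> vF a \<Longrightarrow> x \<in> carrier N \<Longrightarrow> y \<in> carrier N \<Longrightarrow> a \<bullet> (x \<ominus> y) = a \<bullet> x \<ominus> a \<bullet> y"
  using smult_r_minus[of a y] by (simp add: M.minus_eq sm_distrib)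
lemma sm_one: "x \<in> carrier N \<Longrightarrow> 1 \<bullet> x = x"
  using smult_one[of x] by simp

text \<open>A recursive sum with coefficients in O makes the linear algebra a matter of plain
  inductions. The passage to \<open>finsum\<close> with classes as coefficients happens once, in
  \<open>finsum_level\<close>.\<close>

fun lincomb :: "nat \<Rightarrow> (nat \<Rightarrow> 'f) \<Rightarrow> (nat \<Rightarrow> 'b) \<Rightarrow> 'b" where
  "lincomb 0 a e = \<zero>"
| "lincomb (Suc r) a e = a r \<bullet> e r \<oplus> lincomb r a e"

text \<open>Integrality at all indices does not mention the length of a combination; a sequence
  known only below r is extended by 0.\<close>

definition intseq :: "(nat \<Rightarrow> 'f) \<Rightarrow> bool" where "intseq a \<longleftrightarrow> (\<forall>i. 0 \<le> vF (a i))"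

lemma intseqD: "intseq a \<Longrightarrow> 0 \<le> vF (a i)"
  by (simp add: intseq_def)

lemma intseq_diff: "intseq a \<Longrightarrow> intseq b \<Longrightarrow> intseq (\<lambda>i. a i - b i)"
  and intseq_smult: "0 \<le> vF c \<Longrightarrow> intseq a \<Longrightarrow> intseq (\<lambda>i. c * a i)"
  by (auto simp: intseq_def intro: F.w_diff_ge F.w_mult_nonneg)

lemma lincomb_cong:
  "(\<And>i. i < r \<Longrightarrow> a i = a' i) \<Longrightarrow> (\<And>i. i < r \<Longrightarrow> e i = e' i) \<Longrightarrow> lincomb r a e = lincomb r a' e'"
  by (induction r) simp_all

lemma lincomb_closed: "\<forall>i<r. e i \<in> carrier N \<Longrightarrow> intseq a \<Longrightarrow> lincomb r a e \<in> carrier N"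
  by (induction r) (auto intro: sm_closed intseqD)

lemma lincomb_add:
  assumes "\<forall>i<r. e i \<in> carrier N" "intseq a" "intseq b"
  shows "lincomb r (\<lambda>i. a i + b i) e = lincomb r a e \<oplus> lincomb r b e"
  using assms(1)
  by (induction r) (simp_all add: sm_add sm_closed M.a_ac intseqD lincomb_closed assms(2,3))

lemma lincomb_smult:
  assumes "\<forall>i<r. e i \<in> carrier N" "intseq a" "0 \<le> vF c"
  shows "c \<bullet> lincomb r a e = lincomb r (\<lambda>i. c * a i) e"
  using assms(1)
  by (induction r) (simp_all add: sm_zero sm_distrib sm_mult sm_closed intseqD lincomb_closed assms(2,3))

lemma lincomb_smult_right:
  assumes "\<forall>i<r. e i \<in> carrier N" "intseq a" "0 \<le> vF c"
  shows "lincomb r a (\<lambda>i. c \<bullet> e i) = lincomb r (\<lambda>i. c * a i) e"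
  using assms(1) by (induction r) (simp_all add: sm_mult[symmetric] mult.commute[of c] intseqD assms(2,3))

lemma lincomb_eq_diff:
  assumes e: "\<forall>i<r. e i \<in> carrier N" and a: "intseq a" and b: "intseq b"
  shows "lincomb r a e = lincomb r b e \<longleftrightarrow> lincomb r (\<lambda>i. a i - b i) e = \<zero>"
proof -
  note ab = intseq_diff[OF a b]
  have "lincomb r (\<lambda>i. a i - b i + b i) e = lincomb r (\<lambda>i. a i - b i) e \<oplus> lincomb r b e"
    by (rule lincomb_add[OF e ab b])
  then show ?thesis
    using lincomb_closed[OF e a] lincomb_closed[OF e b] lincomb_closed[OF e ab] by simp
qed

definition torsion :: "nat \<Rightarrow> 'b set" where
  "torsion k = {x \<in> carrier N. \<pi> ^ k \<bullet> x = \<zero>}"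

definition closed_under_ops :: "'b set \<Rightarrow> bool" where
  "closed_under_ops M \<longleftrightarrow> \<zero> \<in> M \<and> (\<forall>x\<in>M. \<forall>y\<in>M. x \<oplus> y \<in> M) \<and> (\<forall>a. 0 \<le> vF a \<longrightarrow> (\<forall>x\<in>M. a \<bullet> x \<in> M))"

text \<open>A basis over O/\<pi>^k expressed in O: the coefficients of every relation lie in \<pi>^k
  O. That \<pi>^k kills \<open>M\<close> is stated separately, as
  \<open>M \<subseteq> torsion k\<close>.\<close>

definition basis_mod :: "nat \<Rightarrow> 'b set \<Rightarrow> nat \<Rightarrow> (nat \<Rightarrow> 'b) \<Rightarrow> bool" where
  "basis_mod k M r e \<longleftrightarrow> (\<forall>i<r. e i \<in> M) \<and>
     (\<forall>x\<in>M. \<exists>a. intseq a \<and> x = lincomb r a e) \<and>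
     (\<forall>a. intseq a \<longrightarrow> lincomb r a e = \<zero> \<longrightarrow> (\<forall>i<r. \<exists>b. 0 \<le> vF b \<and> a i = \<pi> ^ k * b))"

lemma lincomb_in:
  assumes "closed_under_ops M" "\<And>i. i < r \<Longrightarrow> e i \<in> M" "intseq a"
  shows "lincomb r a e \<in> M"
  using assms(2) by (induction r) (use assms(1,3) in \<open>auto simp: closed_under_ops_def intseq_def\<close>)

lemma torsion_carrier: "x \<in> torsion k \<Longrightarrow> x \<in> carrier N"
  by (simp add: torsion_def)

lemma closed_under_ops_torsion: "closed_under_ops (torsion k)"
  unfolding closed_under_ops_def
proof (intro conjI ballI allI impI)
  show "\<zero> \<in> torsion k" by (simp add: torsion_def sm_zero \<pi>_power_integral)
  show "x \<oplus> y \<in> torsion k" if "x \<in> torsion k" "y \<in> torsion k" for x y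
    using that by (simp add: torsion_def sm_distrib \<pi>_power_integral)
  show "a \<bullet> x \<in> torsion k" if "0 \<le> vF a" "x \<in> torsion k" for a x
  proof -
    have "\<pi> ^ k \<bullet> a \<bullet> x = a \<bullet> \<pi> ^ k \<bullet> x"
      using sm_mult[of "\<pi> ^ k" a x] sm_mult[of a "\<pi> ^ k" x] that torsion_carrier
      by (simp add: \<pi>_power_integral mult.commute)
    then show ?thesis using that by (auto simp: torsion_def sm_zero sm_closed)
  qed
qed

lemma torsion_1_smult: assumes "x \<in> torsion 1" "0 < vF a" shows "a \<bullet> x = \<zero>"
proof -
  obtain b where b: "0 \<le> vF b" "a = \<pi> * b" using \<pi>_dvd assms(2) by blast
  then have "a \<bullet> x = b \<bullet> \<pi> \<bullet> x"
    using sm_mult[of b \<pi> x] assms(1) \<pi>_pos by (simp add: torsion_def mult.commute[of \<pi>] less_imp_le)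
  then show ?thesis using assms(1) b by (simp add: torsion_def sm_zero)
qed

lemma lincomb_torsion_1:
  assumes e: "\<And>i. i < r \<Longrightarrow> e i \<in> torsion 1" and a: "\<And>i. i < r \<Longrightarrow> 0 < vF (a i)"
  shows "lincomb r a e = \<zero>"
  using assms by (induction r) (simp_all add: torsion_1_smult)

text \<open>On points killed by \<pi> a combination depends only on its coefficients modulo \<pi>.
  The functions from {..<r} to the q representatives therefore reach the whole span, and
  independence makes this parametrization injective.\<close>

lemma card_span:
  assumes e: "\<And>i. i < r \<Longrightarrow> e i \<in> torsion 1"
    and indep: "\<And>a. intseq a \<Longrightarrow> lincomb r a e = \<zero> \<Longrightarrow> (\<And>i. i < r \<Longrightarrow> 0 < vF (a i))"
  shows "card {lincomb r a e |a. intseq a} = q ^ r"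
proof -
  obtain R where R: "card R = q" "\<And>\<rho>. \<rho> \<in> R \<Longrightarrow> 0 \<le> vF \<rho>"
    "\<And>a. 0 \<le> vF a \<Longrightarrow> \<exists>!\<rho>. \<rho> \<in> R \<and> 0 < vF (a - \<rho>)"
    using residues by blast
  have eN: "\<forall>i<r. e i \<in> carrier N" using e torsion_carrier by blast
  define ext where "ext b = (\<lambda>i. if i < r then b i else (0::'f))" for b :: "nat \<Rightarrow> 'f"
  let ?P = "{..<r} \<rightarrow>\<^sub>E R"
  have ext: "intseq (ext b)" if "b \<in> ?P" for b
    using that R(2) by (auto simp: ext_def intseq_def)
  have inj: "inj_on (\<lambda>b. lincomb r (ext b) e) ?P"
  proof (rule inj_onI)
    fix b b' assume b: "b \<in> ?P" "b' \<in> ?P" "lincomb r (ext b) e = lincomb r (ext b') e"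
    have "lincomb r (\<lambda>i. ext b i - ext b' i) e = \<zero>"
      using lincomb_eq_diff[OF eN ext[OF b(1)] ext[OF b(2)]] b(3) by blast
    then have *: "0 < vF (ext b i - ext b' i)" if "i < r" for i
      using indep[OF intseq_diff[OF ext[OF b(1)] ext[OF b(2)]]] that by blast
    have "b i = b' i" if i: "i < r" for i
    proof -
      have bi: "b i \<in> R" "b' i \<in> R" using b i by auto
      moreover have "0 < vF (b i - b' i)" using *[OF i] i by (simp add: ext_def)
      moreover have "0 < vF (b i - b i)" by simp
      ultimately show ?thesis using R(3)[OF R(2)[OF bi(1)]] by blast
    qed
    then show "b = b'" using b(1,2) by (intro PiE_ext) auto
  qed
  have "{lincomb r a e |a. intseq a} = (\<lambda>b. lincomb r (ext b) e) ` ?P"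
  proof (intro equalityI subsetI)
    fix x assume "x \<in> {lincomb r a e |a. intseq a}"
    then obtain a where a: "intseq a" "x = lincomb r a e" by blast
    obtain b where b: "\<And>i. b i \<in> R" "\<And>i. 0 < vF (a i - b i)" using R(3)[OF intseqD[OF a(1)]] by metis
    define b' where "b' = (\<lambda>i\<in>{..<r}. b i)"
    have b': "b' \<in> ?P" using b by (simp add: b'_def)
    have "lincomb r (\<lambda>i. a i - ext b' i) e = \<zero>"
      using b by (intro lincomb_torsion_1 e) (auto simp: ext_def b'_def)
    then have "x = lincomb r (ext b') e"
      using lincomb_eq_diff[OF eN a(1) ext[OF b']] a(2) by simp
    then show "x \<in> (\<lambda>b. lincomb r (ext b) e) ` ?P" using b' by blast
  next
    fix x assume "x \<in> (\<lambda>b. lincomb r (ext b) e) ` ?P"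
    then show "x \<in> {lincomb r a e |a. intseq a}" using ext by blast
  qed
  then show ?thesis using inj R(1) by (simp add: card_image card_PiE)
qed

text \<open>An independent family of m < r elements spans q^m < q^r elements, so some x of
  \<open>C\<close> lies outside. In a relation involving x its coefficient must lie in the maximal
  ideal, since with a unit coefficient the relation could be solved for x.\<close>

lemma exists_basis:
  assumes C: "closed_under_ops C" "C \<subseteq> torsion 1" "card C = q ^ r"
  obtains e where "\<And>i. i < r \<Longrightarrow> e i \<in> C"
    "\<And>x. x \<in> C \<Longrightarrow> \<exists>a. intseq a \<and> x = lincomb r a e"
    "\<And>a i. intseq a \<Longrightarrow> lincomb r a e = \<zero> \<Longrightarrow> i < r \<Longrightarrow> 0 < vF (a i)"
proof -
  have fin: "finite C" using C(3) q_ge_2 by (intro card_ge_0_finite) simp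
  let ?indep = "\<lambda>m e. \<forall>a. intseq a \<longrightarrow> lincomb m a e = \<zero> \<longrightarrow> (\<forall>i<m. 0 < vF (a i))"
  have span: "{lincomb m a e |a. intseq a} \<subseteq> C \<and> card {lincomb m a e |a. intseq a} = q ^ m"
    if "\<forall>i<m. e i \<in> C" "?indep m e" for m e
    using that C(2) lincomb_in[OF C(1)] by (intro conjI card_span) auto
  have "\<exists>e. (\<forall>i<m. e i \<in> C) \<and> ?indep m e" if "m \<le> r" for m
    using that
  proof (induction m)
    case (Suc m)
    then obtain e where e: "\<forall>i<m. e i \<in> C" "?indep m e" by auto
    have "q ^ m < q ^ r" using Suc(2) q_ge_2 by (intro power_strict_increasing) auto
    then have "{lincomb m a e |a. intseq a} \<noteq> C" using span[OF e] C(3) by auto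
    then obtain x where x: "x \<in> C" "\<And>a. intseq a \<Longrightarrow> x \<noteq> lincomb m a e"
      using span[OF e] by blast
    define e' where "e' = e(m := x)"
    have cong: "lincomb m' a e' = lincomb m' a e" if "m' \<le> m" for m' a
      using that by (induction m') (simp_all add: e'_def)
    have xN: "x \<in> carrier N" using x(1) C(2) torsion_carrier by blast
    have eN: "\<forall>i<m. e i \<in> carrier N" using e(1) C(2) torsion_carrier by blast
    have "0 < vF (a i)" if a: "intseq a" "lincomb (Suc m) a e' = \<zero>" "i < Suc m" for a i
    proof -
      have eq: "a m \<bullet> x \<oplus> lincomb m a e = \<zero>" using a(2) cong[of m] by (simp add: e'_def)
      have am: "0 < vF (a m)"
      proof (rule ccontr)
        assume "\<not> 0 < vF (a m)"
        then have vam: "vF (a m) = 0" using intseqD[OF a(1), of m] by (simp add: le_less)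
        then have am0: "a m \<noteq> 0" by auto
        define c where "c = - inverse (a m)"
        have c: "c * a m = - 1" using am0 by (simp add: c_def)
        have vc: "0 \<le> vF c" using F.w_mult[of c "a m"] vam unfolding c by simp
        have "x = 1 \<bullet> x \<oplus> c \<bullet> \<zero>" using xN vc by (simp add: sm_one sm_zero)
        also have "c \<bullet> \<zero> = c \<bullet> (a m \<bullet> x \<oplus> lincomb m a e)" by (simp add: eq)
        also have "\<dots> = (- 1) \<bullet> x \<oplus> c \<bullet> lincomb m a e"
          using vc xN lincomb_closed[OF eN a(1)] intseqD[OF a(1)]
          by (simp add: sm_distrib sm_closed sm_mult[symmetric] c)
        also have "1 \<bullet> x \<oplus> ((- 1) \<bullet> x \<oplus> c \<bullet> lincomb m a e) = (1 \<bullet> x \<oplus> (- 1) \<bullet> x) \<oplus> c \<bullet> lincomb m a e"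
          using vc xN lincomb_closed[OF eN a(1)] by (simp add: sm_closed M.a_assoc)
        also have "1 \<bullet> x \<oplus> (- 1) \<bullet> x = \<zero>"
          using sm_add[of 1 "- 1" x] xN by (simp add: sm_zero)
        also have "\<zero> \<oplus> c \<bullet> lincomb m a e = lincomb m (\<lambda>i. c * a i) e"
          using vc lincomb_smult[OF eN a(1)] lincomb_closed[OF eN intseq_smult[OF vc a(1)]] by simp
        finally show False using x(2)[OF intseq_smult[OF vc a(1)]] by blast
      qed
      then have "a m \<bullet> x = \<zero>" using torsion_1_smult x(1) C(2) by blast
      then have "lincomb m a e = \<zero>" using eq lincomb_closed[OF eN a(1)] by simp
      then show ?thesis using e(2) a(1,3) am by (cases "i = m") auto
    qed
    moreover have "\<forall>i<Suc m. e' i \<in> C" using e(1) x(1) by (simp add: e'_def less_Suc_eq)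
    ultimately show ?case by blast
  qed simp
  then obtain e where e: "\<forall>i<r. e i \<in> C" "?indep r e" by blast
  have "{lincomb r a e |a. intseq a} = C"
    using span[OF e] C(3) fin by (intro card_subset_eq) auto
  then have "\<exists>a. intseq a \<and> x = lincomb r a e" if "x \<in> C" for x
    using that by blast
  then show ?thesis using that e by blast
qed

end


section \<open>Canonical submodules\<close>

text \<open>The slopes are tested against an arbitrary \<phi>: indicator functions yield the number
  of torsion points above a threshold, and \<phi> = min s yields \<eta>.\<close>

locale valued_module = dvr_module vF N \<pi> q
  for vF :: "'f::field \<Rightarrow> ereal" and N :: "('f, 'b, 'c) module_scheme" (structure) and \<pi> q +
  fixes w :: "'b \<Rightarrow> ereal" and n :: nat and lam :: "nat \<Rightarrow> real"
  assumes w_eq_inf: "x \<in> carrier N \<Longrightarrow> w x = \<infinity> \<longleftrightarrow> x = \<zero>"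
    and w_pos: "x \<in> carrier N \<Longrightarrow> 0 < w x"
    and w_minus: "x \<in> carrier N \<Longrightarrow> y \<in> carrier N \<Longrightarrow> c \<le> w x \<Longrightarrow> c \<le> w y \<Longrightarrow> c \<le> w (x \<ominus> y)"
    and w_sm: "0 \<le> vF a \<Longrightarrow> x \<in> carrier N \<Longrightarrow> w x \<le> w (a \<bullet> x)"
    and finite_torsion: "finite (torsion 1)"
    and slopes: "(\<Sum>h\<in>torsion 1 - {\<zero>}. \<phi> (w h)) =
      (\<Sum>i=1..n. (real q ^ i - real q ^ (i - 1)) * (\<phi> (ereal (lam i)) :: real))"
    and lam_antimono: "antimono_on {1..n} lam" and lam_pos: "\<forall>i\<in>{1..n}. 0 < lam i"
    and sm_\<pi>_surj: "x \<in> carrier N \<Longrightarrow> \<exists>y\<in>carrier N. \<pi> \<bullet> y = x"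
    and w_sm_\<pi>: "y \<in> carrier N \<Longrightarrow> w (\<pi> \<bullet> y) = (\<Sum>h\<in>torsion 1. w (y \<ominus> h))"
begin

lemma q1: "1 \<le> q" using q_ge_2 by simp

lemmas eta_simps = eta_eta_inv[OF q1 lam_pos] eta_le_iff[OF q1 lam_pos] slope_iter_Suc[OF q1 lam_pos]

lemma torsion_1: "torsion 1 = {x \<in> carrier N. \<pi> \<bullet> x = \<zero>}" "torsion (Suc 0) = {x \<in> carrier N. \<pi> \<bullet> x = \<zero>}"
  by (simp_all add: torsion_def)

lemma zero_torsion: "\<zero> \<in> torsion k"
  using closed_under_ops_torsion by (simp add: closed_under_ops_def)

lemma w_real: assumes "x \<in> carrier N" "x \<noteq> \<zero>" obtains r where "w x = ereal r" "0 < r"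
  using w_eq_inf[OF assms(1)] w_pos[OF assms(1)] assms(2) by (cases "w x") auto

lemma w_uminus: "x \<in> carrier N \<Longrightarrow> w x \<le> w (\<ominus> x)"
  using w_minus[of \<zero> x "w x"] w_eq_inf[of \<zero>] by (simp add: M.minus_eq)

lemma w_plus: "x \<in> carrier N \<Longrightarrow> y \<in> carrier N \<Longrightarrow> c \<le> w x \<Longrightarrow> c \<le> w y \<Longrightarrow> c \<le> w (x \<oplus> y)"
  using w_minus[of x "\<ominus> y" c] w_uminus[of y] order_trans[of c "w y"] by (simp add: M.minus_eq)

lemma \<pi>_integral: "0 \<le> vF \<pi>" using \<pi>_pos by simp

section \<open>Counting the \<pi>-torsion points by valuation\<close>

lemma sum_weights: "m \<le> n \<Longrightarrow> (\<Sum>i=1..m. real q ^ i - real q ^ (i - 1)) = real q ^ m - 1"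
  using sum_telescope''[of 0 m "\<lambda>i. real q ^ i"] by simp

lemma card_upper:
  "real (card {h \<in> torsion 1. h = \<zero> \<or> Q (w h)}) =
    1 + (\<Sum>i=1..n. (real q ^ i - real q ^ (i - 1)) * of_bool (Q (ereal (lam i))))"
proof -
  have "{h \<in> torsion 1. h = \<zero> \<or> Q (w h)} = insert \<zero> ((torsion 1 - {\<zero>}) \<inter> {h. Q (w h)})"
    using zero_torsion by auto
  then have "card {h \<in> torsion 1. h = \<zero> \<or> Q (w h)} = Suc (card ((torsion 1 - {\<zero>}) \<inter> {h. Q (w h)}))"
    using finite_torsion by simp
  moreover have "real (card ((torsion 1 - {\<zero>}) \<inter> {h. Q (w h)})) = (\<Sum>h\<in>torsion 1 - {\<zero>}. of_bool (Q (w h)))"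
    using finite_torsion by (simp add: sum_of_bool_eq)
  ultimately show ?thesis using slopes[of "\<lambda>x. of_bool (Q x)"] by simp
qed

lemma weight_nonneg: "0 \<le> real q ^ i - real q ^ (i - 1)"
  by (rule slope_weight_nonneg[OF q1 lam_pos])

text \<open>The weights telescope: the zero point together with the points belonging to the first m
  slopes makes q^m.\<close>

lemma card_upper_le:
  assumes "m \<le> n" "\<And>i. i \<in> {1..n} \<Longrightarrow> Q (ereal (lam i)) \<Longrightarrow> i \<le> m"
  shows "card {h \<in> torsion 1. h = \<zero> \<or> Q (w h)} \<le> q ^ m"
proof -
  have "(\<Sum>i=1..n. (real q ^ i - real q ^ (i - 1)) * of_bool (Q (ereal (lam i))))
      = (\<Sum>i=1..m. (real q ^ i - real q ^ (i - 1)) * of_bool (Q (ereal (lam i))))"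
    using assms by (intro sum.mono_neutral_right) auto
  also have "\<dots> \<le> (\<Sum>i=1..m. real q ^ i - real q ^ (i - 1))"
    using weight_nonneg by (intro sum_mono) auto
  finally have "real (card {h \<in> torsion 1. h = \<zero> \<or> Q (w h)}) \<le> real (q ^ m)"
    unfolding card_upper sum_weights[OF assms(1)] by simp
  then show ?thesis by (simp only: of_nat_le_iff)
qed

lemma card_upper_ge:
  assumes "m \<le> n" "\<And>i. i \<in> {1..m} \<Longrightarrow> Q (ereal (lam i))"
  shows "q ^ m \<le> card {h \<in> torsion 1. h = \<zero> \<or> Q (w h)}"
proof -
  have "(\<Sum>i=1..m. real q ^ i - real q ^ (i - 1))
      = (\<Sum>i=1..m. (real q ^ i - real q ^ (i - 1)) * of_bool (Q (ereal (lam i))))"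
    using assms by (intro sum.cong) auto
  also have "\<dots> \<le> (\<Sum>i=1..n. (real q ^ i - real q ^ (i - 1)) * of_bool (Q (ereal (lam i))))"
    using weight_nonneg assms(1) by (intro sum_mono2) auto
  finally have "real (q ^ m) \<le> real (card {h \<in> torsion 1. h = \<zero> \<or> Q (w h)})"
    unfolding card_upper sum_weights[OF assms(1)] by simp
  then show ?thesis by (simp only: of_nat_le_iff)
qed

lemma torsion_1_minus_zero:
  assumes "h \<in> torsion 1 - {\<zero>}" shows "w h = ereal (real_of_ereal (w h))"
proof -
  have "h \<in> carrier N" "h \<noteq> \<zero>" using assms torsion_carrier by auto
  from w_real[OF this] obtain r where "w h = ereal r" by blast
  then show ?thesis by simp
qed

lemma sum_min_eq_eta:
  "ereal s + (\<Sum>h\<in>torsion 1 - {\<zero>}. min (ereal s) (w h)) = ereal (eta q n lam s)"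
proof -
  have "(\<Sum>h\<in>torsion 1 - {\<zero>}. min (ereal s) (w h)) =
      (\<Sum>h\<in>torsion 1 - {\<zero>}. ereal (min s (real_of_ereal (w h))))"
  proof (rule sum.cong[OF refl])
    fix h assume "h \<in> torsion 1 - {\<zero>}"
    then show "min (ereal s) (w h) = ereal (min s (real_of_ereal (w h)))"
      by (subst torsion_1_minus_zero) auto
  qed
  also have "\<dots> = ereal (\<Sum>h\<in>torsion 1 - {\<zero>}. min s (real_of_ereal (w h)))"
    by (rule sum_ereal)
  finally show ?thesis
    using slopes[of "\<lambda>x. min s (real_of_ereal x)"] by (simp add: eta_def)
qed

lemma sum_torsion_split:
  assumes "y \<in> carrier N"
  shows "w (\<pi> \<bullet> y) = w y + (\<Sum>h\<in>torsion 1 - {\<zero>}. w (y \<ominus> h))"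
proof -
  have "y \<ominus> \<zero> = y" using assms by (simp add: M.minus_eq M.add.inv_one)
  then show ?thesis
    unfolding w_sm_\<pi>[OF assms] using finite_torsion zero_torsion
    by (subst sum.remove[of _ \<zero>]) simp_all
qed

text \<open>The product formula is estimated term by term with the ultrametric inequality; the term
  h = 0 accounts for the summand s of \<eta>.\<close>

lemma eta_le_w_sm_\<pi>:
  assumes y: "y \<in> carrier N" and s: "ereal s \<le> w y"
  shows "ereal (eta q n lam s) \<le> w (\<pi> \<bullet> y)"
  unfolding sum_torsion_split[OF y] sum_min_eq_eta[symmetric]
proof (intro add_mono s sum_mono)
  fix h assume "h \<in> torsion 1 - {\<zero>}"
  then have "h \<in> carrier N" using torsion_carrier by blast
  then show "min (ereal s) (w h) \<le> w (y \<ominus> h)"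
    using s y by (intro w_minus) (auto simp: min.coboundedI1)
qed

lemma minus_minus_self: "x \<in> carrier N \<Longrightarrow> y \<in> carrier N \<Longrightarrow> x \<ominus> (x \<ominus> y) = y"
  by (simp add: M.minus_eq M.minus_add M.r_neg2)

text \<open>A preimage \<open>y\<close> of maximal valuation satisfies \<open>w (y - h) = min (w y) (w h)\<close> for every
  \<open>h \<in> H[\<pi>]\<close>, so the product formula for \<open>w (\<pi> y)\<close> becomes \<open>\<eta> (w y)\<close>.\<close>

lemma exists_preimage_eta:
  assumes x: "x \<in> carrier N" "x \<noteq> \<zero>"
  obtains y s where "y \<in> carrier N" "\<pi> \<bullet> y = x" "w y = ereal s" "w x = ereal (eta q n lam s)"
proof -
  define S where "S = {y \<in> carrier N. \<pi> \<bullet> y = x}"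
  obtain y1 where y1: "y1 \<in> S" using sm_\<pi>_surj[OF x(1)] by (auto simp: S_def)
  \<comment> \<open>Two preimages differ by an element of H[\<pi>], so S is finite and the maximal
    valuation is attained.\<close>
  have "S \<subseteq> (\<lambda>h. y1 \<ominus> h) ` torsion 1"
  proof
    fix y assume y: "y \<in> S"
    have "y1 \<ominus> y \<in> torsion 1"
      using y y1 x(1) \<pi>_integral unfolding torsion_1 S_def by (auto simp: sm_minus M.r_neg M.minus_eq[of "\<pi> \<bullet> _"])
    then show "y \<in> (\<lambda>h. y1 \<ominus> h) ` torsion 1"
      using y y1 minus_minus_self[of y1 y] unfolding S_def by (intro image_eqI[of _ _ "y1 \<ominus> y"]) auto
  qed
  then have "finite S" using finite_torsion by (meson finite_imageI finite_subset)
  then have "Max (w ` S) \<in> w ` S" using y1 by (intro Max_in) auto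
  then obtain y where y: "y \<in> S" "w y = Max (w ` S)" by force
  have max: "w z \<le> w y" if "z \<in> S" for z using that \<open>finite S\<close> y(2) by simp
  have yN: "y \<in> carrier N" "\<pi> \<bullet> y = x" using y(1) by (auto simp: S_def)
  have "y \<noteq> \<zero>" using yN x(2) sm_zero(1)[OF \<pi>_integral] by auto
  then obtain s where s: "w y = ereal s" using w_real yN(1) by blast
  have "w (y \<ominus> h) = min (w y) (w h)" if h: "h \<in> torsion 1" for h
  proof (rule antisym)
    have hN: "h \<in> carrier N" "\<pi> \<bullet> h = \<zero>" using h by (auto simp: torsion_1)
    show "min (w y) (w h) \<le> w (y \<ominus> h)" using hN yN by (intro w_minus) auto
    have "y \<ominus> h \<in> S"
      using yN hN x(1) \<pi>_integral unfolding S_def by (auto simp: sm_minus M.minus_eq[of x] M.add.inv_one)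
    then have le: "w (y \<ominus> h) \<le> w y" by (rule max)
    \<comment> \<open>By maximality y is at least as close to 0 as y - h; then so is h = y - (y -
      h).\<close>
    have "w (y \<ominus> h) \<le> w (y \<ominus> (y \<ominus> h))" using yN hN le by (intro w_minus[OF yN(1) M.minus_closed]) auto
    then have "w (y \<ominus> h) \<le> w h" by (simp only: minus_minus_self[OF yN(1) hN(1)])
    then show "w (y \<ominus> h) \<le> min (w y) (w h)" using le by simp
  qed
  then have "w x = w y + (\<Sum>h\<in>torsion 1 - {\<zero>}. min (w y) (w h))"
    using sum_torsion_split[OF yN(1)] yN(2) by simp
  then show ?thesis using that[OF yN s] sum_min_eq_eta[of s] s by simp
qed

lemma preimage_ge:
  assumes x: "x \<in> carrier N" and c: "0 \<le> c" "ereal c \<le> w x"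
  obtains y where "y \<in> carrier N" "\<pi> \<bullet> y = x" "ereal (eta_inv q n lam c) \<le> w y"
proof (cases "x = \<zero>")
  case True
  then show ?thesis using that[of \<zero>] w_eq_inf[of \<zero>] sm_zero(1)[OF \<pi>_integral] by simp
next
  case False
  obtain y s where y: "y \<in> carrier N" "\<pi> \<bullet> y = x" "w y = ereal s" "w x = ereal (eta q n lam s)"
    using exists_preimage_eta[OF x False] by blast
  have "eta q n lam (eta_inv q n lam c) \<le> eta q n lam s" using c y(4) eta_simps(1)[of c] by simp
  then have "eta_inv q n lam c \<le> s" unfolding eta_simps(2) .
  then show ?thesis using that y by simp
qed

text \<open>The counterpart of \<open>preimage_ge\<close>: no preimage under \<pi> of a point of
  valuation c exceeds \<open>eta_inv c\<close>, and some preimage reaches it.\<close>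

lemma w_le_eta_inv:
  assumes y: "y \<in> carrier N" and c: "0 \<le> c" "w (\<pi> \<bullet> y) \<le> ereal c"
  shows "w y \<le> ereal (eta_inv q n lam c)"
proof -
  have "y \<noteq> \<zero>" using c(2) w_eq_inf[of \<zero>] sm_zero(1)[OF \<pi>_integral] by auto
  then obtain s where s: "w y = ereal s" using w_real y by blast
  have "ereal (eta q n lam s) \<le> ereal c" by (rule order_trans[OF eta_le_w_sm_\<pi>[OF y] c(2)]) (simp add: s)
  then have "eta q n lam s \<le> eta q n lam (eta_inv q n lam c)" using eta_simps(1)[OF c(1)] by simp
  then show ?thesis unfolding eta_simps(2) s by simp
qed

lemma sm_power_Suc: "x \<in> carrier N \<Longrightarrow> \<pi> ^ Suc j \<bullet> x = \<pi> \<bullet> \<pi> ^ j \<bullet> x" "x \<in> carrier N \<Longrightarrow> \<pi> ^ Suc j \<bullet> x = \<pi> ^ j \<bullet> \<pi> \<bullet> x"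
  using sm_mult[of \<pi> "\<pi> ^ j" x] sm_mult[of "\<pi> ^ j" \<pi> x] \<pi>_integral \<pi>_power_integral[of j]
  by (simp_all add: mult.commute)

lemma sm_power_add: "x \<in> carrier N \<Longrightarrow> \<pi> ^ (i + j) \<bullet> x = \<pi> ^ i \<bullet> \<pi> ^ j \<bullet> x"
  using sm_mult[of "\<pi> ^ i" "\<pi> ^ j" x] \<pi>_power_integral by (simp add: power_add)

text \<open>The candidate for the canonical subgroup. Being a ball in the torsion, it satisfies the
  separation condition for every radius; the rank and freeness depend on the radius.\<close>

definition tball :: "nat \<Rightarrow> real \<Rightarrow> 'b set" where
  "tball k c = {x \<in> torsion k. ereal c \<le> w x}"

lemma closed_under_ops_tball: "closed_under_ops (tball k c)"
  using closed_under_ops_torsion[of k] torsion_carrier w_eq_inf[of \<zero>]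
  by (auto simp: closed_under_ops_def tball_def intro: w_plus order_trans[OF _ w_sm])

section \<open>Canonical submodules of rank r and level k\<close>

context
  fixes r k :: nat
  assumes r: "1 \<le> r" "r < n" and k: "1 \<le> k"
begin

abbreviation slope where "slope j \<equiv> slope_iter q n lam j r"

lemma slope_nonneg: "1 \<le> j \<Longrightarrow> 0 \<le> slope j"
  using r by (intro slope_iter_nonneg[OF q1 lam_pos]) auto

lemma slope_1: "slope 1 = lam r"
  by (simp add: slope_iter_def)

lemma slope_le: "1 \<le> j \<Longrightarrow> j \<le> j' \<Longrightarrow> slope j' \<le> slope j"
  using r by (intro slope_iter_antimono[OF q1 lam_pos]) auto

lemma lam_le: "i \<in> {1..n} \<Longrightarrow> j \<in> {1..n} \<Longrightarrow> i \<le> j \<Longrightarrow> lam j \<le> lam i"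
  using lam_antimono by (auto simp: monotone_on_def)

lemma lift_to_level:
  assumes "x \<in> torsion 1" "ereal (lam r) \<le> w x"
  shows "\<exists>y\<in>carrier N. \<pi> ^ j \<bullet> y = x \<and> ereal (slope (Suc j)) \<le> w y"
proof (induction j)
  case 0
  then show ?case using assms torsion_carrier slope_1 by (intro bexI[of _ x]) (auto simp: sm_one)
next
  case (Suc j)
  then obtain y where y: "y \<in> carrier N" "\<pi> ^ j \<bullet> y = x" "ereal (slope (Suc j)) \<le> w y" by blast
  obtain z where z: "z \<in> carrier N" "\<pi> \<bullet> z = y" "ereal (eta_inv q n lam (slope (Suc j))) \<le> w z"
    using preimage_ge[OF y(1) _ y(3)] slope_nonneg by auto
  then show ?case using y eta_simps(3)[of "Suc j" r] sm_power_Suc(2) by (intro bexI[of _ z]) auto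
qed

lemma exists_basis_tball:
  assumes less: "lam (r + 1) < slope k"
  obtains e where "basis_mod k (tball k (slope k)) r e"
proof -
  have c: "slope k \<le> lam r" using slope_le[OF order_refl k] slope_1 by simp
  \<comment> \<open>As lam (r + 1) < slope k \<le> lam r, the thresholds lam r and slope k cut out
    the same q^r points of H[\<pi>]. The first is the one from which points lift to level k with
    valuation at least slope k; the second describes the \<pi>-torsion of the ball.\<close>
  define C where "C = tball 1 (lam r)"
  have tball_1: "tball 1 d = {h \<in> torsion 1. h = \<zero> \<or> ereal d \<le> w h}" for d
    using w_eq_inf[of \<zero>] by (auto simp: tball_def)
  have ge: "q ^ r \<le> card C"
    unfolding C_def tball_1 using r lam_le by (intro card_upper_ge) auto
  have le: "card (tball 1 (slope k)) \<le> q ^ r"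
    unfolding tball_1
  proof (rule card_upper_le)
    fix i assume i: "i \<in> {1..n}" "ereal (slope k) \<le> ereal (lam i)"
    show "i \<le> r"
    proof (rule ccontr)
      assume "\<not> i \<le> r"
      then have "lam i \<le> lam (r + 1)" using i(1) r by (intro lam_le) auto
      then show False using i(2) less by simp
    qed
  qed (use r in simp)
  have sub: "C \<subseteq> tball 1 (slope k)"
    using c by (auto simp: C_def tball_def elim: order_trans[rotated])
  have fin: "finite (tball 1 (slope k))" using finite_torsion by (simp add: tball_def)
  have C_eq: "C = tball 1 (slope k)" using card_seteq[OF fin sub] le ge by simp
  have card_C: "card C = q ^ r" using le ge C_eq by simp
  have C1: "C \<subseteq> torsion 1" by (auto simp: C_def tball_def)
  obtain e where e: "\<And>i. i < r \<Longrightarrow> e i \<in> C"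
    "\<And>x. x \<in> C \<Longrightarrow> \<exists>a. intseq a \<and> x = lincomb r a e"
    "\<And>a i. intseq a \<Longrightarrow> lincomb r a e = \<zero> \<Longrightarrow> i < r \<Longrightarrow> 0 < vF (a i)"
    using exists_basis[OF _ C1 card_C] closed_under_ops_tball[of 1 "lam r"] unfolding C_def by metis
  have "\<exists>y\<in>carrier N. \<pi> ^ (k - 1) \<bullet> y = e i \<and> ereal (slope k) \<le> w y" if "i < r" for i
    using lift_to_level[of "e i" "k - 1"] e(1)[OF that] k by (simp add: C_def tball_def)
  then obtain d where d: "\<And>i. i < r \<Longrightarrow> d i \<in> carrier N" "\<And>i. i < r \<Longrightarrow> \<pi> ^ (k - 1) \<bullet> d i = e i"
    "\<And>i. i < r \<Longrightarrow> ereal (slope k) \<le> w (d i)" by metis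
  have dN: "\<forall>i<r. d i \<in> carrier N" using d(1) by blast
  have d_tball: "d i \<in> tball k (slope k)" if i: "i < r" for i
  proof -
    have "\<pi> ^ Suc (k - 1) \<bullet> d i = \<zero>"
      using sm_power_Suc(1)[OF d(1)[OF i]] d(2)[OF i] e(1)[OF i] C1 by (auto simp: torsion_1)
    then show ?thesis using d(1,3)[OF i] k by (simp add: tball_def torsion_def)
  qed
  have lc_e: "lincomb r a e = \<pi> ^ (k - 1) \<bullet> lincomb r a d" if "intseq a" for a
  proof -
    have "lincomb r a e = lincomb r a (\<lambda>i. \<pi> ^ (k - 1) \<bullet> d i)" using d(2) by (intro lincomb_cong) auto
    then show ?thesis
      using lincomb_smult_right[OF dN that \<pi>_power_integral] lincomb_smult[OF dN that \<pi>_power_integral] by simp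
  qed
  \<comment> \<open>Induction on the power of \<pi> that kills y. If \<pi>^(j+1) y = 0, then \<pi>^j
    y lies in C and is a combination of the e i = \<pi>^(k-1) d i. The factor \<pi>^(k-1-j) in u
    makes \<pi>^j u equal to \<pi>^j y, so y - u is killed by \<pi>^j and stays in the ball.\<close>
  have gen: "\<exists>a. intseq a \<and> y = lincomb r a d" if "j \<le> k" "y \<in> tball j (slope k)" for j y
    using that
  proof (induction j arbitrary: y)
    case 0
    then have "y = \<zero>" by (auto simp: tball_def torsion_def sm_one)
    moreover have "lincomb r (\<lambda>_. 0) d = \<zero>"
      using d(1) by (induction r) (simp_all add: sm_zero)
    ultimately show ?case by (intro exI[of _ "\<lambda>_. 0"]) (simp add: intseq_def)
  next
    case (Suc j)
    have y: "y \<in> carrier N" "\<pi> ^ Suc j \<bullet> y = \<zero>" "ereal (slope k) \<le> w y"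
      using Suc.prems by (auto simp: tball_def torsion_def)
    have "\<pi> ^ j \<bullet> y \<in> tball 1 (slope k)"
      unfolding tball_def torsion_1
      using y sm_power_Suc(1)[OF y(1), of j] w_sm[OF \<pi>_power_integral y(1), of j]
      by (auto intro: sm_closed \<pi>_power_integral order_trans)
    then obtain a where a: "intseq a" "\<pi> ^ j \<bullet> y = lincomb r a e" using e(2) C_eq by blast
    define u where "u = lincomb r (\<lambda>i. \<pi> ^ (k - 1 - j) * a i) d"
    note b = intseq_smult[OF \<pi>_power_integral[of "k - 1 - j"] a(1)]
    have u: "u \<in> tball k (slope k)"
      unfolding u_def by (rule lincomb_in[OF closed_under_ops_tball d_tball b])
    then have uN: "u \<in> carrier N" by (auto simp: tball_def torsion_carrier)
    have "\<pi> ^ j \<bullet> u = \<pi> ^ j \<bullet> \<pi> ^ (k - 1 - j) \<bullet> lincomb r a d"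
      unfolding u_def lincomb_smult[OF dN a(1) \<pi>_power_integral] ..
    also have "\<dots> = \<pi> ^ (k - 1) \<bullet> lincomb r a d"
      using sm_power_add[OF lincomb_closed[OF dN a(1)], of j "k - 1 - j"] Suc.prems(1) by simp
    also have "\<dots> = \<pi> ^ j \<bullet> y" using lc_e[OF a(1)] a(2) by simp
    finally have "\<pi> ^ j \<bullet> (y \<ominus> u) = \<zero>"
      using y(1) uN sm_closed[OF \<pi>_power_integral y(1), of j]
      by (simp add: sm_minus[OF \<pi>_power_integral] M.minus_eq[of "\<pi> ^ j \<bullet> y"] M.r_neg)
    moreover have "ereal (slope k) \<le> w (y \<ominus> u)" using y u uN by (intro w_minus) (auto simp: tball_def)
    ultimately have "y \<ominus> u \<in> tball j (slope k)" using y(1) uN by (simp add: tball_def torsion_def)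
    then obtain a' where a': "intseq a'" "y \<ominus> u = lincomb r a' d" using Suc by force
    have "y = (y \<ominus> u) \<oplus> u" using y(1) uN by (simp add: M.minus_eq M.a_assoc M.l_neg)
    also have "\<dots> = lincomb r a' d \<oplus> u" by (simp only: a'(2))
    also have "\<dots> = lincomb r (\<lambda>i. a' i + \<pi> ^ (k - 1 - j) * a i) d"
      unfolding u_def by (rule lincomb_add[OF dN a'(1) b, symmetric])
    finally show ?case using a'(1) b by (intro exI[of _ "\<lambda>i. a' i + \<pi> ^ (k - 1 - j) * a i"]) (auto simp: intseq_def intro: F.w_add_ge)
  qed
  \<comment> \<open>One factor \<pi> is gained at a time: if a = \<pi>^j b, multiplying the relation
    by \<pi>^(k-1-j) gives a relation among the e i with coefficients b, which then lie in the
    maximal ideal.\<close>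
  have indep: "\<forall>i<r. \<exists>b. 0 \<le> vF b \<and> a i = \<pi> ^ j * b"
    if a: "intseq a" "lincomb r a d = \<zero>" and "j \<le> k" for a j
    using \<open>j \<le> k\<close>
  proof (induction j)
    case 0
    then show ?case using intseqD[OF a(1)] by auto
  next
    case (Suc j)
    then obtain b where b: "\<And>i. i < r \<Longrightarrow> 0 \<le> vF (b i) \<and> a i = \<pi> ^ j * b i" by (metis Suc_leD)
    define b' where "b' i = (if i < r then b i else 0)" for i
    have b': "intseq b'" using b by (simp add: b'_def intseq_def)
    have "lincomb r b' e = \<pi> ^ (k - 1 - j) \<bullet> \<pi> ^ j \<bullet> lincomb r b' d"
      using lc_e[OF b'] sm_power_add[OF lincomb_closed[OF dN b'], of "k - 1 - j" j] Suc.prems by simp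
    also have "\<pi> ^ j \<bullet> lincomb r b' d = lincomb r a d"
      unfolding lincomb_smult[OF dN b' \<pi>_power_integral] using b by (intro lincomb_cong) (auto simp: b'_def)
    finally have "lincomb r b' e = \<zero>" using a(2) by (simp add: sm_zero \<pi>_power_integral)
    then have pos: "0 < vF (b i)" if "i < r" for i using e(3)[OF b' _ that] that by (simp add: b'_def)
    show ?case
    proof (intro allI impI)
      fix i assume i: "i < r"
      obtain c where "0 \<le> vF c" "b i = \<pi> * c" using \<pi>_dvd[OF pos[OF i]] by blast
      then show "\<exists>b. 0 \<le> vF b \<and> a i = \<pi> ^ Suc j * b" using b[OF i] by (intro exI[of _ c]) simp
    qed
  qed
  have "basis_mod k (tball k (slope k)) r d"
    unfolding basis_mod_def using d_tball gen[OF order_refl] indep[OF _ _ order_refl] by blast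
  then show ?thesis using that by blast
qed

lemma slope_gt_if_canonical:
  assumes M: "closed_under_ops M" "M \<subseteq> torsion k" and basis: "basis_mod k M r e"
    and canonical: "\<And>x y. x \<in> M \<Longrightarrow> y \<in> torsion k - M \<Longrightarrow> w y < w x"
  shows "lam (r + 1) < slope k"
proof -
  have eM: "\<And>i. i < r \<Longrightarrow> e i \<in> M" using basis by (simp add: basis_mod_def)
  have eN: "\<forall>i<r. e i \<in> carrier N" using eM M(2) torsion_carrier by blast
  define e1 where "e1 i = \<pi> ^ (k - 1) \<bullet> e i" for i
  have lc_e1: "lincomb r a e1 = lincomb r (\<lambda>i. \<pi> ^ (k - 1) * a i) e" if "intseq a" for a
    unfolding e1_def by (rule lincomb_smult_right[OF eN that \<pi>_power_integral])
  have \<pi>k: "\<pi> * \<pi> ^ (k - 1) = \<pi> ^ k" using k by (cases k) auto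
  have indep: "\<forall>i<r. \<exists>b. 0 \<le> vF b \<and> a i = \<pi> ^ k * b" if "intseq a" "lincomb r a e = \<zero>" for a
    using basis that unfolding basis_mod_def by blast
  define M1 where "M1 = {x \<in> M. \<pi> \<bullet> x = \<zero>}"
  \<comment> \<open>If \<pi> kills x, the coefficients of \<pi> x are divisible by \<pi>^k, hence
    those of x by \<pi>^(k-1). So the family e1 generates the \<pi>-torsion of M.\<close>
  have M1_eq: "M1 = {lincomb r a e1 |a. intseq a}"
  proof (intro equalityI subsetI)
    fix x assume x: "x \<in> M1"
    then obtain a where a: "intseq a" "x = lincomb r a e" using basis by (auto simp: M1_def basis_mod_def)
    have "lincomb r (\<lambda>i. \<pi> * a i) e = \<zero>"
      using x a(2) lincomb_smult[OF eN a(1) \<pi>_integral] by (simp add: M1_def)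
    from indep[OF intseq_smult[OF \<pi>_integral a(1)] this]
    obtain b where b: "\<And>i. i < r \<Longrightarrow> 0 \<le> vF (b i) \<and> \<pi> * a i = \<pi> ^ k * b i" by metis
    define b' where "b' i = (if i < r then b i else 0)" for i
    have b': "intseq b'" using b by (simp add: b'_def intseq_def)
    have "a i = \<pi> ^ (k - 1) * b' i" if "i < r" for i
      using b[OF that] \<pi>_nonzero that by (simp add: \<pi>k[symmetric] b'_def mult.assoc)
    then have "x = lincomb r b' e1" unfolding lc_e1[OF b'] a(2) by (intro lincomb_cong) auto
    then show "x \<in> {lincomb r a e1 |a. intseq a}" using b' by blast
  next
    fix x assume "x \<in> {lincomb r a e1 |a. intseq a}"
    then obtain a where a: "intseq a" "x = \<pi> ^ (k - 1) \<bullet> lincomb r a e"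
      using lc_e1 lincomb_smult[OF eN _ \<pi>_power_integral, of _ "k - 1"] by auto
    have l: "lincomb r a e \<in> M" by (rule lincomb_in[OF M(1) eM a(1)])
    then have "x \<in> M" using M(1) a(2) \<pi>_power_integral by (auto simp: closed_under_ops_def)
    moreover have "\<pi> \<bullet> x = \<pi> ^ k \<bullet> lincomb r a e"
      using sm_power_Suc(1)[OF lincomb_closed[OF eN a(1)], of "k - 1"] a(2) k by simp
    ultimately show "x \<in> M1" using l M(2) by (auto simp: M1_def torsion_def)
  qed
  have M1_torsion: "M1 \<subseteq> torsion 1" using M(2) torsion_carrier by (auto simp: M1_def torsion_1)
  have card_M1: "card M1 = q ^ r"
    unfolding M1_eq
  proof (rule card_span)
    have id: "e1 i \<in> torsion 1" if i: "i < r" for i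
    proof -
      have "e i \<in> torsion k" using eM[OF i] M(2) by blast
      then show ?thesis using sm_power_Suc(1)[of "e i" "k - 1"] k
        by (simp add: torsion_def e1_def sm_closed \<pi>_power_integral)
    qed
    then show "e1 i \<in> torsion 1" if "i < r" for i using that .
    fix a i assume a: "intseq a" "lincomb r a e1 = \<zero>" "i < r"
    have "lincomb r (\<lambda>i. \<pi> ^ (k - 1) * a i) e = \<zero>" using a(2) lc_e1[OF a(1)] by simp
    from indep[OF intseq_smult[OF \<pi>_power_integral a(1)] this]
    obtain b where b: "0 \<le> vF b" "\<pi> ^ (k - 1) * a i = \<pi> ^ k * b" using a(3) by metis
    have "\<pi> ^ (k - 1) * a i = \<pi> ^ (k - 1) * (\<pi> * b)" using b(2) by (simp add: \<pi>k[symmetric] mult_ac)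
    then have "a i = \<pi> * b" using \<pi>_nonzero by simp
    then show "0 < vF (a i)" using b(1) \<pi>_pos by (simp add: F.w_mult add_pos_nonneg)
  qed
  \<comment> \<open>Valuations above lam r belong only to slopes of index at most r - 1, hence to at
    most q^(r-1) points including 0, too few for M1.\<close>
  have "\<exists>x\<in>M1. x \<noteq> \<zero> \<and> w x \<le> ereal (lam r)"
  proof (rule ccontr)
    assume "\<not> ?thesis"
    then have "M1 \<subseteq> {h \<in> torsion 1. h = \<zero> \<or> ereal (lam r) < w h}" using M1_torsion by auto
    then have "q ^ r \<le> card {h \<in> torsion 1. h = \<zero> \<or> ereal (lam r) < w h}"
      using card_mono[of "{h \<in> torsion 1. h = \<zero> \<or> ereal (lam r) < w h}" M1] card_M1 finite_torsion by simp
    also have "\<dots> \<le> q ^ (r - 1)"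
    proof (rule card_upper_le)
      fix i assume i: "i \<in> {1..n}" "ereal (lam r) < ereal (lam i)"
      show "i \<le> r - 1"
      proof (rule ccontr)
        assume "\<not> i \<le> r - 1"
        then have "lam i \<le> lam r" using i(1) r by (intro lam_le) auto
        then show False using i(2) by simp
      qed
    qed (use r in simp)
    also have "\<dots> < q ^ r" using q_ge_2 r by (intro power_strict_increasing) auto
    finally show False by simp
  qed
  then obtain x where x: "x \<in> M1" "x \<noteq> \<zero>" "w x \<le> ereal (lam r)" by blast
  \<comment> \<open>At least q^(r+1) points of H[\<pi>] have valuation at least lam (r + 1), too
    many for the q^r elements of M1.\<close>
  have "\<exists>h\<in>torsion 1 - M. ereal (lam (r + 1)) \<le> w h"
  proof (rule ccontr)
    assume no: "\<not> ?thesis"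
    have "{h \<in> torsion 1. h = \<zero> \<or> ereal (lam (r + 1)) \<le> w h} \<subseteq> M1"
      using no M(1) by (auto simp: M1_def torsion_1 closed_under_ops_def)
    then have "card {h \<in> torsion 1. h = \<zero> \<or> ereal (lam (r + 1)) \<le> w h} \<le> q ^ r"
      using card_mono[of M1] card_M1 finite_subset[OF M1_torsion finite_torsion] by metis
    moreover have "q ^ (r + 1) \<le> card {h \<in> torsion 1. h = \<zero> \<or> ereal (lam (r + 1)) \<le> w h}"
      using r lam_le by (intro card_upper_ge) auto
    moreover have "q ^ r < q ^ (r + 1)" using q_ge_2 by (intro power_strict_increasing) auto
    ultimately show False by linarith
  qed
  then obtain h where h: "h \<in> torsion 1" "h \<notin> M" "ereal (lam (r + 1)) \<le> w h" by blast
  have "h \<in> torsion k"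
    using h(1) sm_power_Suc(2)[of h "k - 1"] k by (auto simp: torsion_def sm_zero \<pi>_power_integral)
  obtain a where a: "intseq a" "x = \<pi> ^ (k - 1) \<bullet> lincomb r a e"
    using x(1) lc_e1 lincomb_smult[OF eN _ \<pi>_power_integral, of _ "k - 1"] unfolding M1_eq by auto
  define y where "y = lincomb r a e"
  have yM: "y \<in> M" unfolding y_def by (rule lincomb_in[OF M(1) eM a(1)])
  then have yN: "y \<in> carrier N" using M(2) torsion_carrier by blast
  \<comment> \<open>Descent from x = \<pi>^(k-1) y to y: each factor \<pi> removed costs one
    application of \<open>w_le_eta_inv\<close>, that is, one more step of the slope
    iteration.\<close>
  have "w (\<pi> ^ (k - Suc j) \<bullet> y) \<le> ereal (slope (Suc j))" if "j < k" for j
    using that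
  proof (induction j)
    case 0
    then show ?case using x(3) a(2) slope_1 by (simp add: y_def)
  next
    case (Suc j)
    define z where "z = \<pi> ^ (k - Suc (Suc j)) \<bullet> y"
    have zN: "z \<in> carrier N" unfolding z_def by (rule sm_closed[OF \<pi>_power_integral yN])
    have "\<pi> \<bullet> z = \<pi> ^ (k - Suc j) \<bullet> y"
      using sm_power_Suc(1)[OF yN, of "k - Suc (Suc j)"] Suc.prems by (simp add: z_def Suc_diff_Suc)
    then have "w (\<pi> \<bullet> z) \<le> ereal (slope (Suc j))" using Suc by simp
    then have "w z \<le> ereal (eta_inv q n lam (slope (Suc j)))"
      by (intro w_le_eta_inv[OF zN]) (auto intro: slope_nonneg)
    then show ?case using eta_simps(3)[of "Suc j" r] by (simp add: z_def)
  qed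
  from this[of "k - 1"] have "w y \<le> ereal (slope k)" using k yN by (simp add: sm_one)
  moreover have "w h < w y" using canonical yM h(2) \<open>h \<in> torsion k\<close> by blast
  ultimately have "ereal (lam (r + 1)) < ereal (slope k)" using h(3) by (meson le_less_trans less_le_trans)
  then show ?thesis by simp
qed

theorem canonical_iff:
  "(\<exists>M e. closed_under_ops M \<and> M \<subseteq> torsion k \<and> basis_mod k M r e \<and> (\<forall>x\<in>M. \<forall>y\<in>torsion k - M. w y < w x))
    \<longleftrightarrow> lam (r + 1) < slope k"
proof
  assume "lam (r + 1) < slope k"
  then obtain e where "basis_mod k (tball k (slope k)) r e" by (rule exists_basis_tball)
  moreover have "tball k (slope k) \<subseteq> torsion k" by (auto simp: tball_def)
  moreover have "w y < w x" if "x \<in> tball k (slope k)" "y \<in> torsion k - tball k (slope k)" for x y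
    using that by (auto simp: tball_def)
  ultimately show "\<exists>M e. closed_under_ops M \<and> M \<subseteq> torsion k \<and> basis_mod k M r e \<and>
      (\<forall>x\<in>M. \<forall>y\<in>torsion k - M. w y < w x)"
    using closed_under_ops_tball by blast
qed (use slope_gt_if_canonical in blast)

end

end


section \<open>The quotients \<open>\<O>/\<pi>\<^sup>k\<O>\<close>\<close>

lemma coset_valuation_ring: "a_r_coset (valuation_ring vF) I a = {x. x - a \<in> I}"
proof -
  have "(\<exists>h\<in>I. x = h + a) \<longleftrightarrow> x - a \<in> I" for x
    by (metis add_diff_cancel diff_add_cancel)
  then show ?thesis by (auto simp: a_r_coset_def')
qed

lemma carrier_Quot_valuation_ring:
  "carrier (valuation_ring vF Quot I) = {{x. x - a \<in> I} |a. 0 \<le> vF a}"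
  unfolding FactRing_simps ring_record_simps by (auto simp: coset_valuation_ring[unfolded a_r_coset_def] a_r_coset_def[symmetric] coset_valuation_ring)

lemma PIdl_valuation_ring: "PIdl\<^bsub>valuation_ring vF\<^esub> a = {a * b |b. 0 \<le> vF b}"
  by (auto simp: cgenideal_def mult.commute)

lemma (in valued_field) residue_representatives:
  "\<exists>R. card R = residue_card w \<and> (\<forall>\<rho>\<in>R. 0 \<le> w \<rho>) \<and> (\<forall>a. 0 \<le> w a \<longrightarrow> (\<exists>!\<rho>. \<rho> \<in> R \<and> 0 < w (a - \<rho>)))"
proof -
  let ?coset = "\<lambda>a. {x. x - a \<in> maximal_ideal w}"
  let ?Q = "carrier (valuation_ring w Quot maximal_ideal w)"
  have Q: "?Q = {?coset a |a. 0 \<le> w a}" by (rule carrier_Quot_valuation_ring)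
  have self: "a \<in> ?coset a" for a by (simp add: maximal_ideal_def)
  have eq: "?coset a = ?coset b \<longleftrightarrow> 0 < w (a - b)" for a b
  proof
    assume "?coset a = ?coset b"
    then show "0 < w (a - b)" using self[of a] by (simp add: maximal_ideal_def set_eq_iff)
  next
    assume ab: "0 < w (a - b)"
    have "0 < w (x - a) \<longleftrightarrow> 0 < w (x - b)" for x
    proof
      assume "0 < w (x - a)"
      then have "0 < w ((x - a) + (a - b))" using ab by (rule w_add_pos)
      then show "0 < w (x - b)" by simp
    next
      assume "0 < w (x - b)"
      then have "0 < w ((x - b) + - (a - b))" using ab by (intro w_add_pos) (auto simp: w_diff_commute)
      then show "0 < w (x - a)" by simp
    qed
    then show "?coset a = ?coset b" by (simp add: maximal_ideal_def)
  qed
  define rep where "rep C = (SOME a. a \<in> C)" for C :: "'a set"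
  have rep: "rep (?coset a) \<in> ?coset a" for a
    unfolding rep_def using self[of a] by (rule someI)
  have coset_rep: "?coset (rep (?coset a)) = ?coset a" for a
    unfolding eq using rep[of a] by (simp add: maximal_ideal_def)
  have inj: "inj_on rep ?Q"
  proof (rule inj_on_inverseI[of _ ?coset])
    fix C assume "C \<in> ?Q"
    then obtain a where "C = ?coset a" unfolding Q by blast
    then show "?coset (rep C) = C" by (simp only: coset_rep)
  qed
  have int: "0 \<le> w (rep (?coset a))" if "0 \<le> w a" for a
    using rep[of a] w_add_ge[of 0 "rep (?coset a) - a" a] that by (simp add: maximal_ideal_def)
  have "\<exists>!\<rho>. \<rho> \<in> rep ` ?Q \<and> 0 < w (a - \<rho>)" if a: "0 \<le> w a" for a
  proof (rule ex1I[of _ "rep (?coset a)"])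
    have "rep (?coset a) \<in> rep ` ?Q" unfolding Q using a by blast
    moreover have "0 < w (a - rep (?coset a))"
      using rep[of a] by (simp add: maximal_ideal_def w_diff_commute)
    ultimately show "rep (?coset a) \<in> rep ` ?Q \<and> 0 < w (a - rep (?coset a))" ..
    fix \<rho> assume \<rho>: "\<rho> \<in> rep ` ?Q \<and> 0 < w (a - \<rho>)"
    then obtain b where b: "\<rho> = rep (?coset b)" unfolding Q by blast
    have "?coset a = ?coset \<rho>" using \<rho> eq by blast
    also have "\<dots> = ?coset b" unfolding b by (rule coset_rep)
    finally show "\<rho> = rep (?coset a)" using b by (simp only:)
  qed
  moreover have "card (rep ` ?Q) = residue_card w"
    using inj by (simp add: card_image residue_card_def Coset.order_def)
  moreover have "\<forall>\<rho>\<in>rep ` ?Q. 0 \<le> w \<rho>" unfolding Q using int by blast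
  ultimately show ?thesis by blast
qed

section \<open>Modules over O/\<pi>^k as O-modules killed by \<pi>^k\<close>

context dvr_module begin

text \<open>Copies \<open>torsion_module\<close> field by field, so that the two records are equal
  for the module of points.\<close>

definition level_module :: "nat \<Rightarrow> ('f set, 'b) module" where
  "level_module k = \<lparr>carrier = torsion k, monoid.mult = undefined, one = undefined,
      ring.zero = \<zero>, add = (\<oplus>), module.smult = (\<lambda>C x. (SOME a. a \<in> C) \<bullet> x)\<rparr>"

lemma level_module_simps [simp]:
  "carrier (level_module k) = torsion k" "zero (level_module k) = \<zero>" "add (level_module k) = (\<oplus>)"
  "module.smult (level_module k) C x = (SOME a. a \<in> C) \<bullet> x"
  by (simp_all add: level_module_def)

definition coset :: "nat \<Rightarrow> 'f \<Rightarrow> 'f set" where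
  "coset k a = {x. \<exists>b. 0 \<le> vF b \<and> x - a = \<pi> ^ k * b}"

definition rep :: "'f set \<Rightarrow> 'f" where "rep C = (SOME a. a \<in> C)"

lemma carrier_O_mod: "carrier (O_mod vF \<pi> k) = coset k ` {a. 0 \<le> vF a}"
  unfolding O_mod_def carrier_Quot_valuation_ring PIdl_valuation_ring coset_def by auto

lemma rep_coset:
  obtains b where "0 \<le> vF b" "rep (coset k a) = a + \<pi> ^ k * b"
proof -
  have "a \<in> coset k a" by (auto simp: coset_def intro: exI[of _ 0])
  then have "rep (coset k a) \<in> coset k a" unfolding rep_def by (rule someI)
  then show ?thesis using that by (auto simp: coset_def algebra_simps)
qed

lemma rep_coset_integral: assumes "0 \<le> vF a" shows "0 \<le> vF (rep (coset k a))"
proof -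
  obtain b where "0 \<le> vF b" "rep (coset k a) = a + \<pi> ^ k * b" by (rule rep_coset)
  then show ?thesis
    using assms F.w_add_ge[of 0 a "\<pi> ^ k * b"] F.w_mult_nonneg[OF \<pi>_power_integral] by simp
qed

lemma coset_eqI:
  assumes c: "0 \<le> vF c" "a - b = \<pi> ^ k * c" shows "coset k a = coset k b"
proof -
  have "(\<exists>d. 0 \<le> vF d \<and> x - a = \<pi> ^ k * d) \<longleftrightarrow> (\<exists>d. 0 \<le> vF d \<and> x - b = \<pi> ^ k * d)" for x
  proof
    assume "\<exists>d. 0 \<le> vF d \<and> x - a = \<pi> ^ k * d"
    then obtain d where d: "0 \<le> vF d" "x - a = \<pi> ^ k * d" by blast
    have "x - b = (x - a) + (a - b)" by simp
    then have "x - b = \<pi> ^ k * (d + c)" by (simp only: d(2) c(2) distrib_left)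
    then show "\<exists>d. 0 \<le> vF d \<and> x - b = \<pi> ^ k * d" using c(1) d(1) F.w_add_ge by blast
  next
    assume "\<exists>d. 0 \<le> vF d \<and> x - b = \<pi> ^ k * d"
    then obtain d where d: "0 \<le> vF d" "x - b = \<pi> ^ k * d" by blast
    have "x - a = (x - b) - (a - b)" by simp
    then have "x - a = \<pi> ^ k * (d - c)" by (simp only: d(2) c(2) right_diff_distrib)
    then show "\<exists>d. 0 \<le> vF d \<and> x - a = \<pi> ^ k * d" using c(1) d(1) F.w_diff_ge by blast
  qed
  then show ?thesis by (simp add: coset_def)
qed

lemma coset_eqD:
  assumes "coset k a = coset k b" shows "\<exists>c. 0 \<le> vF c \<and> a - b = \<pi> ^ k * c"
proof -
  have "a \<in> coset k a" by (auto simp: coset_def intro: exI[of _ 0])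
  then have "a \<in> coset k b" using assms by simp
  then show ?thesis by (simp add: coset_def)
qed

lemma coset_rep_coset: "coset k (rep (coset k a)) = coset k a"
proof -
  obtain b where "0 \<le> vF b" "rep (coset k a) = a + \<pi> ^ k * b" by (rule rep_coset)
  then show ?thesis by (intro coset_eqI) auto
qed

text \<open>The chosen representative differs from a by a multiple of \<pi>^k, which kills x. So the
  choice inside the scalar multiplication has no effect on torsion points.\<close>

lemma sm_rep_coset:
  assumes x: "x \<in> torsion k" and a: "0 \<le> vF a" shows "rep (coset k a) \<bullet> x = a \<bullet> x"
proof -
  obtain b where b: "0 \<le> vF b" "rep (coset k a) = a + \<pi> ^ k * b" by (rule rep_coset)
  have xN: "x \<in> carrier N" using x by (rule torsion_carrier)
  have "(\<pi> ^ k * b) \<bullet> x = \<zero>"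
    using sm_mult[OF b(1) \<pi>_power_integral xN, of k] x b(1)
    by (simp add: torsion_def sm_zero mult.commute[of b])
  then show ?thesis
    using sm_add[OF a F.w_mult_nonneg[OF \<pi>_power_integral b(1)] xN, of k] b(2) sm_closed[OF a xN] by simp
qed

lemma sm_minus_one: assumes "x \<in> carrier N" shows "(- 1) \<bullet> x \<oplus> x = \<zero>"
  using sm_add[of "- 1" 1 x] assms by (simp add: sm_one sm_zero)

lemma abelian_group_level: "abelian_group (level_module k)"
proof (rule abelian_groupI)
  fix x assume "x \<in> carrier (level_module k)"
  then have x: "x \<in> torsion k" by simp
  then have "(- 1) \<bullet> x \<in> torsion k" using closed_under_ops_torsion[of k] by (auto simp: closed_under_ops_def)
  then show "\<exists>y\<in>carrier (level_module k). y \<oplus>\<^bsub>level_module k\<^esub> x = \<zero>\<^bsub>level_module k\<^esub>"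
    using sm_minus_one[OF torsion_carrier[OF x]] by auto
qed (use closed_under_ops_torsion[of k] torsion_carrier in
    \<open>auto simp: closed_under_ops_def intro: M.a_comm M.a_assoc M.l_zero\<close>)

text \<open>A submodule must contain inverses; these are multiples by -1, so closure under scalars
  in O provides them.\<close>

lemma submodule_level_iff:
  "submodule M (O_mod vF \<pi> k) (level_module k) \<longleftrightarrow> closed_under_ops M \<and> M \<subseteq> torsion k"
proof
  assume "submodule M (O_mod vF \<pi> k) (level_module k)"
  then interpret S: submodule M "O_mod vF \<pi> k" "level_module k" .
  have sub: "M \<subseteq> torsion k" using S.subset by simp
  have "a \<bullet> x \<in> M" if "0 \<le> vF a" "x \<in> M" for a x
  proof -
    have "module.smult (level_module k) (coset k a) x \<in> M"
      using that by (intro S.smult_closed) (auto simp: carrier_O_mod)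
    moreover have "rep (coset k a) \<bullet> x = a \<bullet> x" using that sub by (intro sm_rep_coset) auto
    ultimately show ?thesis by (simp only: level_module_simps rep_def[symmetric])
  qed
  then show "closed_under_ops M \<and> M \<subseteq> torsion k"
    using sub S.m_closed S.one_closed by (auto simp: closed_under_ops_def)
next
  assume M: "closed_under_ops M \<and> M \<subseteq> torsion k"
  interpret A: abelian_group "level_module k" by (rule abelian_group_level)
  show "submodule M (O_mod vF \<pi> k) (level_module k)"
  proof (intro submodule.intro subgroup.intro submodule_axioms.intro)
    fix x assume x: "x \<in> M"
    have mx: "(- 1) \<bullet> x \<in> M" using M x by (auto simp: closed_under_ops_def)
    have "\<ominus>\<^bsub>level_module k\<^esub> x = (- 1) \<bullet> x"
      using A.minus_equality[of "(- 1) \<bullet> x" x] M x mx sm_minus_one[of x] torsion_carrier by auto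
    then show "inv\<^bsub>add_monoid (level_module k)\<^esub> x \<in> M" using mx by (simp add: a_inv_def)
  next
    fix C x assume "C \<in> carrier (O_mod vF \<pi> k)" "x \<in> M"
    then show "C \<odot>\<^bsub>level_module k\<^esub> x \<in> M"
      using M rep_coset_integral by (auto simp: carrier_O_mod closed_under_ops_def rep_def)
  qed (use M in \<open>auto simp: closed_under_ops_def\<close>)
qed

lemma finsum_level:
  assumes "\<And>i. i < r \<Longrightarrow> e i \<in> torsion k" "\<And>i. i < r \<Longrightarrow> A i \<in> carrier (O_mod vF \<pi> k)"
  shows "(\<Oplus>\<^bsub>level_module k\<^esub>i\<in>{..<r}. A i \<odot>\<^bsub>level_module k\<^esub> e i) = lincomb r (\<lambda>i. rep (A i)) e"
  using assms
proof (induction r)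
  case 0
  interpret A: abelian_group "level_module k" by (rule abelian_group_level)
  show ?case using A.finsum_empty by simp
next
  case (Suc r)
  interpret A: abelian_group "level_module k" by (rule abelian_group_level)
  have mem: "A i \<odot>\<^bsub>level_module k\<^esub> e i \<in> carrier (level_module k)" if "i < Suc r" for i
    using Suc.prems[OF that] rep_coset_integral closed_under_ops_torsion[of k]
    by (auto simp: carrier_O_mod closed_under_ops_def rep_def)
  have "(\<Oplus>\<^bsub>level_module k\<^esub>i\<in>{..<Suc r}. A i \<odot>\<^bsub>level_module k\<^esub> e i) =
      A r \<odot>\<^bsub>level_module k\<^esub> e r \<oplus>\<^bsub>level_module k\<^esub> (\<Oplus>\<^bsub>level_module k\<^esub>i\<in>{..<r}. A i \<odot>\<^bsub>level_module k\<^esub> e i)"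
    unfolding lessThan_Suc using mem by (intro A.finsum_insert) auto
  then show ?case using Suc by (simp add: rep_def)
qed

text \<open>Tuples of classes and integral sequences are exchanged by \<open>ext\<close>, which
  picks representatives, and \<open>?cs\<close>, which takes classes. Surjectivity becomes
  generation, and injectivity becomes, on taking differences, divisibility of the coefficients of
  relations by \<pi>^k.\<close>

lemma free_level_iff:
  assumes M: "closed_under_ops M" "M \<subseteq> torsion k"
  shows "free_of_rank (O_mod vF \<pi> k) (level_module k) M r \<longleftrightarrow> (\<exists>e. basis_mod k M r e)"
proof -
  let ?P = "{..<r} \<rightarrow>\<^sub>E carrier (O_mod vF \<pi> k)"
  let ?cs = "\<lambda>a. \<lambda>i\<in>{..<r}. coset k (a i)"
  have "bij_betw (\<lambda>A. \<Oplus>\<^bsub>level_module k\<^esub>i\<in>{..<r}. A i \<odot>\<^bsub>level_module k\<^esub> e i) ?P M \<longleftrightarrow>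
      basis_mod k M r e" if e: "\<forall>i<r. e i \<in> M" for e
  proof -
    have et: "e i \<in> torsion k" if "i < r" for i using e M(2) that by blast
    have eN: "\<forall>i<r. e i \<in> carrier N" using et torsion_carrier by blast
    define g where "g A = lincomb r (\<lambda>i. rep (A i)) e" for A
    define ext where "ext A = (\<lambda>i. if i < r then rep (A i) else 0)" for A
    have g_ext: "g A = lincomb r (ext A) e" for A
      unfolding g_def by (intro lincomb_cong) (auto simp: ext_def)
    have ext: "intseq (ext A)" if "A \<in> ?P" for A
      unfolding intseq_def
    proof
      fix i
      show "0 \<le> vF (ext A i)"
      proof (cases "i < r")
        case True
        then have "A i \<in> coset k ` {a. 0 \<le> vF a}" using \<open>A \<in> ?P\<close> unfolding carrier_O_mod by auto
        then show ?thesis using rep_coset_integral True by (auto simp: ext_def)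
      qed (simp add: ext_def)
    qed
    have cs: "?cs a \<in> ?P" if "intseq a" for a
      using that by (auto simp: carrier_O_mod intseq_def)
    have g_cs: "g (?cs a) = lincomb r a e" if a: "intseq a" for a
    proof -
      have "lincomb m (\<lambda>i. rep (?cs a i)) e = lincomb m a e" if "m \<le> r" for m
        using that by (induction m) (simp_all add: sm_rep_coset[OF et intseqD[OF a]])
      then show ?thesis by (simp add: g_def)
    qed
    have coset_ext: "A i = coset k (ext A i)" if "A \<in> ?P" "i < r" for A i
    proof -
      have "A i \<in> carrier (O_mod vF \<pi> k)" using that by auto
      then show ?thesis using that(2) coset_rep_coset by (auto simp: ext_def carrier_O_mod)
    qed
    have "bij_betw (\<lambda>A. \<Oplus>\<^bsub>level_module k\<^esub>i\<in>{..<r}. A i \<odot>\<^bsub>level_module k\<^esub> e i) ?P M \<longleftrightarrow> bij_betw g ?P M"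
      unfolding g_def by (intro bij_betw_cong finsum_level et) auto
    also have "\<dots> \<longleftrightarrow> basis_mod k M r e"
    proof
      assume bij: "bij_betw g ?P M"
      have "\<exists>a. intseq a \<and> x = lincomb r a e" if "x \<in> M" for x
      proof -
        obtain A where "A \<in> ?P" "x = g A" using bij \<open>x \<in> M\<close> by (auto simp: bij_betw_def)
        then show ?thesis using ext g_ext by blast
      qed
      moreover have "\<exists>b. 0 \<le> vF b \<and> a i = \<pi> ^ k * b" if a: "intseq a" "lincomb r a e = \<zero>" and i: "i < r" for a i
      proof -
        have z: "intseq (\<lambda>_. 0)" by (simp add: intseq_def)
        have "lincomb r (\<lambda>_. 0) e = \<zero>"
          using lincomb_eq_diff[OF eN a(1) a(1)] by simp
        then have "g (?cs a) = g (?cs (\<lambda>_. 0))" using g_cs[OF a(1)] g_cs[OF z] a(2) by simp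
        then have "?cs a = ?cs (\<lambda>_. 0)"
          using bij cs[OF a(1)] cs[OF z] by (meson bij_betw_def inj_onD)
        then have "coset k (a i) = coset k 0" using i by (metis lessThan_iff restrict_apply')
        from coset_eqD[OF this] show ?thesis by simp
      qed
      ultimately show "basis_mod k M r e" using e unfolding basis_mod_def by blast
    next
      assume b: "basis_mod k M r e"
      show "bij_betw g ?P M"
        unfolding bij_betw_def
      proof (intro conjI inj_onI equalityI subsetI)
        fix A B assume AB: "A \<in> ?P" "B \<in> ?P" "g A = g B"
        have "lincomb r (\<lambda>i. ext A i - ext B i) e = \<zero>"
          using AB(3) lincomb_eq_diff[OF eN ext[OF AB(1)] ext[OF AB(2)]] by (simp add: g_ext)
        then have "\<forall>i<r. \<exists>c. 0 \<le> vF c \<and> ext A i - ext B i = \<pi> ^ k * c"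
          using b intseq_diff[OF ext[OF AB(1)] ext[OF AB(2)]] unfolding basis_mod_def by blast
        then have "coset k (ext A i) = coset k (ext B i)" if "i < r" for i using that coset_eqI by blast
        then have "A i = B i" if "i < r" for i
          using coset_ext[OF AB(1) that] coset_ext[OF AB(2) that] that by simp
        then show "A = B" using AB(1,2) by (intro PiE_ext) auto
      next
        fix x assume "x \<in> g ` ?P"
        then obtain A where "A \<in> ?P" "x = lincomb r (ext A) e" using g_ext by blast
        then show "x \<in> M" using lincomb_in[OF M(1), of r e] e ext by blast
      next
        fix x assume "x \<in> M"
        then obtain a where "intseq a" "x = lincomb r a e" using b by (auto simp: basis_mod_def)
        then show "x \<in> g ` ?P" using cs[of a] g_cs[of a] by (intro image_eqI[of _ _ "?cs a"]) auto
      qed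
    qed
    finally show ?thesis .
  qed
  moreover have "\<forall>i<r. e i \<in> M" if "basis_mod k M r e" for e using that by (simp add: basis_mod_def)
  ultimately show ?thesis unfolding free_of_rank_def by blast
qed

end


section \<open>Half-apartments\<close>

text \<open>Test points of the quarter with a single jump, of height c after index s. Varying s and
  c recovers i, j and b from a half-apartment.\<close>

definition step_vector :: "nat \<Rightarrow> nat \<Rightarrow> real \<Rightarrow> nat \<Rightarrow> real" where
  "step_vector n s c = (\<lambda>l\<in>{1..n}. if l \<le> s then 0 else c)"

lemma step_vector_in_half_apartment:
  assumes c: "0 \<le> c" and ij: "1 \<le> i" "i < j" "j \<le> n"
  shows "diagonal_rel n `` {step_vector n s c} \<in> half_apartment n i j b \<longleftrightarrow> i \<le> s \<and> s < j \<and> real b < c"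
proof -
  let ?S = "step_vector n s c"
  have S: "?S \<in> coord_vectors n" by (simp add: step_vector_def coord_vectors_def)
  have diff: "a l - a m = ?S l - ?S m"
    if "a \<in> diagonal_rel n `` {?S}" "l \<in> {1..n}" "m \<in> {1..n}" for a l m
    using that by (auto simp: diagonal_rel_def)
  have self: "?S \<in> diagonal_rel n `` {?S}"
    using S by (auto simp: diagonal_rel_def intro!: exI[of _ 0])
  have "diagonal_rel n `` {?S} \<in> apartment n"
    unfolding apartment_def using S by (rule quotientI)
  moreover have "mono_on {1..n} a" if a: "a \<in> diagonal_rel n `` {?S}" for a
  proof (rule mono_onI)
    fix l m assume lm: "l \<in> {1..n}" "m \<in> {1..n}" "l \<le> m"
    then have "0 \<le> ?S m - ?S l" using c by (simp add: step_vector_def)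
    then show "a l \<le> a m" using diff[OF a lm(2,1)] by simp
  qed
  ultimately have "diagonal_rel n `` {?S} \<in> quarter n" by (simp add: quarter_def)
  then have "diagonal_rel n `` {?S} \<in> half_apartment n i j b \<longleftrightarrow> (\<forall>a\<in>diagonal_rel n `` {?S}. real b < a j - a i)"
    by (simp add: half_apartment_def)
  also have "\<dots> \<longleftrightarrow> real b < ?S j - ?S i"
  proof (intro iffI ballI)
    show "real b < ?S j - ?S i" if "\<forall>a\<in>diagonal_rel n `` {?S}. real b < a j - a i"
      using that self by (rule bspec)
    show "real b < a j - a i" if "real b < ?S j - ?S i" "a \<in> diagonal_rel n `` {?S}" for a
      using that(1) diff[OF that(2), of j i] ij by simp
  qed
  also have "\<dots> \<longleftrightarrow> i \<le> s \<and> s < j \<and> real b < c"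
    using ij by (auto simp: step_vector_def)
  finally show ?thesis .
qed

text \<open>\<open>Newt_half_apartment\<close> quantifies over all ways of writing its argument;
  this makes the way unique. A jump higher than both bounds leaves the condition i \<le> s < j
  alone, which determines i and j; jumps of height b and b' at s = i then compare the
  bounds.\<close>

lemma half_apartment_eqD:
  assumes eq: "half_apartment n i j b = half_apartment n i' j' b'"
    and ij: "1 \<le> i" "i < j" "j \<le> n" and ij': "1 \<le> i'" "i' < j'" "j' \<le> n"
  shows "i = i' \<and> j = j' \<and> b = b'"
proof -
  have *: "i \<le> s \<and> s < j \<and> real b < c \<longleftrightarrow> i' \<le> s \<and> s < j' \<and> real b' < c" if "0 \<le> c" for s c
    using step_vector_in_half_apartment[OF that ij, of s b] step_vector_in_half_apartment[OF that ij', of s b'] eq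
    by simp
  have s: "i \<le> s \<and> s < j \<longleftrightarrow> i' \<le> s \<and> s < j'" for s
    using *[of "real b + real b' + 1" s] by simp
  have "i = i'" using s[of i] s[of i'] ij ij' by auto
  moreover have "j = j'" using s[of "j - 1"] s[of "j' - 1"] ij ij' by auto
  moreover have "b = b'" using *[of "real b" i] *[of "real b'" i] s[of i] ij by auto
  ultimately show ?thesis by blast
qed


section \<open>The theorem\<close>

lemma sum_mset_image_mset_sum:
  fixes f :: "'i \<Rightarrow> 'a multiset" and \<phi> :: "'a \<Rightarrow> 'c::comm_monoid_add"
  shows "finite I \<Longrightarrow> sum_mset (image_mset \<phi> (\<Sum>i\<in>I. f i)) = (\<Sum>i\<in>I. sum_mset (image_mset \<phi> (f i)))"
  by (induction I rule: finite_induct) simp_all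

lemma newton_slopes_sum:
  fixes \<phi> :: "ereal \<Rightarrow> real"
  assumes "newton_slopes w act \<pi> q n lam" and q: "1 \<le> q"
  shows "(\<Sum>h\<in>torsion_points w act \<pi> - {0}. \<phi> (w h)) =
    (\<Sum>i=1..n. (real q ^ i - real q ^ (i - 1)) * \<phi> (ereal (lam i)))"
proof -
  have "(\<Sum>h\<in>torsion_points w act \<pi> - {0}. \<phi> (w h)) =
      sum_mset (image_mset \<phi> (image_mset w (mset_set (torsion_points w act \<pi> - {0}))))"
    by (simp add: sum_unfold_sum_mset multiset.map_comp o_def)
  also have "\<dots> = (\<Sum>i=1..n. real (q ^ i - q ^ (i - 1)) * \<phi> (ereal (lam i)))"
    using assms(1) by (simp add: newton_slopes_def sum_mset_image_mset_sum)
  also have "\<dots> = (\<Sum>i=1..n. (real q ^ i - real q ^ (i - 1)) * \<phi> (ereal (lam i)))"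
    using q by (intro sum.cong) (auto simp: of_nat_diff power_increasing)
  finally show ?thesis .
qed


lemma size_sum_mset:
  fixes f :: "'i \<Rightarrow> 'a multiset"
  shows "finite I \<Longrightarrow> size (\<Sum>i\<in>I. f i) = (\<Sum>i\<in>I. size (f i))"
  by (induction I rule: finite_induct) simp_all

lemma newton_slopes_card:
  assumes lam: "newton_slopes w act \<pi> q n lam" and q: "2 \<le> q" and n: "1 \<le> n"
    and zero: "0 \<in> torsion_points w act \<pi>"
  shows "card (torsion_points w act \<pi>) = q ^ n"
proof -
  let ?H = "torsion_points w act \<pi>"
  have "card (?H - {0}) = size (image_mset w (mset_set (?H - {0})))" by simp
  also have "\<dots> = (\<Sum>i=1..n. q ^ i - q ^ (i - 1))"
    using lam by (simp add: newton_slopes_def size_sum_mset)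
  finally have "int (card (?H - {0})) = (\<Sum>i=1..n. int (q ^ i - q ^ (i - 1)))" by simp
  also have "\<dots> = (\<Sum>i=1..n. int q ^ i - int q ^ (i - 1))"
    using q by (intro sum.cong) (auto simp: of_nat_diff power_increasing)
  also have "\<dots> = int q ^ n - 1"
    using sum_telescope''[of 0 n "\<lambda>i. int q ^ i"] by simp
  finally have "int (card (?H - {0})) = int (q ^ n) - 1" by simp
  moreover have "1 < q ^ n" using q n by (intro one_less_power) auto
  ultimately have card: "card (?H - {0}) = q ^ n - 1" "0 < card (?H - {0})" by linarith+
  \<comment> \<open>\<open>mset_set\<close> and \<open>card\<close> have default values on infinite
    sets, so finiteness is a conclusion here: an infinite set would have \<open>card\<close>
    0.\<close>
  then have "finite (?H - {0})" by (intro card_ge_0_finite)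
  then have "finite ?H" by simp
  then show ?thesis using card zero by (simp add: card_Diff_singleton)
qed

theorem mainTheorem15:
  fixes p q n r k :: nat
    and vF :: "'f::field_char_0 \<Rightarrow> ereal" and \<pi> :: 'f
    and v :: "'k::field \<Rightarrow> ereal" and \<iota> :: "'f \<Rightarrow> 'k"
    and w :: "'k alg_closure \<Rightarrow> ereal"
    and F :: "'k fps fps" and act :: "'f \<Rightarrow> 'k fps"
    and lam :: "nat \<Rightarrow> real"
  assumes "prime p" and "padic_field p vF"
    and "uniformizer vF \<pi>" and "vF \<pi> = 1" and "q = residue_card vF"
    and "valuation v" and "vcomplete v UNIV"
    and "field_embedding \<iota>" and "\<And>x. v (\<iota> x) = vF x"
    and "valuation w" and "\<And>x. w (to_ac x) = v x"
    and "formal_O_module vF v \<iota> F act" and "has_height v q (act \<pi>) n"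
    and "newton_slopes w act \<pi> q n lam"
    and "1 \<le> r" and "r \<le> n - 1" and "1 \<le> k"
  shows "((\<exists>M. canonical_subgroup vF \<pi> w F act r k M) \<longleftrightarrow>
            lam \<in> Newt_half_apartment q n (half_apartment n r (r + 1) (k - 1))) \<and>
         ((\<exists>M. canonical_subgroup vF \<pi> w F act r k M) \<longleftrightarrow>
            slope_iter q n lam k r > lam (r + 1))"
proof -
  have "valuation vF" using assms(2) by (simp add: padic_field_def)
  interpret formal_module v w vF \<iota> F act
    using assms \<open>valuation vF\<close> by unfold_locales
  have v\<pi>: "v (\<iota> \<pi>) = 1" using assms(4,9) by simp
  have n: "1 \<le> n" "r < n" using assms(15,16) by auto
  have \<pi>0: "0 \<le> vF \<pi>" using assms(4) by simp
  \<comment> \<open>The height excludes small q: for q = 0 the index q^n is 0, where [\<pi>] has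
    coefficient 0; for q = 1 it is 1, where the coefficient has valuation 1 instead of 0.\<close>
  have q: "2 \<le> q"
  proof (rule ccontr)
    assume "\<not> 2 \<le> q"
    then consider "q = 0" | "q = 1" by linarith
    then show False
    proof cases
      case 1
      then show False using assms(13) n(1) act_0[OF \<pi>0] by (simp add: has_height_def zero_power)
    next
      case 2
      then show False using assms(13) act_1[OF \<pi>0] v\<pi> by (simp add: has_height_def)
    qed
  qed
  interpret height_module v w vF \<iota> F act \<pi> q n
    using assms(4,13) v\<pi> q by unfold_locales
  let ?H = "torsion_points w act \<pi>"
  have H: "?H = {h. 0 < w h \<and> smul \<pi> h = 0}" by (simp add: torsion_points_def)
  have card: "card ?H = q ^ n"
    by (rule newton_slopes_card[OF assms(14) q n(1)]) (simp add: H smul_zero[OF \<pi>0])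
  have fin: "finite ?H" using card q by (intro card_ge_0_finite) simp
  interpret D: dvr_module vF points \<pi> q
  proof (intro dvr_module.intro dvr_module_axioms.intro module_points)
    show "valued_field vF" by unfold_locales
    show "0 < vF \<pi>" by (simp add: assms(4))
    show "\<pi> \<noteq> 0" using assms(3) by (simp add: uniformizer_def)
    show "\<exists>b. 0 \<le> vF b \<and> a = \<pi> * b" if "0 < vF a" for a
    proof -
      have "a \<in> PIdl\<^bsub>valuation_ring vF\<^esub> \<pi>"
        using assms(3) that by (simp add: uniformizer_def maximal_ideal_def)
      then show ?thesis unfolding PIdl_valuation_ring by blast
    qed
    show "\<exists>R. card R = q \<and> (\<forall>\<rho>\<in>R. 0 \<le> vF \<rho>) \<and> (\<forall>a. 0 \<le> vF a \<longrightarrow> (\<exists>!\<rho>. \<rho> \<in> R \<and> 0 < vF (a - \<rho>)))"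
      using F.residue_representatives assms(5) by simp
  qed (rule q)
  have torsion: "D.torsion j = torsion_points w act (\<pi> ^ j)" for j
    by (auto simp: D.torsion_def torsion_points_def)
  have torsion_1: "D.torsion 1 = ?H" using torsion[of 1] by simp
  have lam: "antimono_on {1..n} lam" "\<forall>i\<in>{1..n}. 0 < lam i"
    using assms(14) by (auto simp: newton_slopes_def)
  interpret V: valued_module vF points \<pi> q w n lam
  proof
    fix x y assume x: "x \<in> carrier points" and y: "y \<in> carrier points"
    show "c \<le> w x \<Longrightarrow> c \<le> w y \<Longrightarrow> c \<le> w (x \<ominus>\<^bsub>points\<^esub> y)" for c
      using w_minus_points[of x y] x y by (auto intro: w_diff_ge)
  next
    fix x assume x: "x \<in> carrier points"
    show "w x = \<infinity> \<longleftrightarrow> x = \<zero>\<^bsub>points\<^esub>" "0 < w x" using x by auto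
    show "0 \<le> vF a \<Longrightarrow> w x \<le> w (a \<odot>\<^bsub>points\<^esub> x)" for a using smul_ge[of a x] x by simp
    obtain y where "0 < w y" "smul \<pi> y = x" using smul_surj x by auto
    then show "\<exists>y\<in>carrier points. \<pi> \<odot>\<^bsub>points\<^esub> y = x" by (intro bexI[of _ y]) auto
    have "w (x - h) = w (x \<ominus>\<^bsub>points\<^esub> h)" if "h \<in> ?H" for h
      using w_minus_points[of x h] x that by (simp add: H)
    then show "w (\<pi> \<odot>\<^bsub>points\<^esub> x) = (\<Sum>h\<in>D.torsion 1. w (x \<ominus>\<^bsub>points\<^esub> h))"
      using w_smul_\<pi>[OF H card, of x] x unfolding torsion_1 by simp
  next
    show "finite (D.torsion 1)" unfolding torsion_1 by (rule fin)
    show "(\<Sum>h\<in>D.torsion 1 - {\<zero>\<^bsub>points\<^esub>}. \<phi> (w h)) =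
        (\<Sum>i=1..n. (real q ^ i - real q ^ (i - 1)) * \<phi> (ereal (lam i)))" for \<phi>
      using newton_slopes_sum[OF assms(14), of \<phi>] q unfolding torsion_1 by simp
  qed (use lam in auto)
  have "torsion_module w F act \<pi> k = D.level_module k"
    unfolding torsion_module_def D.level_module_def torsion by (simp add: points_def)
  then have can: "canonical_subgroup vF \<pi> w F act r k M \<longleftrightarrow>
      D.closed_under_ops M \<and> M \<subseteq> D.torsion k \<and> (\<exists>e. D.basis_mod k M r e) \<and>
      (\<forall>x\<in>M. \<forall>y\<in>D.torsion k - M. w y < w x)" for M
    using D.submodule_level_iff[of M k] D.free_level_iff[of M k r]
    unfolding canonical_subgroup_def torsion[symmetric] by auto
  have iff: "(\<exists>M. canonical_subgroup vF \<pi> w F act r k M) \<longleftrightarrow> lam (r + 1) < slope_iter q n lam k r"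
    unfolding can V.canonical_iff[OF assms(15) n(2) assms(17), symmetric] by meson
  \<comment> \<open>Membership in \<open>Newt\<close> asks that the weighted slopes add up to 1.
    This normalization is not part of \<open>newton_slopes\<close>; it follows from
    \<open>sum_slopes\<close>.\<close>
  have "(\<Sum>h\<in>?H - {0}. w h) = ereal (\<Sum>h\<in>?H - {0}. real_of_ereal (w h))"
    using V.torsion_1_minus_zero unfolding torsion_1 by (simp flip: sum_ereal)
  then have "(\<Sum>h\<in>?H - {0}. real_of_ereal (w h)) = 1"
    using sum_slopes[OF H card] by simp
  then have Newt: "lam \<in> Newt q n"
    using newton_slopes_sum[OF assms(14), of real_of_ereal] q lam by (simp add: Newt_def)
  have "lam \<in> Newt_half_apartment q n (half_apartment n r (r + 1) (k - 1)) \<longleftrightarrow>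
      lam (r + 1) < slope_iter q n lam k r"
  proof
    assume "lam \<in> Newt_half_apartment q n (half_apartment n r (r + 1) (k - 1))"
    then obtain i j b where ij: "1 \<le> i" "i < j" "j \<le> n" "lam j < slope_iter q n lam (b + 1) i"
      and eq: "half_apartment n r (r + 1) (k - 1) = half_apartment n i j b"
      unfolding Newt_half_apartment_def by blast
    have "r = i \<and> r + 1 = j \<and> k - 1 = b"
      using half_apartment_eqD[OF eq] ij n assms(15) by simp
    moreover have "k - 1 + 1 = k" using assms(17) by simp
    ultimately show "lam (r + 1) < slope_iter q n lam k r" using ij(4) by metis
  next
    assume "lam (r + 1) < slope_iter q n lam k r"
    then have "1 \<le> r \<and> r < r + 1 \<and> r + 1 \<le> n \<and> lam (r + 1) < slope_iter q n lam (k - 1 + 1) r"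
      using n assms(15,17) by simp
    then show "lam \<in> Newt_half_apartment q n (half_apartment n r (r + 1) (k - 1))"
      unfolding Newt_half_apartment_def using Newt by blast
  qed
  then show ?thesis using iff by blast
qed

end
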